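(* Let $R$ be an almost factorial local noetherian ring. Then $\operatorname{Ass}_R(H^2_{(x,y)}(R))$ is finite for every $x,y\in R$.
   Context: Rings are commutative. A ring is called almost factorial if it is a Krull domain whose divisor class group is torsion. $H^j_I(R)$ denotes the $j$-th local cohomology module of $R$ with support in the ideal $I$, i.e. the $j$-th right derived functor of $\Gamma_I(M)=\{m\in M : I^n m=0 \text{ for some } n\}$, evaluated at $M=R$. $\operatorname{Ass}_R$ denotes the set of associated primes of an $R$-module. *)

theory Defs
  imports "HOL-Algebra.Algebra"
begin

section \<open>The field of fractions of a domain\<close>

definition frac_rel :: "('a, 'r) ring_scheme \<Rightarrow> (('a \<times> 'a) \<times> ('a \<times> 'a)) set"
  where "frac_rel R =
    {((a, b), (c, d)). a \<in> carrier R \<and> b \<in> carrier R - {\<zero>\<^bsub>R\<^esub>} \<and>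
       c \<in> carrier R \<and> d \<in> carrier R - {\<zero>\<^bsub>R\<^esub>} \<and> a \<otimes>\<^bsub>R\<^esub> d = c \<otimes>\<^bsub>R\<^esub> b}"

definition fraction :: "('a, 'r) ring_scheme \<Rightarrow> 'a \<Rightarrow> 'a \<Rightarrow> ('a \<times> 'a) set"
  where "fraction R a b = frac_rel R `` {(a, b)}"

definition frac_field :: "('a, 'r) ring_scheme \<Rightarrow> ('a \<times> 'a) set ring"
  where "frac_field R =
    \<lparr>carrier = (carrier R \<times> (carrier R - {\<zero>\<^bsub>R\<^esub>})) // frac_rel R,
     monoid.mult = (\<lambda>p q. \<Union>(a, b)\<in>p. \<Union>(c, d)\<in>q. fraction R (a \<otimes>\<^bsub>R\<^esub> c) (b \<otimes>\<^bsub>R\<^esub> d)),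
     one = fraction R \<one>\<^bsub>R\<^esub> \<one>\<^bsub>R\<^esub>,
     ring.zero = fraction R \<zero>\<^bsub>R\<^esub> \<one>\<^bsub>R\<^esub>,
     add = (\<lambda>p q. \<Union>(a, b)\<in>p. \<Union>(c, d)\<in>q.
              fraction R (a \<otimes>\<^bsub>R\<^esub> d \<oplus>\<^bsub>R\<^esub> c \<otimes>\<^bsub>R\<^esub> b) (b \<otimes>\<^bsub>R\<^esub> d))\<rparr>"

definition frac_embed :: "('a, 'r) ring_scheme \<Rightarrow> 'a \<Rightarrow> ('a \<times> 'a) set"
  where "frac_embed R a = fraction R a \<one>\<^bsub>R\<^esub>"

abbreviation frac_image :: "('a, 'r) ring_scheme \<Rightarrow> ('a \<times> 'a) set set"
  where "frac_image R \<equiv> frac_embed R ` carrier R"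

context domain
begin

lemma frac_rel_equiv: "equiv (carrier R \<times> (carrier R - {\<zero>})) (frac_rel R)"
proof (rule equivI)
  show "frac_rel R \<subseteq> (carrier R \<times> (carrier R - {\<zero>})) \<times> (carrier R \<times> (carrier R - {\<zero>}))"
    by (auto simp: frac_rel_def)
  show "refl_on (carrier R \<times> (carrier R - {\<zero>})) (frac_rel R)"
    by (auto simp: refl_on_def frac_rel_def)
  show "sym (frac_rel R)"
    by (auto simp: sym_def frac_rel_def)
  show "trans (frac_rel R)"
  proof (rule transI, clarify)
    fix a b c d e f
    assume 1: "((a, b), (c, d)) \<in> frac_rel R" and 2: "((c, d), (e, f)) \<in> frac_rel R"
    then have [simp]: "a \<in> carrier R" "b \<in> carrier R" "c \<in> carrier R" "d \<in> carrier R"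
      "e \<in> carrier R" "f \<in> carrier R" and nz: "b \<noteq> \<zero>" "d \<noteq> \<zero>" "f \<noteq> \<zero>"
      and e: "a \<otimes> d = c \<otimes> b" "c \<otimes> f = e \<otimes> d"
      by (auto simp: frac_rel_def)
    have "d \<otimes> (a \<otimes> f) = (a \<otimes> d) \<otimes> f" by (simp add: m_ac)
    also have "\<dots> = b \<otimes> (c \<otimes> f)" by (simp add: e(1) m_ac)
    also have "\<dots> = d \<otimes> (e \<otimes> b)" by (simp add: e(2) m_ac)
    finally have "a \<otimes> f = e \<otimes> b" using nz m_lcancel by simp
    then show "((a, b), (e, f)) \<in> frac_rel R" using nz by (simp add: frac_rel_def)
  qed
qed

lemma frac_eq_iff:
  assumes "a \<in> carrier R" "b \<in> carrier R - {\<zero>}" "c \<in> carrier R" "d \<in> carrier R - {\<zero>}"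
  shows "fraction R a b = fraction R c d \<longleftrightarrow> a \<otimes> d = c \<otimes> b"
proof -
  have "fraction R a b = fraction R c d \<longleftrightarrow> ((a, b), (c, d)) \<in> frac_rel R"
    unfolding fraction_def using assms by (intro eq_equiv_class_iff[OF frac_rel_equiv]) auto
  then show ?thesis using assms by (auto simp: frac_rel_def)
qed

lemma frac_memD:
  assumes "(c, d) \<in> fraction R a b"
  shows "a \<in> carrier R" "b \<in> carrier R - {\<zero>}" "c \<in> carrier R" "d \<in> carrier R - {\<zero>}"
    "a \<otimes> d = c \<otimes> b"
  using assms by (auto simp: fraction_def frac_rel_def)

lemma frac_self_mem:
  assumes "a \<in> carrier R" "b \<in> carrier R - {\<zero>}"
  shows "(a, b) \<in> fraction R a b"
  using assms by (auto simp: fraction_def frac_rel_def)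

lemma frac_closed [simp]:
  assumes "a \<in> carrier R" "b \<in> carrier R - {\<zero>}"
  shows "fraction R a b \<in> carrier (frac_field R)"
  using assms by (auto simp: frac_field_def fraction_def intro!: quotientI)

lemma frac_cases:
  assumes "u \<in> carrier (frac_field R)"
  obtains a b where "a \<in> carrier R" "b \<in> carrier R" "b \<noteq> \<zero>" "u = fraction R a b"
  using assms by (auto simp: frac_field_def fraction_def elim!: quotientE)

lemma nonzero_prod [simp]:
  assumes "b \<in> carrier R" "d \<in> carrier R" "b \<noteq> \<zero>" "d \<noteq> \<zero>"
  shows "b \<otimes> d \<noteq> \<zero>"
  using assms integral by blast

lemma frac_mult:
  assumes "a \<in> carrier R" "b \<in> carrier R" "b \<noteq> \<zero>" "c \<in> carrier R" "d \<in> carrier R" "d \<noteq> \<zero>"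
  shows "fraction R a b \<otimes>\<^bsub>frac_field R\<^esub> fraction R c d = fraction R (a \<otimes> c) (b \<otimes> d)"
proof -
  have *: "fraction R (a' \<otimes> c') (b' \<otimes> d') = fraction R (a \<otimes> c) (b \<otimes> d)"
    if p: "(a', b') \<in> fraction R a b" and q: "(c', d') \<in> fraction R c d" for a' b' c' d'
  proof -
    note p = frac_memD[OF p] and q = frac_memD[OF q]
    have "(a' \<otimes> c') \<otimes> (b \<otimes> d) = (a' \<otimes> b) \<otimes> (c' \<otimes> d)"
      using p(1-4) q(1-4) by (simp add: m_ac)
    also have "\<dots> = (a \<otimes> b') \<otimes> (c \<otimes> d')" by (simp only: p(5) q(5))
    also have "\<dots> = (a \<otimes> c) \<otimes> (b' \<otimes> d')" using p(1-4) q(1-4) by (simp add: m_ac)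
    finally show ?thesis using p q by (subst frac_eq_iff) auto
  qed
  have "fraction R a b \<otimes>\<^bsub>frac_field R\<^esub> fraction R c d
      = (\<Union>(a', b')\<in>fraction R a b. \<Union>(c', d')\<in>fraction R c d. fraction R (a' \<otimes> c') (b' \<otimes> d'))"
    by (simp add: frac_field_def)
  also have "\<dots> = (\<Union>(a', b')\<in>fraction R a b. \<Union>(c', d')\<in>fraction R c d. fraction R (a \<otimes> c) (b \<otimes> d))"
    using * by (intro SUP_cong refl) (auto intro!: SUP_cong)
  also have "\<dots> = fraction R (a \<otimes> c) (b \<otimes> d)"
    using frac_self_mem[of a b] frac_self_mem[of c d] assms by auto
  finally show ?thesis .
qed

lemma frac_add:
  assumes "a \<in> carrier R" "b \<in> carrier R" "b \<noteq> \<zero>" "c \<in> carrier R" "d \<in> carrier R" "d \<noteq> \<zero>"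
  shows "fraction R a b \<oplus>\<^bsub>frac_field R\<^esub> fraction R c d = fraction R (a \<otimes> d \<oplus> c \<otimes> b) (b \<otimes> d)"
proof -
  have *: "fraction R (a' \<otimes> d' \<oplus> c' \<otimes> b') (b' \<otimes> d') = fraction R (a \<otimes> d \<oplus> c \<otimes> b) (b \<otimes> d)"
    if p: "(a', b') \<in> fraction R a b" and q: "(c', d') \<in> fraction R c d" for a' b' c' d'
  proof -
    note p = frac_memD[OF p] and q = frac_memD[OF q]
    have "(a' \<otimes> d' \<oplus> c' \<otimes> b') \<otimes> (b \<otimes> d)
        = (a' \<otimes> b) \<otimes> (d \<otimes> d') \<oplus> (c' \<otimes> d) \<otimes> (b \<otimes> b')"
      using p(1-4) q(1-4) by (simp add: m_ac l_distr r_distr)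
    also have "\<dots> = (a \<otimes> b') \<otimes> (d \<otimes> d') \<oplus> (c \<otimes> d') \<otimes> (b \<otimes> b')"
      by (simp only: p(5) q(5))
    also have "\<dots> = (a \<otimes> d \<oplus> c \<otimes> b) \<otimes> (b' \<otimes> d')"
      using p(1-4) q(1-4) by (simp add: m_ac l_distr r_distr)
    finally show ?thesis using p q by (subst frac_eq_iff) auto
  qed
  have "fraction R a b \<oplus>\<^bsub>frac_field R\<^esub> fraction R c d
      = (\<Union>(a', b')\<in>fraction R a b. \<Union>(c', d')\<in>fraction R c d. fraction R (a' \<otimes> d' \<oplus> c' \<otimes> b') (b' \<otimes> d'))"
    by (simp add: frac_field_def)
  also have "\<dots> = (\<Union>(a', b')\<in>fraction R a b. \<Union>(c', d')\<in>fraction R c d.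
      fraction R (a \<otimes> d \<oplus> c \<otimes> b) (b \<otimes> d))"
    using * by (intro SUP_cong refl) (auto intro!: SUP_cong)
  also have "\<dots> = fraction R (a \<otimes> d \<oplus> c \<otimes> b) (b \<otimes> d)"
    using frac_self_mem[of a b] frac_self_mem[of c d] assms by auto
  finally show ?thesis .
qed

lemma frac_field_zero_one:
  "\<zero>\<^bsub>frac_field R\<^esub> = fraction R \<zero> \<one>" "\<one>\<^bsub>frac_field R\<^esub> = fraction R \<one> \<one>"
  by (simp_all add: frac_field_def)

lemma frac_field_is_field: "field (frac_field R)"
proof -
  have "cring (frac_field R)"
  proof (rule cringI)
    show "abelian_group (frac_field R)"
    proof (rule abelian_groupI)
      fix u assume u: "u \<in> carrier (frac_field R)"
      then obtain a b where [simp]: "a \<in> carrier R" "b \<in> carrier R" "b \<noteq> \<zero>" "u = fraction R a b"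
        by (rule frac_cases)
      show "\<exists>w\<in>carrier (frac_field R). w \<oplus>\<^bsub>frac_field R\<^esub> u = \<zero>\<^bsub>frac_field R\<^esub>"
      proof (rule bexI)
        show "fraction R (\<ominus> a) b \<oplus>\<^bsub>frac_field R\<^esub> u = \<zero>\<^bsub>frac_field R\<^esub>"
          by (simp add: frac_add frac_field_zero_one frac_eq_iff l_minus l_neg)
      qed simp
    qed (auto elim!: frac_cases simp: frac_add frac_field_zero_one frac_eq_iff
          l_distr r_distr m_ac a_ac)
    show "comm_monoid (frac_field R)"
      by (rule comm_monoidI)
        (auto elim!: frac_cases simp: frac_mult frac_field_zero_one frac_eq_iff m_ac)
    fix u v w
    assume "u \<in> carrier (frac_field R)" "v \<in> carrier (frac_field R)" "w \<in> carrier (frac_field R)"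
    then show "(u \<oplus>\<^bsub>frac_field R\<^esub> v) \<otimes>\<^bsub>frac_field R\<^esub> w =
      u \<otimes>\<^bsub>frac_field R\<^esub> w \<oplus>\<^bsub>frac_field R\<^esub> v \<otimes>\<^bsub>frac_field R\<^esub> w"
      by (elim frac_cases) (simp add: frac_mult frac_add frac_eq_iff l_distr r_distr m_ac)
  qed
  then show ?thesis
  proof (rule cring.cring_fieldI2)
    show "\<zero>\<^bsub>frac_field R\<^esub> \<noteq> \<one>\<^bsub>frac_field R\<^esub>"
      by (simp add: frac_field_zero_one frac_eq_iff)
    fix u assume u: "u \<in> carrier (frac_field R)" "u \<noteq> \<zero>\<^bsub>frac_field R\<^esub>"
    obtain a b where ab [simp]: "a \<in> carrier R" "b \<in> carrier R" "b \<noteq> \<zero>" "u = fraction R a b"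
      using u(1) by (rule frac_cases)
    with u have [simp]: "a \<noteq> \<zero>" by (auto simp: frac_field_zero_one frac_eq_iff)
    show "\<exists>w\<in>carrier (frac_field R). u \<otimes>\<^bsub>frac_field R\<^esub> w = \<one>\<^bsub>frac_field R\<^esub>"
      by (rule bexI[of _ "fraction R b a"])
        (simp_all add: frac_mult frac_field_zero_one frac_eq_iff m_ac)
  qed
qed

lemma frac_embed_hom: "frac_embed R \<in> ring_hom R (frac_field R)"
  by (rule ring_hom_memI) (auto simp: frac_embed_def frac_mult frac_add frac_field_zero_one)

lemma frac_embed_inj: "inj_on (frac_embed R) (carrier R)"
  by (rule inj_onI) (simp add: frac_embed_def frac_eq_iff)

lemma frac_eq_quotient:
  assumes "a \<in> carrier R" "b \<in> carrier R" "b \<noteq> \<zero>"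
  shows "frac_embed R b \<otimes>\<^bsub>frac_field R\<^esub> fraction R a b = frac_embed R a"
  using assms by (simp add: frac_embed_def frac_mult frac_eq_iff m_ac)

end

section \<open>Krull domains and almost factorial rings\<close>

text \<open>Normalised (surjective onto the integers) discrete valuations; the value at zero, which
  would be infinite, is left unspecified.\<close>

definition discrete_valuation :: "('k, 'r) ring_scheme \<Rightarrow> ('k \<Rightarrow> int) \<Rightarrow> bool"
  where "discrete_valuation K v \<longleftrightarrow>
    (\<forall>u\<in>carrier K - {\<zero>\<^bsub>K\<^esub>}. \<forall>w\<in>carrier K - {\<zero>\<^bsub>K\<^esub>}. v (u \<otimes>\<^bsub>K\<^esub> w) = v u + v w) \<and>
    (\<forall>u\<in>carrier K - {\<zero>\<^bsub>K\<^esub>}. \<forall>w\<in>carrier K - {\<zero>\<^bsub>K\<^esub>}.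
       u \<oplus>\<^bsub>K\<^esub> w \<noteq> \<zero>\<^bsub>K\<^esub> \<longrightarrow> min (v u) (v w) \<le> v (u \<oplus>\<^bsub>K\<^esub> w)) \<and>
    v ` (carrier K - {\<zero>\<^bsub>K\<^esub>}) = UNIV"

text \<open>A Krull domain is the intersection of the valuation rings of a family of discrete
  valuations of its field of fractions that is of finite character.  The empty family is
  allowed, so fields are Krull domains.\<close>

definition krull_domain :: "('a, 'r) ring_scheme \<Rightarrow> bool"
  where "krull_domain R \<longleftrightarrow> domain R \<and>
    (\<exists>V. (\<forall>v\<in>V. discrete_valuation (frac_field R) v) \<and>
         (\<forall>u\<in>carrier (frac_field R) - {\<zero>\<^bsub>frac_field R\<^esub>}. finite {v \<in> V. v u \<noteq> 0}) \<and>
         (\<forall>u\<in>carrier (frac_field R) - {\<zero>\<^bsub>frac_field R\<^esub>}.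
            u \<in> frac_image R \<longleftrightarrow> (\<forall>v\<in>V. 0 \<le> v u)))"

text \<open>The divisor class group: divisorial fractional ideals modulo principal ones, with
  \<open>(R : (R : I J))\<close> as the product of \<open>I\<close> and \<open>J\<close>.\<close>

definition fractional_ideal :: "('a, 'r) ring_scheme \<Rightarrow> ('a \<times> 'a) set set \<Rightarrow> bool"
  where "fractional_ideal R I \<longleftrightarrow>
    additive_subgroup I (frac_field R) \<and>
    (\<forall>a\<in>carrier R. \<forall>u\<in>I. frac_embed R a \<otimes>\<^bsub>frac_field R\<^esub> u \<in> I) \<and>
    I \<noteq> {\<zero>\<^bsub>frac_field R\<^esub>} \<and>
    (\<exists>d\<in>carrier R - {\<zero>\<^bsub>R\<^esub>}. \<forall>u\<in>I. frac_embed R d \<otimes>\<^bsub>frac_field R\<^esub> u \<in> frac_image R)"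

definition ring_colon :: "('a, 'r) ring_scheme \<Rightarrow> ('a \<times> 'a) set set \<Rightarrow> ('a \<times> 'a) set set"
  where "ring_colon R I =
    {u \<in> carrier (frac_field R). \<forall>w\<in>I. u \<otimes>\<^bsub>frac_field R\<^esub> w \<in> frac_image R}"

definition divisorial_ideal :: "('a, 'r) ring_scheme \<Rightarrow> ('a \<times> 'a) set set \<Rightarrow> bool"
  where "divisorial_ideal R I \<longleftrightarrow>
    fractional_ideal R I \<and> ring_colon R (ring_colon R I) = I"

definition divisor_group :: "('a, 'r) ring_scheme \<Rightarrow> ('a \<times> 'a) set set monoid"
  where "divisor_group R =
    \<lparr>carrier = {I. divisorial_ideal R I},
     monoid.mult = (\<lambda>I J. ring_colon R (ring_colon R (ideal_prod (frac_field R) I J))),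
     one = frac_image R\<rparr>"

definition principal_divisors :: "('a, 'r) ring_scheme \<Rightarrow> ('a \<times> 'a) set set set"
  where "principal_divisors R =
    {(\<lambda>w. u \<otimes>\<^bsub>frac_field R\<^esub> w) ` frac_image R | u.
       u \<in> carrier (frac_field R) - {\<zero>\<^bsub>frac_field R\<^esub>}}"

definition divisor_class_group :: "('a, 'r) ring_scheme \<Rightarrow> ('a \<times> 'a) set set set monoid"
  where "divisor_class_group R = divisor_group R Mod principal_divisors R"

definition torsion_group :: "('g, 'r) monoid_scheme \<Rightarrow> bool"
  where "torsion_group G \<longleftrightarrow> (\<forall>g\<in>carrier G. \<exists>n::nat. n > 0 \<and> g [^]\<^bsub>G\<^esub> n = \<one>\<^bsub>G\<^esub>)"

definition almost_factorial :: "('a, 'r) ring_scheme \<Rightarrow> bool"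
  where "almost_factorial R \<longleftrightarrow> krull_domain R \<and> torsion_group (divisor_class_group R)"

definition local_ring :: "('a, 'r) ring_scheme \<Rightarrow> bool"
  where "local_ring R \<longleftrightarrow> cring R \<and> (\<exists>!\<mm>. maximalideal \<mm> R)"

section \<open>Modules, injective resolutions and local cohomology\<close>

definition ring_module :: "('a, 'r) ring_scheme \<Rightarrow> ('a, 'a) module"
  where "ring_module R =
    \<lparr>carrier = carrier R, monoid.mult = monoid.mult R, one = \<one>\<^bsub>R\<^esub>, ring.zero = \<zero>\<^bsub>R\<^esub>,
     add = add R, smult = monoid.mult R\<rparr>"

lemma ring_module_is_module:
  assumes "cring R"
  shows "module R (ring_module R)"
proof -
  interpret R: cring R by fact
  have "abelian_group (ring_module R)"
  proof (rule abelian_groupI)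
    fix x assume "x \<in> carrier (ring_module R)"
    then show "\<exists>y\<in>carrier (ring_module R). y \<oplus>\<^bsub>ring_module R\<^esub> x = \<zero>\<^bsub>ring_module R\<^esub>"
      by (intro bexI[of _ "\<ominus>\<^bsub>R\<^esub> x"]) (simp_all add: ring_module_def R.l_neg)
  qed (auto simp: ring_module_def R.a_ac)
  then show ?thesis
    by (intro moduleI) (auto simp: ring_module_def R.is_cring R.l_distr R.r_distr R.m_assoc)
qed

definition mod_hom ::
    "('a, 'r) ring_scheme \<Rightarrow> ('a, 'm) module \<Rightarrow> ('a, 'n) module \<Rightarrow> ('m \<Rightarrow> 'n) set"
  where "mod_hom R M N =
    {f \<in> carrier M \<rightarrow> carrier N.
       (\<forall>x\<in>carrier M. \<forall>y\<in>carrier M. f (x \<oplus>\<^bsub>M\<^esub> y) = f x \<oplus>\<^bsub>N\<^esub> f y) \<and>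
       (\<forall>a\<in>carrier R. \<forall>x\<in>carrier M. f (a \<odot>\<^bsub>M\<^esub> x) = a \<odot>\<^bsub>N\<^esub> f x)}"

text \<open>The \<open>mult\<close> and \<open>one\<close> fields of a module record carry no information.\<close>

definition quot_module :: "('a, 'm) module \<Rightarrow> 'm set \<Rightarrow> ('a, 'm set) module"
  where "quot_module M N =
    \<lparr>carrier = a_rcosets\<^bsub>M\<^esub> N, monoid.mult = (\<lambda>_ _. N), one = N, ring.zero = N, add = set_add M,
     smult = (\<lambda>a S. \<Union>x\<in>S. N +>\<^bsub>M\<^esub> (a \<odot>\<^bsub>M\<^esub> x))\<rparr>"

lemma quot_module_is_module:
  assumes M: "module R M" and N: "submodule N R M"
  shows "module R (quot_module M N)"
proof -
  interpret M: module R M by fact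
  interpret N: submodule N R M by fact
  interpret A: abelian_subgroup N M
    using N.subgroup_axioms M.abelian_group_axioms
    by (intro abelian_subgroupI3 additive_subgroup.intro)
  have sm: "a \<odot>\<^bsub>quot_module M N\<^esub> (N +>\<^bsub>M\<^esub> x) = N +>\<^bsub>M\<^esub> (a \<odot>\<^bsub>M\<^esub> x)"
    if a: "a \<in> carrier R" and x: "x \<in> carrier M" for a x
  proof -
    have "N +>\<^bsub>M\<^esub> (a \<odot>\<^bsub>M\<^esub> y) = N +>\<^bsub>M\<^esub> (a \<odot>\<^bsub>M\<^esub> x)" if "y \<in> N +>\<^bsub>M\<^esub> x" for y
    proof -
      from that obtain h where h: "h \<in> N" "y = h \<oplus>\<^bsub>M\<^esub> x"
        by (auto simp: a_r_coset_def r_coset_def)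
      then have hM: "h \<in> carrier M" using A.a_subset by auto
      have "a \<odot>\<^bsub>M\<^esub> y \<in> N +>\<^bsub>M\<^esub> (a \<odot>\<^bsub>M\<^esub> x)"
        using h hM a x N.smult_closed[of a h]
        by (auto simp: a_r_coset_def r_coset_def M.smult_r_distr)
      then show ?thesis
        using a x A.a_repr_independence' by auto
    qed
    moreover have "x \<in> N +>\<^bsub>M\<^esub> x" using x A.a_rcos_self by blast
    ultimately have "(\<Union>y\<in>N +>\<^bsub>M\<^esub> x. N +>\<^bsub>M\<^esub> (a \<odot>\<^bsub>M\<^esub> y)) = N +>\<^bsub>M\<^esub> (a \<odot>\<^bsub>M\<^esub> x)" by blast
    then show ?thesis by (simp add: quot_module_def)
  qed
  have car: "carrier (quot_module M N) = (\<lambda>x. N +>\<^bsub>M\<^esub> x) ` carrier M"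
    by (auto simp: quot_module_def A_RCOSETS_def')
  have ad: "(N +>\<^bsub>M\<^esub> x) \<oplus>\<^bsub>quot_module M N\<^esub> (N +>\<^bsub>M\<^esub> y) = N +>\<^bsub>M\<^esub> (x \<oplus>\<^bsub>M\<^esub> y)"
    if "x \<in> carrier M" "y \<in> carrier M" for x y
    using that by (simp add: quot_module_def A.a_rcos_sum)
  have zq: "\<zero>\<^bsub>quot_module M N\<^esub> = N +>\<^bsub>M\<^esub> \<zero>\<^bsub>M\<^esub>"
    using A.a_subset by (simp add: quot_module_def M.a_coset_add_zero)
  show ?thesis
  proof (rule moduleI)
    show "cring R" by (rule M.is_cring)
    show "abelian_group (quot_module M N)"
    proof (rule abelian_groupI)
      fix p assume "p \<in> carrier (quot_module M N)"
      then obtain x where "x \<in> carrier M" "p = N +>\<^bsub>M\<^esub> x" by (auto simp: car)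
      then show "\<exists>q\<in>carrier (quot_module M N). q \<oplus>\<^bsub>quot_module M N\<^esub> p = \<zero>\<^bsub>quot_module M N\<^esub>"
        by (intro bexI[of _ "N +>\<^bsub>M\<^esub> (\<ominus>\<^bsub>M\<^esub> x)"]) (auto simp: car ad zq M.l_neg)
    qed (auto simp: car ad zq M.a_ac)
  qed (auto simp: car sm ad M.smult_l_distr M.smult_r_distr M.smult_assoc1)
qed

definition ass_primes :: "('a, 'r) ring_scheme \<Rightarrow> ('a, 'm) module \<Rightarrow> 'a set set"
  where "ass_primes R M =
    {\<pp>. primeideal \<pp> R \<and> (\<exists>m\<in>carrier M. \<pp> = {a \<in> carrier R. a \<odot>\<^bsub>M\<^esub> m = \<zero>\<^bsub>M\<^esub>})}"

text \<open>A definition cannot quantify over the modules of all types, so the lifting property is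
  required for modules whose carrier lives in the type of the ring.\<close>

definition injective_module :: "('a, 'r) ring_scheme \<Rightarrow> ('a, 'e) module \<Rightarrow> bool"
  where "injective_module R E \<longleftrightarrow> module R E \<and>
    (\<forall>(M :: ('a, 'a) module) (N :: ('a, 'a) module) i f.
       module R M \<and> module R N \<and> i \<in> mod_hom R M N \<and> inj_on i (carrier M) \<and> f \<in> mod_hom R M E
       \<longrightarrow> (\<exists>g\<in>mod_hom R N E. \<forall>x\<in>carrier M. g (i x) = f x))"

text \<open>By Baer's criterion this is no restriction.\<close>

lemma injective_module_extends:
  fixes R :: "('a, 'r) ring_scheme" and E :: "('a, 'e) module"
    and M :: "('a, 'm) module" and N :: "('a, 'n) module"
  assumes E: "injective_module R E" and M: "module R M" and N: "module R N"
    and i: "i \<in> mod_hom R M N" and inj: "inj_on i (carrier M)" and f: "f \<in> mod_hom R M E"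
  shows "\<exists>g\<in>mod_hom R N E. \<forall>x\<in>carrier M. g (i x) = f x"
proof -
  interpret M: module R M by fact
  interpret N: module R N by fact
  interpret E: module R E using E by (simp add: injective_module_def)
  define P where "P G \<longleftrightarrow> G \<subseteq> carrier N \<times> carrier E \<and> (\<lambda>x. (i x, f x)) ` carrier M \<subseteq> G \<and>
    (\<forall>n e n' e'. (n, e) \<in> G \<and> (n', e') \<in> G \<longrightarrow> (n \<oplus>\<^bsub>N\<^esub> n', e \<oplus>\<^bsub>E\<^esub> e') \<in> G) \<and>
    (\<forall>a n e. a \<in> carrier R \<and> (n, e) \<in> G \<longrightarrow> (a \<odot>\<^bsub>N\<^esub> n, a \<odot>\<^bsub>E\<^esub> e) \<in> G) \<and>
    (\<forall>e. (\<zero>\<^bsub>N\<^esub>, e) \<in> G \<longrightarrow> e = \<zero>\<^bsub>E\<^esub>)" for G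
  have hom: "i x \<in> carrier N" "f x \<in> carrier E" if "x \<in> carrier M" for x
    using that i f by (auto simp: mod_hom_def)
  have hom_add: "i (x \<oplus>\<^bsub>M\<^esub> y) = i x \<oplus>\<^bsub>N\<^esub> i y" "f (x \<oplus>\<^bsub>M\<^esub> y) = f x \<oplus>\<^bsub>E\<^esub> f y"
    if "x \<in> carrier M" "y \<in> carrier M" for x y
    using that i f by (auto simp: mod_hom_def)
  have hom_smult: "i (a \<odot>\<^bsub>M\<^esub> x) = a \<odot>\<^bsub>N\<^esub> i x" "f (a \<odot>\<^bsub>M\<^esub> x) = a \<odot>\<^bsub>E\<^esub> f x"
    if "x \<in> carrier M" "a \<in> carrier R" for x a
    using that i f by (auto simp: mod_hom_def)
  have hom_zero: "i \<zero>\<^bsub>M\<^esub> = \<zero>\<^bsub>N\<^esub>" "f \<zero>\<^bsub>M\<^esub> = \<zero>\<^bsub>E\<^esub>"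
    using hom_smult[of "\<zero>\<^bsub>M\<^esub>" "\<zero>\<^bsub>R\<^esub>"] hom[of "\<zero>\<^bsub>M\<^esub>"] by auto
  have P0: "P ((\<lambda>x. (i x, f x)) ` carrier M)"
  proof -
    have "f x = \<zero>\<^bsub>E\<^esub>" if "x \<in> carrier M" "i x = \<zero>\<^bsub>N\<^esub>" for x
      using that inj_onD[OF inj, of x "\<zero>\<^bsub>M\<^esub>"] hom_zero by auto
    then show ?thesis
      unfolding P_def
      by (auto simp: hom hom_add[symmetric] hom_smult[symmetric] image_iff eq_commute[of "\<zero>\<^bsub>N\<^esub>"])
  qed
  have "\<exists>G\<in>Collect P. \<forall>H\<in>Collect P. G \<subseteq> H \<longrightarrow> H = G"
  proof (rule subset_Zorn_nonempty)
    show "Collect P \<noteq> {}" using P0 by auto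
    fix C assume C: "C \<noteq> {}" "subset.chain (Collect P) C"
    then have CP: "P G" if "G \<in> C" for G using that by (auto simp: subset.chain_def)
    have two: "\<exists>K\<in>C. p \<in> K \<and> q \<in> K" if pq: "p \<in> \<Union>C" "q \<in> \<Union>C" for p q
    proof -
      obtain K L where KL: "K \<in> C" "p \<in> K" "L \<in> C" "q \<in> L" using pq by blast
      then have "K \<subseteq> L \<or> L \<subseteq> K" using C(2) by (simp add: subset_chain_def)
      then show ?thesis using KL by blast
    qed
    have "\<Union>C \<subseteq> carrier N \<times> carrier E" using CP unfolding P_def by blast
    moreover have "(\<lambda>x. (i x, f x)) ` carrier M \<subseteq> \<Union>C" using C(1) CP unfolding P_def by blast
    moreover have "(n \<oplus>\<^bsub>N\<^esub> n', e \<oplus>\<^bsub>E\<^esub> e') \<in> \<Union>C" if pq: "(n, e) \<in> \<Union>C" "(n', e') \<in> \<Union>C" for n e n' e'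
    proof -
      obtain K where "K \<in> C" "(n, e) \<in> K" "(n', e') \<in> K" using two[OF pq] by blast
      then show ?thesis using CP[of K] unfolding P_def by blast
    qed
    moreover have "(a \<odot>\<^bsub>N\<^esub> n, a \<odot>\<^bsub>E\<^esub> e) \<in> \<Union>C" if ae: "a \<in> carrier R" "(n, e) \<in> \<Union>C" for a n e
    proof -
      obtain K where "K \<in> C" "(n, e) \<in> K" using ae by blast
      then show ?thesis using ae CP[of K] unfolding P_def by blast
    qed
    moreover have "e = \<zero>\<^bsub>E\<^esub>" if e: "(\<zero>\<^bsub>N\<^esub>, e) \<in> \<Union>C" for e
    proof -
      obtain K where "K \<in> C" "(\<zero>\<^bsub>N\<^esub>, e) \<in> K" using e by blast
      then show ?thesis using CP[of K] unfolding P_def by blast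
    qed
    ultimately have "P (\<Union>C)"
      unfolding P_def by (intro conjI allI impI) (simp_all only: simp_thms)
    then show "\<Union>C \<in> Collect P" by simp
  qed
  then obtain G where PG: "P G" and maxG: "\<And>H. P H \<Longrightarrow> G \<subseteq> H \<Longrightarrow> H = G" by auto
  have Gc: "n \<in> carrier N" "e \<in> carrier E" if "(n, e) \<in> G" for n e
    using that PG by (auto simp: P_def)
  have Gi: "(i x, f x) \<in> G" if "x \<in> carrier M" for x
    using that PG by (auto simp: P_def)
  have Ga: "(n \<oplus>\<^bsub>N\<^esub> n', e \<oplus>\<^bsub>E\<^esub> e') \<in> G" if "(n, e) \<in> G" "(n', e') \<in> G" for n e n' e'
    using that PG unfolding P_def by blast
  have Gs: "(a \<odot>\<^bsub>N\<^esub> n, a \<odot>\<^bsub>E\<^esub> e) \<in> G" if "a \<in> carrier R" "(n, e) \<in> G" for a n e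
    using that PG unfolding P_def by blast
  have G0: "e = \<zero>\<^bsub>E\<^esub>" if "(\<zero>\<^bsub>N\<^esub>, e) \<in> G" for e
    using that PG unfolding P_def by blast
  have Gn: "(\<ominus>\<^bsub>N\<^esub> n, \<ominus>\<^bsub>E\<^esub> e) \<in> G" if "(n, e) \<in> G" for n e
    using Gs[of "\<ominus>\<^bsub>R\<^esub> \<one>\<^bsub>R\<^esub>", OF _ that] Gc[OF that] by (simp add: N.smult_l_minus E.smult_l_minus)
  have Gz: "(\<zero>\<^bsub>N\<^esub>, \<zero>\<^bsub>E\<^esub>) \<in> G" using Gi[of "\<zero>\<^bsub>M\<^esub>"] hom_zero by simp
  have Gu: "e = e'" if "(n, e) \<in> G" "(n, e') \<in> G" for n e e'
  proof -
    have "(n \<oplus>\<^bsub>N\<^esub> \<ominus>\<^bsub>N\<^esub> n, e \<oplus>\<^bsub>E\<^esub> \<ominus>\<^bsub>E\<^esub> e') \<in> G" using Ga[OF that(1) Gn[OF that(2)]] .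
    then have "e \<oplus>\<^bsub>E\<^esub> \<ominus>\<^bsub>E\<^esub> e' = \<zero>\<^bsub>E\<^esub>" using G0 Gc that by (simp add: N.M.r_neg)
    then show ?thesis using Gc that by (metis E.M.minus_equality E.M.minus_minus E.M.a_inv_closed E.M.a_comm)
  qed
  have dom: "n \<in> Domain G" if n: "n \<in> carrier N" for n
  proof -
    define J where "J = {a \<in> carrier R. a \<odot>\<^bsub>N\<^esub> n \<in> Domain G}"
    define \<phi> where "\<phi> a = (THE e. (a \<odot>\<^bsub>N\<^esub> n, e) \<in> G)" for a
    have \<phi>I: "\<phi> a = e" if "(a \<odot>\<^bsub>N\<^esub> n, e) \<in> G" for a e
      unfolding \<phi>_def using that Gu by blast
    have \<phi>: "(a \<odot>\<^bsub>N\<^esub> n, \<phi> a) \<in> G" if "a \<in> J" for a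
      using that \<phi>I by (auto simp: J_def)
    have Jadd: "a \<oplus>\<^bsub>R\<^esub> b \<in> J \<and> \<phi> (a \<oplus>\<^bsub>R\<^esub> b) = \<phi> a \<oplus>\<^bsub>E\<^esub> \<phi> b" if "a \<in> J" "b \<in> J" for a b
    proof -
      have "((a \<oplus>\<^bsub>R\<^esub> b) \<odot>\<^bsub>N\<^esub> n, \<phi> a \<oplus>\<^bsub>E\<^esub> \<phi> b) \<in> G"
        using Ga[OF \<phi>[OF that(1)] \<phi>[OF that(2)]] that n by (simp add: N.smult_l_distr J_def)
      then show ?thesis using \<phi>I that by (auto simp: J_def)
    qed
    have Jmul: "a \<otimes>\<^bsub>R\<^esub> b \<in> J \<and> \<phi> (a \<otimes>\<^bsub>R\<^esub> b) = a \<odot>\<^bsub>E\<^esub> \<phi> b" if "a \<in> carrier R" "b \<in> J" for a b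
    proof -
      have "((a \<otimes>\<^bsub>R\<^esub> b) \<odot>\<^bsub>N\<^esub> n, a \<odot>\<^bsub>E\<^esub> \<phi> b) \<in> G"
        using Gs[OF that(1) \<phi>[OF that(2)]] that n by (simp add: N.smult_assoc1 J_def)
      then show ?thesis using \<phi>I that by (auto simp: J_def)
    qed
    have rm: "module R (ring_module R)"
      by (rule ring_module_is_module[OF M.R.is_cring])
    have "submodule J R (ring_module R)"
    proof (rule module.submoduleI[OF rm])
      show "J \<subseteq> carrier (ring_module R)" by (auto simp: J_def ring_module_def)
      show z: "\<zero>\<^bsub>ring_module R\<^esub> \<in> J" using Gz n by (auto simp: J_def ring_module_def)
      fix a assume a: "a \<in> J"
      then have "(\<ominus>\<^bsub>R\<^esub> \<one>\<^bsub>R\<^esub>) \<otimes>\<^bsub>R\<^esub> a \<in> J" using Jmul by simp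
      moreover have "\<ominus>\<^bsub>ring_module R\<^esub> a = \<ominus>\<^bsub>R\<^esub> a"
        by (simp add: ring_module_def a_inv_def m_inv_def)
      ultimately show "\<ominus>\<^bsub>ring_module R\<^esub> a \<in> J" using a by (simp add: J_def M.R.l_minus)
    qed (use Jadd Jmul in \<open>auto simp: ring_module_def\<close>)
    then have Jm: "module R ((ring_module R)\<lparr>carrier := J\<rparr>)"
      by (rule submodule.submodule_is_module[OF _ rm])
    have "\<exists>\<psi>\<in>mod_hom R (ring_module R) E. \<forall>a\<in>carrier ((ring_module R)\<lparr>carrier := J\<rparr>). \<psi> (id a) = \<phi> a"
    proof -
      have "id \<in> mod_hom R ((ring_module R)\<lparr>carrier := J\<rparr>) (ring_module R)"
        by (auto simp: mod_hom_def J_def ring_module_def)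
      moreover have "\<phi> \<in> mod_hom R ((ring_module R)\<lparr>carrier := J\<rparr>) E"
        using Jadd Jmul Gc(2)[OF \<phi>] by (auto simp: mod_hom_def ring_module_def)
      ultimately show ?thesis
        using E rm Jm inj_on_id unfolding injective_module_def by blast
    qed
    then obtain \<psi> where \<psi>: "\<psi> \<in> mod_hom R (ring_module R) E" "\<And>a. a \<in> J \<Longrightarrow> \<psi> a = \<phi> a" by auto
    define e0 where "e0 = \<psi> \<one>\<^bsub>R\<^esub>"
    have e0: "e0 \<in> carrier E" using \<psi>(1) by (auto simp: e0_def mod_hom_def ring_module_def)
    have \<psi>e: "\<psi> a = a \<odot>\<^bsub>E\<^esub> e0" if "a \<in> carrier R" for a
    proof -
      have "\<psi> (a \<odot>\<^bsub>ring_module R\<^esub> \<one>\<^bsub>R\<^esub>) = a \<odot>\<^bsub>E\<^esub> \<psi> \<one>\<^bsub>R\<^esub>"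
        using \<psi>(1) that by (auto simp: mod_hom_def ring_module_def simp del: M.R.r_one)
      then show ?thesis using that by (simp add: e0_def ring_module_def)
    qed
    define H where "H = {(m \<oplus>\<^bsub>N\<^esub> a \<odot>\<^bsub>N\<^esub> n, e \<oplus>\<^bsub>E\<^esub> a \<odot>\<^bsub>E\<^esub> e0) | m e a. (m, e) \<in> G \<and> a \<in> carrier R}"
    have GH: "G \<subseteq> H"
    proof (rule subrelI)
      fix m e assume "(m, e) \<in> G"
      moreover from this have "(m, e) = (m \<oplus>\<^bsub>N\<^esub> \<zero>\<^bsub>R\<^esub> \<odot>\<^bsub>N\<^esub> n, e \<oplus>\<^bsub>E\<^esub> \<zero>\<^bsub>R\<^esub> \<odot>\<^bsub>E\<^esub> e0)"
        using Gc n e0 by auto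
      ultimately show "(m, e) \<in> H" unfolding H_def by blast
    qed
    have "P H"
      unfolding P_def
    proof (intro conjI allI impI)
      show "H \<subseteq> carrier N \<times> carrier E" using Gc n e0 by (auto simp: H_def)
      show "(\<lambda>x. (i x, f x)) ` carrier M \<subseteq> H" using Gi GH by auto
    next
      fix m e m' e' assume "(m, e) \<in> H \<and> (m', e') \<in> H"
      then obtain p q a p' q' a' where *: "(p, q) \<in> G" "a \<in> carrier R" "(p', q') \<in> G" "a' \<in> carrier R"
        "m = p \<oplus>\<^bsub>N\<^esub> a \<odot>\<^bsub>N\<^esub> n" "e = q \<oplus>\<^bsub>E\<^esub> a \<odot>\<^bsub>E\<^esub> e0" "m' = p' \<oplus>\<^bsub>N\<^esub> a' \<odot>\<^bsub>N\<^esub> n" "e' = q' \<oplus>\<^bsub>E\<^esub> a' \<odot>\<^bsub>E\<^esub> e0"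
        unfolding H_def by blast
      have "m \<oplus>\<^bsub>N\<^esub> m' = (p \<oplus>\<^bsub>N\<^esub> p') \<oplus>\<^bsub>N\<^esub> (a \<oplus>\<^bsub>R\<^esub> a') \<odot>\<^bsub>N\<^esub> n"
        "e \<oplus>\<^bsub>E\<^esub> e' = (q \<oplus>\<^bsub>E\<^esub> q') \<oplus>\<^bsub>E\<^esub> (a \<oplus>\<^bsub>R\<^esub> a') \<odot>\<^bsub>E\<^esub> e0"
        using * Gc[OF *(1)] Gc[OF *(3)] n e0
        by (simp_all add: N.smult_l_distr E.smult_l_distr N.M.a_ac E.M.a_ac)
      moreover have "(p \<oplus>\<^bsub>N\<^esub> p', q \<oplus>\<^bsub>E\<^esub> q') \<in> G" "a \<oplus>\<^bsub>R\<^esub> a' \<in> carrier R" using * Ga by auto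
      ultimately show "(m \<oplus>\<^bsub>N\<^esub> m', e \<oplus>\<^bsub>E\<^esub> e') \<in> H" unfolding H_def by blast
    next
      fix b m e assume b: "b \<in> carrier R \<and> (m, e) \<in> H"
      then obtain p q a where *: "(p, q) \<in> G" "a \<in> carrier R"
        "m = p \<oplus>\<^bsub>N\<^esub> a \<odot>\<^bsub>N\<^esub> n" "e = q \<oplus>\<^bsub>E\<^esub> a \<odot>\<^bsub>E\<^esub> e0"
        unfolding H_def by blast
      have "b \<odot>\<^bsub>N\<^esub> m = b \<odot>\<^bsub>N\<^esub> p \<oplus>\<^bsub>N\<^esub> (b \<otimes>\<^bsub>R\<^esub> a) \<odot>\<^bsub>N\<^esub> n"
        "b \<odot>\<^bsub>E\<^esub> e = b \<odot>\<^bsub>E\<^esub> q \<oplus>\<^bsub>E\<^esub> (b \<otimes>\<^bsub>R\<^esub> a) \<odot>\<^bsub>E\<^esub> e0"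
        using * b Gc[OF *(1)] n e0
        by (simp_all add: N.smult_r_distr E.smult_r_distr N.smult_assoc1 E.smult_assoc1)
      moreover have "(b \<odot>\<^bsub>N\<^esub> p, b \<odot>\<^bsub>E\<^esub> q) \<in> G" "b \<otimes>\<^bsub>R\<^esub> a \<in> carrier R" using * b Gs by auto
      ultimately show "(b \<odot>\<^bsub>N\<^esub> m, b \<odot>\<^bsub>E\<^esub> e) \<in> H" unfolding H_def by blast
    next
      fix e assume "(\<zero>\<^bsub>N\<^esub>, e) \<in> H"
      then obtain p q a where *: "(p, q) \<in> G" "a \<in> carrier R"
        "\<zero>\<^bsub>N\<^esub> = p \<oplus>\<^bsub>N\<^esub> a \<odot>\<^bsub>N\<^esub> n" "e = q \<oplus>\<^bsub>E\<^esub> a \<odot>\<^bsub>E\<^esub> e0"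
        unfolding H_def by blast
      have pq: "p \<in> carrier N" "q \<in> carrier E" using Gc *(1) by auto
      have "a \<odot>\<^bsub>N\<^esub> n = \<ominus>\<^bsub>N\<^esub> p"
        using * pq n by (metis N.M.a_comm N.M.minus_equality N.smult_closed)
      then have g: "(a \<odot>\<^bsub>N\<^esub> n, \<ominus>\<^bsub>E\<^esub> q) \<in> G" using Gn[OF *(1)] by simp
      then have "a \<in> J" using * by (auto simp: J_def)
      then have "a \<odot>\<^bsub>E\<^esub> e0 = \<ominus>\<^bsub>E\<^esub> q" using \<psi>(2) \<psi>e[OF *(2)] \<phi>I[OF g] by metis
      then show "e = \<zero>\<^bsub>E\<^esub>" using * pq by (simp add: E.M.r_neg)
    qed
    then have "H = G" using maxG GH by blast
    moreover have "(\<zero>\<^bsub>N\<^esub> \<oplus>\<^bsub>N\<^esub> \<one>\<^bsub>R\<^esub> \<odot>\<^bsub>N\<^esub> n, \<zero>\<^bsub>E\<^esub> \<oplus>\<^bsub>E\<^esub> \<one>\<^bsub>R\<^esub> \<odot>\<^bsub>E\<^esub> e0) \<in> H"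
      unfolding H_def using Gz by blast
    ultimately show ?thesis using n e0 by auto
  qed
  define g where "g n = (THE e. (n, e) \<in> G)" for n
  have gI: "g n = e" if "(n, e) \<in> G" for n e
    unfolding g_def using that Gu by blast
  have gG: "(n, g n) \<in> G" if "n \<in> carrier N" for n
    using dom[OF that] gI by auto
  have "g \<in> mod_hom R N E"
    unfolding mod_hom_def using gG Gc(2)[OF gG] by (auto intro!: gI Ga Gs)
  moreover have "\<forall>x\<in>carrier M. g (i x) = f x" using gI Gi by blast
  ultimately show ?thesis by blast
qed

definition injective_resolution ::
    "('a, 'r) ring_scheme \<Rightarrow> ('a, 'm) module \<Rightarrow> ('m \<Rightarrow> 'e) \<Rightarrow>
     (nat \<Rightarrow> ('a, 'e) module) \<Rightarrow> (nat \<Rightarrow> 'e \<Rightarrow> 'e) \<Rightarrow> bool"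
  where "injective_resolution R M \<epsilon> E d \<longleftrightarrow>
    module R M \<and> (\<forall>n. injective_module R (E n)) \<and>
    \<epsilon> \<in> mod_hom R M (E 0) \<and> (\<forall>n. d n \<in> mod_hom R (E n) (E (Suc n))) \<and>
    inj_on \<epsilon> (carrier M) \<and>
    \<epsilon> ` carrier M = {x \<in> carrier (E 0). d 0 x = \<zero>\<^bsub>E (Suc 0)\<^esub>} \<and>
    (\<forall>n. d n ` carrier (E n) = {x \<in> carrier (E (Suc n)). d (Suc n) x = \<zero>\<^bsub>E (Suc (Suc n))\<^esub>})"

definition torsion_functor ::
    "('a, 'r) ring_scheme \<Rightarrow> 'a set \<Rightarrow> ('a, 'm) module \<Rightarrow> ('a, 'm) module"
  where "torsion_functor R I M =
    M\<lparr>carrier := {m \<in> carrier M. \<exists>n::nat. \<forall>a\<in>I [^]\<^bsub>ideals_set R\<^esub> n. a \<odot>\<^bsub>M\<^esub> m = \<zero>\<^bsub>M\<^esub>}\<rparr>"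

definition cohomology ::
    "(nat \<Rightarrow> ('a, 'm) module) \<Rightarrow> (nat \<Rightarrow> 'm \<Rightarrow> 'm) \<Rightarrow> nat \<Rightarrow> ('a, 'm set) module"
  where "cohomology C d j =
    quot_module ((C j)\<lparr>carrier := {x \<in> carrier (C j). d j x = \<zero>\<^bsub>C (Suc j)\<^esub>}\<rparr>)
      (case j of 0 \<Rightarrow> {\<zero>\<^bsub>C 0\<^esub>} | Suc i \<Rightarrow> d i ` carrier (C i))"

text \<open>If \<open>(E, d)\<close> is an injective resolution of \<open>M\<close>, this is the value at \<open>M\<close> of the \<open>j\<close>-th
  right derived functor of the \<open>I\<close>-torsion functor (which acts on maps by restriction).  Up to
  isomorphism it does not depend on the resolution.  Resolutions exist once the type \<open>'e\<close> is
  large enough, for instance for \<open>'e = ('a + nat) set\<close>.\<close>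

definition local_cohomology ::
    "('a, 'r) ring_scheme \<Rightarrow> 'a set \<Rightarrow> (nat \<Rightarrow> ('a, 'e) module) \<Rightarrow> (nat \<Rightarrow> 'e \<Rightarrow> 'e) \<Rightarrow>
     nat \<Rightarrow> ('a, 'e set) module"
  where "local_cohomology R I E d j = cohomology (\<lambda>n. torsion_functor R I (E n)) d j"

end

theory Submission
  imports Defs
begin

text \<open>
  The idea is to compare local cohomology with the Cech complex and to make the two elements coprime.
  If \<open>x\<close> and \<open>y\<close> formed a regular sequence, \<open>H^2_{(x,y)}(R)\<close> would be the union of the modules
  \<open>R/(x^n, y^n)\<close> along injective maps, each with a finite filtration by copies of \<open>R/(x, y)\<close>.  All its
  associated primes would be associated primes of \<open>R/(x, y)\<close>, and these are finite in number because \<open>R\<close>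
  is noetherian.

  In an almost factorial ring this situation is reached up to a common factor.  For nonzero \<open>x\<close> and \<open>y\<close>,
  some power of the divisorial ideal generated by them is principal, say generated by \<open>g\<close> for the
  exponent \<open>N\<close>; valuations show that \<open>x^N\<close> and \<open>y^N\<close> already generate it as a divisorial ideal, so
  \<open>x^N = g s\<close> and \<open>y^N = g t\<close> where \<open>s\<close> and \<open>t\<close> have only trivial relations
  (\<open>almost_factorial_coprime_power\<close>).  If one of \<open>x\<close>, \<open>y\<close> is zero, such a factorization with the pair
  \<open>1, 0\<close> or \<open>0, 1\<close> exists with \<open>N = 1\<close>.  Replacing \<open>x, y\<close> by \<open>x^N, y^N\<close> does not change local cohomology, and the
  factor \<open>g\<close> only has the effect of localizing at \<open>g\<close>, which creates no new associated primes
  (\<open>cech_ann_prime\<close>).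

  The cohomology of an injective resolution enters only through annihilators: a diagram chase shows that
  the annihilator of every class equals that of some Cech class \<open>r / (g s g t)^n\<close>
  (\<open>annihilator_eq_cech_ann\<close>).  The chase needs an injective module only to solve two simultaneous linear
  equations (\<open>injective_solve\<close>), and the absence of nontrivial relations between \<open>s\<close> and \<open>t\<close> makes the
  equations solvable after multiplication by powers of \<open>g s\<close> and \<open>g t\<close> (\<open>coprime_lift\<close>).
\<close>

section \<open>Associated primes of cyclic modules\<close>

definition colon :: "('a, 'r) ring_scheme \<Rightarrow> 'a set \<Rightarrow> 'a \<Rightarrow> 'a set"
  where "colon R J z = {a \<in> carrier R. a \<otimes>\<^bsub>R\<^esub> z \<in> J}"

text \<open>The associated primes of the module \<open>R/J\<close>, without forming the quotient: \<open>colon R J z\<close> is the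
  annihilator of the class of \<open>z\<close>.\<close>
definition cyclic_ass :: "('a, 'r) ring_scheme \<Rightarrow> 'a set \<Rightarrow> 'a set set"
  where "cyclic_ass R J = {P. primeideal P R \<and> (\<exists>z\<in>carrier R. P = colon R J z)}"

lemma (in ring) ideal_if_closed:
  assumes "J \<subseteq> carrier R" "\<zero> \<in> J"
    and "\<And>a b. a \<in> J \<Longrightarrow> b \<in> J \<Longrightarrow> a \<oplus> b \<in> J"
    and "\<And>a b. a \<in> J \<Longrightarrow> b \<in> carrier R \<Longrightarrow> b \<otimes> a \<in> J"
    and "\<And>a b. a \<in> J \<Longrightarrow> b \<in> carrier R \<Longrightarrow> a \<otimes> b \<in> J"
  shows "ideal J R"
proof (rule idealI)
  show "subgroup J (add_monoid R)"
  proof (rule add.subgroupI)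
    fix a assume "a \<in> J"
    then have "(\<ominus> \<one>) \<otimes> a \<in> J" "a \<in> carrier R" using assms(1,4) by auto
    then show "\<ominus> a \<in> J" by (simp add: l_minus)
  qed (use assms in auto)
qed (use assms in \<open>auto intro: ring_axioms\<close>)

context cring
begin

lemma ideal_diff:
  assumes "ideal J R" "a \<in> J" "b \<in> J"
  shows "a \<ominus> b \<in> J"
  using assms by (simp add: a_minus_def additive_subgroup.a_closed additive_subgroup.a_inv_closed ideal.axioms(1))

lemma ideal_add:
  assumes "ideal J R" "a \<in> J" "b \<in> J"
  shows "a \<oplus> b \<in> J"
  using assms by (simp add: additive_subgroup.a_closed ideal.axioms(1))

lemma ideal_add_cancel:
  assumes "ideal J R" "a \<in> J" "b \<in> carrier R"
  shows "a \<oplus> b \<in> J \<longleftrightarrow> b \<in> J"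
proof
  assume *: "a \<oplus> b \<in> J"
  have a: "a \<in> carrier R" using assms ideal.Icarr by fast
  have "(a \<oplus> b) \<ominus> a = b" using a assms(3) by algebra
  then show "b \<in> J" using ideal_diff[OF assms(1) * assms(2)] by simp
qed (use assms ideal_add in auto)

lemma colon_ideal:
  assumes "ideal J R" "z \<in> carrier R"
  shows "ideal (colon R J z) R"
proof -
  interpret J: ideal J R by fact
  show ?thesis
  proof (rule ideal_if_closed)
    fix a b assume a: "a \<in> colon R J z" and b: "b \<in> carrier R"
    have "(b \<otimes> a) \<otimes> z = b \<otimes> (a \<otimes> z)" using a b assms by (simp add: colon_def m_assoc)
    then show "b \<otimes> a \<in> colon R J z" using a b J.I_l_closed by (simp add: colon_def)
    then show "a \<otimes> b \<in> colon R J z" using a b m_comm[of a b] by (simp add: colon_def)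
  qed (use assms in \<open>auto simp: colon_def l_distr J.Icarr\<close>)
qed

lemma colon_colon:
  assumes "z \<in> carrier R" "w \<in> carrier R"
  shows "colon R (colon R J z) w = colon R J (w \<otimes> z)"
  using assms by (auto simp: colon_def m_assoc)

lemma colon_prime:
  assumes "primeideal P R" "b \<in> carrier R" "b \<notin> P"
  shows "colon R P b = P"
proof -
  interpret P: primeideal P R by fact
  show ?thesis using assms P.I_prime P.I_r_closed P.Icarr by (auto simp: colon_def)
qed

text \<open>In a module, an element whose annihilator is a prime \<open>P\<close> generates a copy of \<open>R/P\<close>, and every
  nonzero element of \<open>R/P\<close> again has annihilator \<open>P\<close>.\<close>
lemma colon_mult_outside:
  assumes "primeideal (colon R J z) R" "z \<in> carrier R" "b \<in> carrier R" "b \<notin> colon R J z"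
  shows "colon R J (b \<otimes> z) = colon R J z"
  using colon_prime[OF assms(1,3,4)] assms colon_colon by simp

definition adjoin :: "'a set \<Rightarrow> 'a \<Rightarrow> 'a set"
  where "adjoin J z = {j \<oplus> c \<otimes> z | j c. j \<in> J \<and> c \<in> carrier R}"

lemma adjoinI: "j \<in> J \<Longrightarrow> c \<in> carrier R \<Longrightarrow> j \<oplus> c \<otimes> z \<in> adjoin J z"
  by (auto simp: adjoin_def)

lemma adjoinE:
  assumes "x \<in> adjoin J z"
  obtains j c where "j \<in> J" "c \<in> carrier R" "x = j \<oplus> c \<otimes> z"
  using assms by (auto simp: adjoin_def)

lemma adjoin_ideal:
  assumes "ideal J R" and z: "z \<in> carrier R"
  shows "ideal (adjoin J z) R"
proof -
  interpret J: ideal J R by fact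
  show ?thesis
  proof (rule ideal_if_closed)
    show "adjoin J z \<subseteq> carrier R" using z J.Icarr by (auto simp: adjoin_def)
    show "\<zero> \<in> adjoin J z" using adjoinI[of \<zero> J \<zero> z] z by simp
  next
    fix a b assume "a \<in> adjoin J z" "b \<in> adjoin J z"
    then obtain i j c d where *: "a = i \<oplus> c \<otimes> z" "b = j \<oplus> d \<otimes> z" "i \<in> J" "j \<in> J"
      "c \<in> carrier R" "d \<in> carrier R" by (auto simp: adjoin_def)
    moreover have "i \<in> carrier R" "j \<in> carrier R" using * J.Icarr by auto
    ultimately have "a \<oplus> b = (i \<oplus> j) \<oplus> (c \<oplus> d) \<otimes> z" using z by algebra
    then show "a \<oplus> b \<in> adjoin J z" using * adjoinI[of "i \<oplus> j" J "c \<oplus> d" z] by simp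
  next
    fix a b assume "a \<in> adjoin J z" and b: "b \<in> carrier R"
    then obtain i c where *: "a = i \<oplus> c \<otimes> z" "i \<in> J" "c \<in> carrier R" by (auto simp: adjoin_def)
    moreover have i: "i \<in> carrier R" using * J.Icarr by auto
    ultimately have "b \<otimes> a = b \<otimes> i \<oplus> (b \<otimes> c) \<otimes> z" using z b by algebra
    then show "b \<otimes> a \<in> adjoin J z" using * b J.I_l_closed adjoinI[of "b \<otimes> i" J "b \<otimes> c" z] by simp
    then show "a \<otimes> b \<in> adjoin J z" using m_comm[of a b] b i * z by simp
  qed
qed

lemma adjoin_superset:
  assumes "ideal J R" "z \<in> carrier R"
  shows "J \<subseteq> adjoin J z" "z \<in> adjoin J z"
proof -
  interpret J: ideal J R by fact
  show "J \<subseteq> adjoin J z"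
  proof
    fix j assume "j \<in> J"
    then show "j \<in> adjoin J z" using adjoinI[of j J \<zero> z] assms(2) J.Icarr by simp
  qed
  show "z \<in> adjoin J z" using adjoinI[of \<zero> J \<one> z] assms(2) by simp
qed

text \<open>Associated primes are subadditive in the exact sequence
  \<open>0 \<rightarrow> R/(J:z) \<rightarrow> R/J \<rightarrow> R/(J+Rz) \<rightarrow> 0\<close>.  If the prime \<open>Q\<close> is the annihilator of \<open>w\<close> in \<open>R/J\<close>, either
  some multiple \<open>a w\<close> with \<open>a \<notin> Q\<close> falls into the submodule generated by \<open>z\<close>, and it still has
  annihilator \<open>Q\<close>, or the annihilator of \<open>w\<close> does not grow on passing to \<open>R/(J+Rz)\<close>.\<close>
lemma cyclic_ass_subset:
  assumes J: "ideal J R" and z: "z \<in> carrier R"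
  shows "cyclic_ass R J \<subseteq> cyclic_ass R (adjoin J z) \<union> cyclic_ass R (colon R J z)"
proof
  fix Q assume "Q \<in> cyclic_ass R J"
  then obtain w where Q: "primeideal Q R" "w \<in> carrier R" "Q = colon R J w" by (auto simp: cyclic_ass_def)
  interpret J: ideal J R by fact
  show "Q \<in> cyclic_ass R (adjoin J z) \<union> cyclic_ass R (colon R J z)"
  proof (cases "colon R (adjoin J z) w \<subseteq> Q")
    case True
    then have "Q = colon R (adjoin J z) w"
      using Q(3) adjoin_superset(1)[OF J z] by (auto simp: colon_def)
    then show ?thesis using Q by (auto simp: cyclic_ass_def)
  next
    case False
    then obtain a where a: "a \<in> carrier R" "a \<otimes> w \<in> adjoin J z" "a \<notin> Q" by (auto simp: colon_def)
    then obtain j c where jc: "a \<otimes> w = j \<oplus> c \<otimes> z" "j \<in> J" "c \<in> carrier R" by (auto simp: adjoin_def)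
    have j: "j \<in> carrier R" using jc J.Icarr by auto
    have "Q = colon R J (a \<otimes> w)" using colon_mult_outside[of J w a] Q a by simp
    also have "\<dots> = colon R J (c \<otimes> z)"
    proof -
      have "b \<otimes> (j \<oplus> c \<otimes> z) \<in> J \<longleftrightarrow> b \<otimes> (c \<otimes> z) \<in> J" if b: "b \<in> carrier R" for b
        using ideal_add_cancel[OF J J.I_l_closed[OF jc(2) b], of "b \<otimes> (c \<otimes> z)"] b j jc(3) z
        by (simp add: r_distr)
      then show ?thesis using jc(1) by (auto simp: colon_def)
    qed
    also have "\<dots> = colon R (colon R J z) c" using colon_colon jc z by simp
    finally show ?thesis using Q jc by (auto simp: cyclic_ass_def)
  qed
qed

lemma cyclic_ass_prime:
  assumes "primeideal P R"
  shows "cyclic_ass R P \<subseteq> {P}"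
proof
  fix Q assume "Q \<in> cyclic_ass R P"
  then obtain w where Q: "primeideal Q R" "w \<in> carrier R" "Q = colon R P w" by (auto simp: cyclic_ass_def)
  interpret P: primeideal P R by fact
  interpret Q: primeideal Q R by fact
  show "Q \<in> {P}"
  proof (cases "w \<in> P")
    case True
    then have "colon R P w = carrier R" using P.I_l_closed by (auto simp: colon_def)
    then show ?thesis using Q.I_notcarr Q(3) by simp
  next
    case False
    then show ?thesis using colon_prime[OF assms Q(2)] Q(3) by simp
  qed
qed

text \<open>Noetherian induction: a maximal ideal \<open>M\<close> among those with infinitely many associated primes has an
  associated prime \<open>P = (M:z)\<close>, and the exact sequence for \<open>z\<close> bounds its associated primes by \<open>P\<close> and
  those of the strictly larger ideal \<open>M + Rz\<close>.\<close>
lemma finite_cyclic_ass: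
  assumes "noetherian_ring R" "ideal J R"
  shows "finite (cyclic_ass R J)"
proof (rule ccontr)
  interpret N: noetherian_ring R by fact
  assume J: "infinite (cyclic_ass R J)"
  define S where "S = {J. ideal J R \<and> infinite (cyclic_ass R J)}"
  have "\<exists>M\<in>S. \<forall>L\<in>S. M \<subseteq> L \<longrightarrow> L = M"
  proof (rule subset_Zorn_nonempty)
    show "S \<noteq> {}" using J assms by (auto simp: S_def)
    fix C assume C: "C \<noteq> {}" "subset.chain S C"
    then have "subset.chain {I. ideal I R} C" by (auto simp: subset_chain_def S_def)
    then show "\<Union>C \<in> S" using C N.ideal_chain_is_trivial by (auto simp: subset_chain_def)
  qed
  then obtain M where M: "M \<in> S" "\<And>L. L \<in> S \<Longrightarrow> M \<subseteq> L \<Longrightarrow> L = M" by auto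
  then have Mi: "ideal M R" and inf: "infinite (cyclic_ass R M)" by (auto simp: S_def)
  then obtain P where "P \<in> cyclic_ass R M" using infinite_imp_nonempty by blast
  then obtain z where P: "primeideal P R" "z \<in> carrier R" "P = colon R M z" by (auto simp: cyclic_ass_def)
  interpret M: ideal M R by fact
  interpret P: primeideal P R by fact
  have "z \<notin> M"
  proof
    assume "z \<in> M"
    then have "colon R M z = carrier R" using M.I_l_closed by (auto simp: colon_def)
    then show False using P.I_notcarr P(3) by simp
  qed
  then have "adjoin M z \<notin> S" using M(2)[of "adjoin M z"] adjoin_superset[OF Mi P(2)] by auto
  then have "finite (cyclic_ass R (adjoin M z))" using adjoin_ideal[OF Mi P(2)] by (simp add: S_def)
  moreover have "finite (cyclic_ass R P)" using finite_subset[OF cyclic_ass_prime[OF P(1)]] by simp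
  ultimately show False
    using inf finite_subset[OF cyclic_ass_subset[OF Mi P(2)]] P(3) by simp
qed

section \<open>Coprime pairs\<close>

text \<open>The only relations between \<open>s\<close> and \<open>t\<close> are the trivial ones, i.e. the Koszul complex on \<open>s, t\<close> is
  exact in the middle.  In a domain, for \<open>s, t \<noteq> 0\<close>, this says that \<open>s, t\<close> is a regular sequence or
  generates the unit ideal.  The pair \<open>1, 0\<close> qualifies too, which covers the case that one of the two
  given elements vanishes.\<close>
definition coprime_pair :: "'a \<Rightarrow> 'a \<Rightarrow> bool"
  where "coprime_pair s t \<longleftrightarrow> (\<forall>a\<in>carrier R. \<forall>b\<in>carrier R. a \<otimes> s = b \<otimes> t \<longrightarrow>
    (\<exists>c\<in>carrier R. a = c \<otimes> t \<and> b = c \<otimes> s))"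

lemma coprime_pairD:
  assumes "coprime_pair s t" "a \<in> carrier R" "b \<in> carrier R" "a \<otimes> s = b \<otimes> t"
  obtains c where "c \<in> carrier R" "a = c \<otimes> t" "b = c \<otimes> s"
  using assms unfolding coprime_pair_def by blast

lemma coprime_pair_sym:
  assumes "coprime_pair s t"
  shows "coprime_pair t s"
  unfolding coprime_pair_def
proof (intro ballI impI)
  fix a b assume "a \<in> carrier R" "b \<in> carrier R" "a \<otimes> t = b \<otimes> s"
  then obtain c where "c \<in> carrier R" "b = c \<otimes> t" "a = c \<otimes> s"
    using coprime_pairD[OF assms, of b a] by metis
  then show "\<exists>c\<in>carrier R. a = c \<otimes> s \<and> b = c \<otimes> t" by blast
qed

lemma coprime_pair_one: "t \<in> carrier R \<Longrightarrow> coprime_pair \<one> t"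
  unfolding coprime_pair_def by auto

lemma coprime_pair_one_zero: "coprime_pair \<one> \<zero>"
  by (simp add: coprime_pair_one)

lemma coprime_pair_mult:
  assumes st: "coprime_pair s t" "coprime_pair s' t"
    and [simp]: "s \<in> carrier R" "s' \<in> carrier R" "t \<in> carrier R"
  shows "coprime_pair (s \<otimes> s') t"
  unfolding coprime_pair_def
proof (intro ballI impI)
  fix a b assume [simp]: "a \<in> carrier R" "b \<in> carrier R" and "a \<otimes> (s \<otimes> s') = b \<otimes> t"
  then have "(a \<otimes> s) \<otimes> s' = b \<otimes> t" by (simp add: m_assoc)
  then obtain c where c: "c \<in> carrier R" "a \<otimes> s = c \<otimes> t" "b = c \<otimes> s'"
    using st(2) by (elim coprime_pairD) auto
  then obtain e where "e \<in> carrier R" "a = e \<otimes> t" "c = e \<otimes> s"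
    using st(1) by (elim coprime_pairD) auto
  then show "\<exists>c\<in>carrier R. a = c \<otimes> t \<and> b = c \<otimes> (s \<otimes> s')"
    using c by (auto simp: m_assoc)
qed

lemma coprime_pair_pow_left:
  assumes "coprime_pair s t" "s \<in> carrier R" "t \<in> carrier R"
  shows "coprime_pair (s [^] (i::nat)) t"
  by (induction i) (use assms in \<open>auto intro: coprime_pair_mult coprime_pair_one\<close>)

lemma coprime_pair_pow:
  assumes "coprime_pair s t" "s \<in> carrier R" "t \<in> carrier R"
  shows "coprime_pair (s [^] (i::nat)) (t [^] (j::nat))"
  using assms by (intro coprime_pair_pow_left coprime_pair_sym[OF coprime_pair_pow_left]
      coprime_pair_sym[of s t]) auto

text \<open>The ideal generated by two elements, given by explicit coefficients because these are what the
  relations between cochains below turn into.\<close>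
definition gen2 :: "'a \<Rightarrow> 'a \<Rightarrow> 'a set"
  where "gen2 s t = {a \<otimes> s \<oplus> b \<otimes> t | a b. a \<in> carrier R \<and> b \<in> carrier R}"

lemma gen2I: "a \<in> carrier R \<Longrightarrow> b \<in> carrier R \<Longrightarrow> a \<otimes> s \<oplus> b \<otimes> t \<in> gen2 s t"
  by (auto simp: gen2_def)

lemma gen2E:
  assumes "x \<in> gen2 s t"
  obtains a b where "a \<in> carrier R" "b \<in> carrier R" "x = a \<otimes> s \<oplus> b \<otimes> t"
  using assms by (auto simp: gen2_def)

lemma gen2_commute:
  assumes "s \<in> carrier R" "t \<in> carrier R"
  shows "gen2 s t = gen2 t s"
proof -
  have *: "gen2 s t \<subseteq> gen2 t s" if "s \<in> carrier R" "t \<in> carrier R" for s t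
  proof
    fix z assume "z \<in> gen2 s t"
    then obtain a b where *: "a \<in> carrier R" "b \<in> carrier R" "z = a \<otimes> s \<oplus> b \<otimes> t" by (rule gen2E)
    then have "z = b \<otimes> t \<oplus> a \<otimes> s" using that by (simp add: a_comm)
    then show "z \<in> gen2 t s" using gen2I[of b a t s] * by simp
  qed
  show ?thesis using assms by (intro equalityI *)
qed

lemma gen2_adjoin: "gen2 s t = adjoin {a \<otimes> s | a. a \<in> carrier R} t"
  unfolding gen2_def adjoin_def by blast

lemma gen2_ideal:
  assumes "s \<in> carrier R" "t \<in> carrier R"
  shows "ideal (gen2 s t) R"
  unfolding gen2_adjoin using adjoin_ideal[OF cgenideal_ideal[OF assms(1)] assms(2)]
  by (simp only: cgenideal_def)

lemma adjoin_gen2: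
  assumes st: "s \<in> carrier R" "t \<in> carrier R" "q \<in> carrier R"
  shows "adjoin (gen2 (q \<otimes> s) t) s = gen2 s t"
proof (intro equalityI subsetI)
  fix z assume "z \<in> adjoin (gen2 (q \<otimes> s) t) s"
  then obtain a b c where *: "a \<in> carrier R" "b \<in> carrier R" "c \<in> carrier R"
    "z = (a \<otimes> (q \<otimes> s) \<oplus> b \<otimes> t) \<oplus> c \<otimes> s" by (metis gen2E adjoinE)
  have "z = (a \<otimes> q \<oplus> c) \<otimes> s \<oplus> b \<otimes> t" unfolding *(4) using *(1-3) st by algebra
  then show "z \<in> gen2 s t" using gen2I[of "a \<otimes> q \<oplus> c" b s t] * st by simp
next
  fix z assume "z \<in> gen2 s t"
  then obtain a b where *: "a \<in> carrier R" "b \<in> carrier R" "z = a \<otimes> s \<oplus> b \<otimes> t"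
    by (rule gen2E)
  have "z = (\<zero> \<otimes> (q \<otimes> s) \<oplus> b \<otimes> t) \<oplus> a \<otimes> s" unfolding *(3) using *(1,2) st by algebra
  then show "z \<in> adjoin (gen2 (q \<otimes> s) t) s"
    using adjoinI[OF gen2I[of \<zero> b "q \<otimes> s" t], of a s] * by simp
qed

text \<open>The kernel of multiplication by \<open>s\<close> into \<open>R/(q s, t)\<close>; without coprimality it may be larger.\<close>
lemma colon_gen2:
  assumes st: "coprime_pair s t" and [simp]: "s \<in> carrier R" "t \<in> carrier R" "q \<in> carrier R"
  shows "colon R (gen2 (q \<otimes> s) t) s = gen2 q t"
proof (intro equalityI subsetI)
  fix a assume "a \<in> colon R (gen2 (q \<otimes> s) t) s"
  then have a: "a \<in> carrier R" "a \<otimes> s \<in> gen2 (q \<otimes> s) t" by (auto simp: colon_def)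
  from a(2) obtain b c where *: "b \<in> carrier R" "c \<in> carrier R"
    "a \<otimes> s = b \<otimes> (q \<otimes> s) \<oplus> c \<otimes> t" by (rule gen2E)
  have "(a \<ominus> b \<otimes> q) \<otimes> s = a \<otimes> s \<ominus> b \<otimes> (q \<otimes> s)" using a(1) *(1,2) assms(2-) by algebra
  also have "\<dots> = (b \<otimes> (q \<otimes> s) \<oplus> c \<otimes> t) \<ominus> b \<otimes> (q \<otimes> s)" by (simp only: *(3))
  also have "\<dots> = c \<otimes> t" using *(1,2) assms(2-) by algebra
  finally have eq: "(a \<ominus> b \<otimes> q) \<otimes> s = c \<otimes> t" .
  have "a \<ominus> b \<otimes> q \<in> carrier R" using a(1) * by simp
  then obtain e where e: "e \<in> carrier R" "a \<ominus> b \<otimes> q = e \<otimes> t"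
    using coprime_pairD[OF st _ *(2) eq] by metis
  have "a = b \<otimes> q \<oplus> (a \<ominus> b \<otimes> q)" using a(1) *(1) assms(4) by algebra
  then show "a \<in> gen2 q t" using gen2I[of b e q t] e * by simp
next
  fix a assume "a \<in> gen2 q t"
  then obtain b c where *: "b \<in> carrier R" "c \<in> carrier R"
    "a = b \<otimes> q \<oplus> c \<otimes> t" by (rule gen2E)
  have "a \<otimes> s = b \<otimes> (q \<otimes> s) \<oplus> (c \<otimes> s) \<otimes> t"
    unfolding *(3) using *(1,2) assms(2-) by algebra
  then have "a \<otimes> s \<in> gen2 (q \<otimes> s) t" using gen2I[of b "c \<otimes> s" "q \<otimes> s" t] * by simp
  then show "a \<in> colon R (gen2 (q \<otimes> s) t) s" using * by (simp add: colon_def)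
qed

text \<open>Each step of the filtration of \<open>R/(s^i, t)\<close> by powers of \<open>s\<close> has quotient \<open>R/(s, t)\<close>.\<close>
lemma cyclic_ass_gen2_pow_left:
  assumes st: "coprime_pair s t" and [simp]: "s \<in> carrier R" "t \<in> carrier R"
  shows "cyclic_ass R (gen2 (s [^] (i::nat)) t) \<subseteq> cyclic_ass R (gen2 s t)"
proof (induction i)
  case 0
  have "gen2 \<one> t = carrier R"
  proof (intro equalityI subsetI)
    fix a assume a: "a \<in> carrier R"
    then show "a \<in> gen2 \<one> t" using gen2I[of a \<zero> \<one> t] by simp
  qed (auto simp: gen2_def)
  then have "colon R (gen2 \<one> t) z = carrier R" if "z \<in> carrier R" for z using that by (auto simp: colon_def)
  then show ?case by (auto simp: cyclic_ass_def dest: primeideal.I_notcarr)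
next
  case (Suc i)
  have "cyclic_ass R (gen2 (s [^] i \<otimes> s) t) \<subseteq>
      cyclic_ass R (gen2 s t) \<union> cyclic_ass R (gen2 (s [^] i) t)"
    using cyclic_ass_subset[of "gen2 (s [^] i \<otimes> s) t" s] st
    by (simp add: gen2_ideal adjoin_gen2 colon_gen2)
  then show ?case using Suc by auto
qed

lemma cyclic_ass_gen2_pow:
  assumes st: "coprime_pair s t" and [simp]: "s \<in> carrier R" "t \<in> carrier R"
  shows "cyclic_ass R (gen2 (s [^] (i::nat)) (t [^] (j::nat))) \<subseteq> cyclic_ass R (gen2 s t)"
proof -
  have "cyclic_ass R (gen2 (s [^] i) (t [^] j)) \<subseteq> cyclic_ass R (gen2 s (t [^] j))"
    using coprime_pair_pow[OF st, of 1 j] by (intro cyclic_ass_gen2_pow_left) auto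
  also have "\<dots> = cyclic_ass R (gen2 (t [^] j) s)" by (simp add: gen2_commute)
  also have "\<dots> \<subseteq> cyclic_ass R (gen2 t s)"
    using coprime_pair_sym[OF st] by (intro cyclic_ass_gen2_pow_left) auto
  finally show ?thesis by (simp add: gen2_commute)
qed

end

section \<open>Annihilators in Cech cohomology\<close>

context cring
begin

text \<open>The annihilator of the class of \<open>r / (x y)^n\<close> in the Cech cohomology module
  \<open>R_{xy} / (R_x + R_y)\<close>: the fraction \<open>a r / (x y)^n\<close> is a sum of fractions with denominators powers of
  \<open>x\<close> and of \<open>y\<close> iff the displayed membership holds for some \<open>k\<close>.\<close>
definition cech_ann :: "'a \<Rightarrow> 'a \<Rightarrow> nat \<Rightarrow> 'a \<Rightarrow> 'a set"
  where "cech_ann x y n r =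
    {a \<in> carrier R. \<exists>k. (a \<otimes> r) \<otimes> (x \<otimes> y) [^] k \<in> gen2 (x [^] (n + k)) (y [^] (n + k))}"

text \<open>The transition maps of the direct system \<open>R/(s^n, t^n)\<close>, multiplication by powers of \<open>s t\<close>, are
  injective for a coprime pair.\<close>
lemma gen2_pow_cancel:
  assumes st: "coprime_pair s t" and [simp]: "s \<in> carrier R" "t \<in> carrier R" "z \<in> carrier R"
    and z: "z \<otimes> (s \<otimes> t) [^] k \<in> gen2 (s [^] (n + k)) (t [^] (n + k :: nat))"
  shows "z \<in> gen2 (s [^] n) (t [^] n)"
proof -
  have "z \<otimes> t [^] k \<in> colon R (gen2 (s [^] n \<otimes> s [^] k) (t [^] (n + k))) (s [^] k)"
    using z by (simp add: colon_def nat_pow_distrib nat_pow_mult m_assoc m_comm[of "t [^] k" "s [^] k"])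
  then have "z \<otimes> t [^] k \<in> gen2 (s [^] n) (t [^] (n + k))"
    using coprime_pair_pow[OF st, of k "n + k"] by (simp add: colon_gen2)
  then have "z \<in> colon R (gen2 (t [^] n \<otimes> t [^] k) (s [^] n)) (t [^] k)"
    by (simp add: colon_def nat_pow_mult gen2_commute)
  then have "z \<in> gen2 (t [^] n) (s [^] n)"
    using coprime_pair_pow[OF coprime_pair_sym[OF st], of k n] by (simp add: colon_gen2)
  then show ?thesis by (simp add: gen2_commute)
qed

lemma gen2_smult:
  assumes "c \<in> carrier R" "s \<in> carrier R" "t \<in> carrier R" "z \<in> gen2 s t"
  shows "c \<otimes> z \<in> gen2 s t" "c \<otimes> z \<in> gen2 (c \<otimes> s) (c \<otimes> t)"
proof -
  interpret ideal "gen2 s t" R using assms by (intro gen2_ideal)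
  show "c \<otimes> z \<in> gen2 s t" using assms I_l_closed by simp
  obtain a b where *: "a \<in> carrier R" "b \<in> carrier R" "z = a \<otimes> s \<oplus> b \<otimes> t"
    using assms(4) by (rule gen2E)
  have "c \<otimes> z = a \<otimes> (c \<otimes> s) \<oplus> b \<otimes> (c \<otimes> t)" unfolding *(3) using assms(1-3) *(1,2) by algebra
  then show "c \<otimes> z \<in> gen2 (c \<otimes> s) (c \<otimes> t)" using gen2I * by simp
qed

lemma gen2_mult_both:
  assumes "s \<in> carrier R" "t \<in> carrier R" "p \<in> carrier R" "q \<in> carrier R" "z \<in> gen2 s t"
  shows "z \<otimes> (p \<otimes> q) \<in> gen2 (s \<otimes> p) (t \<otimes> q)"
proof -
  obtain a b where *: "a \<in> carrier R" "b \<in> carrier R" "z = a \<otimes> s \<oplus> b \<otimes> t"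
    using assms(5) by (rule gen2E)
  have "z \<otimes> (p \<otimes> q) = (a \<otimes> q) \<otimes> (s \<otimes> p) \<oplus> (b \<otimes> p) \<otimes> (t \<otimes> q)"
    unfolding *(3) using assms(1-4) *(1,2) by algebra
  then show ?thesis using gen2I[of "a \<otimes> q" "b \<otimes> p"] * assms by simp
qed

text \<open>For \<open>x = g s\<close> and \<open>y = g t\<close> the Cech cohomology of \<open>x, y\<close> is the localization at \<open>g\<close> of that of
  \<open>s, t\<close>, and the latter is the union of the modules \<open>R/(s^n, t^n)\<close>.\<close>
lemma cech_ann_iff:
  assumes st: "coprime_pair s t"
    and [simp]: "g \<in> carrier R" "s \<in> carrier R" "t \<in> carrier R" "r \<in> carrier R" "a \<in> carrier R"
  shows "a \<in> cech_ann (g \<otimes> s) (g \<otimes> t) n r \<longleftrightarrow> (\<exists>j::nat. g [^] j \<otimes> (a \<otimes> r) \<in> gen2 (s [^] n) (t [^] n))"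
proof
  assume "a \<in> cech_ann (g \<otimes> s) (g \<otimes> t) n r"
  then obtain k where k: "(a \<otimes> r) \<otimes> ((g \<otimes> s) \<otimes> (g \<otimes> t)) [^] k
      \<in> gen2 ((g \<otimes> s) [^] (n + k)) ((g \<otimes> t) [^] (n + k))"
    by (auto simp: cech_ann_def)
  from k obtain b c where *: "b \<in> carrier R" "c \<in> carrier R"
    "(a \<otimes> r) \<otimes> ((g \<otimes> s) \<otimes> (g \<otimes> t)) [^] k = b \<otimes> (g \<otimes> s) [^] (n + k) \<oplus> c \<otimes> (g \<otimes> t) [^] (n + k)"
    by (rule gen2E)
  have "(g [^] (k + k) \<otimes> (a \<otimes> r)) \<otimes> (s \<otimes> t) [^] k = (a \<otimes> r) \<otimes> ((g \<otimes> s) \<otimes> (g \<otimes> t)) [^] k"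
    by (simp add: nat_pow_distrib nat_pow_mult[symmetric] m_ac)
  also have "\<dots> = (b \<otimes> g [^] (n + k)) \<otimes> s [^] (n + k) \<oplus> (c \<otimes> g [^] (n + k)) \<otimes> t [^] (n + k)"
    unfolding *(3) using *(1,2) by (simp add: nat_pow_distrib m_assoc)
  also have "\<dots> \<in> gen2 (s [^] (n + k)) (t [^] (n + k))"
    using * by (intro gen2I) auto
  finally have "g [^] (k + k) \<otimes> (a \<otimes> r) \<in> gen2 (s [^] n) (t [^] n)"
    by (rule gen2_pow_cancel[OF st, of _ k, rotated -1]) auto
  then show "\<exists>j::nat. g [^] j \<otimes> (a \<otimes> r) \<in> gen2 (s [^] n) (t [^] n)" by blast
next
  assume "\<exists>j::nat. g [^] j \<otimes> (a \<otimes> r) \<in> gen2 (s [^] n) (t [^] n)"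
  then obtain j :: nat where j: "g [^] j \<otimes> (a \<otimes> r) \<in> gen2 (s [^] n) (t [^] n)" by blast
  \<comment> \<open>Balances the powers of \<open>g\<close>: \<open>2 k = j + (n + k)\<close>.\<close>
  define k where "k = n + j"
  have "(g [^] j \<otimes> (a \<otimes> r)) \<otimes> (s [^] k \<otimes> t [^] k) \<in> gen2 (s [^] n \<otimes> s [^] k) (t [^] n \<otimes> t [^] k)"
    using j by (intro gen2_mult_both) auto
  then have "g [^] (n + k) \<otimes> ((g [^] j \<otimes> (a \<otimes> r)) \<otimes> (s [^] k \<otimes> t [^] k)) \<in>
      gen2 (g [^] (n + k) \<otimes> (s [^] n \<otimes> s [^] k)) (g [^] (n + k) \<otimes> (t [^] n \<otimes> t [^] k))"
    by (rule gen2_smult(2)[rotated -1]) auto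
  moreover have "g [^] (n + k) \<otimes> ((g [^] j \<otimes> (a \<otimes> r)) \<otimes> (s [^] k \<otimes> t [^] k)) =
      (a \<otimes> r) \<otimes> ((g \<otimes> s) \<otimes> (g \<otimes> t)) [^] k"
    by (simp add: nat_pow_distrib nat_pow_mult[symmetric] k_def m_ac)
  moreover have "g [^] (n + k) \<otimes> (z [^] n \<otimes> z [^] k) = (g \<otimes> z) [^] (n + k)" if "z \<in> carrier R" for z
    using that by (simp add: nat_pow_distrib nat_pow_mult)
  ultimately show "a \<in> cech_ann (g \<otimes> s) (g \<otimes> t) n r" by (auto simp: cech_ann_def)
qed

text \<open>A finitely generated annihilator in a localization at \<open>g\<close> is reached by a single power of \<open>g\<close>, so
  the prime is already associated to some \<open>R/(s^n, t^n)\<close>, hence to \<open>R/(s, t)\<close>.\<close>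
lemma cech_ann_prime:
  assumes noeth: "noetherian_ring R" and st: "coprime_pair s t"
    and [simp]: "g \<in> carrier R" "s \<in> carrier R" "t \<in> carrier R" "r \<in> carrier R"
    and prime: "primeideal (cech_ann (g \<otimes> s) (g \<otimes> t) n r) R" (is "primeideal ?P R")
  shows "?P \<in> cyclic_ass R (gen2 s t)"
proof -
  let ?Q = "gen2 (s [^] n) (t [^] n)"
  interpret N: noetherian_ring R by fact
  interpret P: primeideal ?P R by fact
  have mono: "g [^] j \<otimes> (a \<otimes> r) \<in> ?Q" if "g [^] i \<otimes> (a \<otimes> r) \<in> ?Q" "i \<le> j" "a \<in> carrier R" for a and i j :: nat
  proof -
    have "g [^] j \<otimes> (a \<otimes> r) = g [^] (j - i) \<otimes> (g [^] i \<otimes> (a \<otimes> r))"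
      using that nat_pow_mult[of g "j - i" i] by (simp add: m_assoc[symmetric])
    then show ?thesis using gen2_smult(1)[OF _ _ _ that(1), of "g [^] (j - i)"] by simp
  qed
  obtain A where A: "A \<subseteq> carrier R" "finite A" "?P = Idl A"
    using N.finetely_gen[OF P.is_ideal] by blast
  have "\<exists>j::nat. \<forall>a\<in>B. g [^] j \<otimes> (a \<otimes> r) \<in> ?Q" if "finite B" "B \<subseteq> ?P" for B
    using that
  proof (induction B)
    case (insert b B)
    then obtain j where j: "\<forall>a\<in>B. g [^] (j::nat) \<otimes> (a \<otimes> r) \<in> ?Q" by auto
    have b: "b \<in> carrier R" using insert P.Icarr by auto
    then obtain i where i: "g [^] (i::nat) \<otimes> (b \<otimes> r) \<in> ?Q"
      using cech_ann_iff[OF st] insert by auto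
    have "B \<subseteq> carrier R" using insert P.Icarr by auto
    then have "\<forall>a\<in>insert b B. g [^] (max i j) \<otimes> (a \<otimes> r) \<in> ?Q"
      using mono[OF i, of "max i j"] mono[of j _ "max i j"] j b by auto
    then show ?case by blast
  qed auto
  moreover have "A \<subseteq> ?P" using genideal_self[OF A(1)] by (simp only: A(3))
  ultimately have "\<exists>j::nat. \<forall>a\<in>A. g [^] j \<otimes> (a \<otimes> r) \<in> ?Q" using A(2) by simp
  then obtain j where j: "\<And>a. a \<in> A \<Longrightarrow> g [^] (j::nat) \<otimes> (a \<otimes> r) \<in> ?Q" by auto
  let ?z = "g [^] j \<otimes> r"
  have swap: "a \<otimes> ?z = g [^] j \<otimes> (a \<otimes> r)" if "a \<in> carrier R" for a using that by (simp add: m_ac)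
  have "A \<subseteq> colon R ?Q ?z" using j A(1) swap by (auto simp: colon_def)
  then have "?P \<subseteq> colon R ?Q ?z"
    unfolding A(3) by (intro genideal_minimal colon_ideal gen2_ideal) auto
  moreover have "colon R ?Q ?z \<subseteq> ?P"
    using cech_ann_iff[OF st, of g r _ n] swap by (auto simp: colon_def)
  ultimately have "?P \<in> cyclic_ass R ?Q" using prime by (auto simp: cyclic_ass_def)
  then show ?thesis using cyclic_ass_gen2_pow[OF st] by auto
qed

end

section \<open>Linear maps, quotients and injective modules\<close>

lemma mod_homD:
  assumes "f \<in> mod_hom R M N"
  shows "x \<in> carrier M \<Longrightarrow> f x \<in> carrier N"
    and "x \<in> carrier M \<Longrightarrow> y \<in> carrier M \<Longrightarrow> f (x \<oplus>\<^bsub>M\<^esub> y) = f x \<oplus>\<^bsub>N\<^esub> f y"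
    and "a \<in> carrier R \<Longrightarrow> x \<in> carrier M \<Longrightarrow> f (a \<odot>\<^bsub>M\<^esub> x) = a \<odot>\<^bsub>N\<^esub> f x"
  using assms by (auto simp: mod_hom_def)

lemma mod_hom_zero_minus:
  assumes f: "f \<in> mod_hom R M N" and M: "module R M" and N: "module R N"
  shows "f \<zero>\<^bsub>M\<^esub> = \<zero>\<^bsub>N\<^esub>"
    and "x \<in> carrier M \<Longrightarrow> f (\<ominus>\<^bsub>M\<^esub> x) = \<ominus>\<^bsub>N\<^esub> f x"
    and "x \<in> carrier M \<Longrightarrow> y \<in> carrier M \<Longrightarrow> f (x \<ominus>\<^bsub>M\<^esub> y) = f x \<ominus>\<^bsub>N\<^esub> f y"
proof -
  interpret M: module R M by fact
  interpret N: module R N by fact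
  note f = mod_homD[OF f]
  show "f \<zero>\<^bsub>M\<^esub> = \<zero>\<^bsub>N\<^esub>" using f(3)[of "\<zero>\<^bsub>R\<^esub>" "\<zero>\<^bsub>M\<^esub>"] f(1)[of "\<zero>\<^bsub>M\<^esub>"] by simp
  show minus: "f (\<ominus>\<^bsub>M\<^esub> x) = \<ominus>\<^bsub>N\<^esub> f x" if "x \<in> carrier M" for x
    using f(3)[of "\<ominus>\<^bsub>R\<^esub> \<one>\<^bsub>R\<^esub>" x] f(1)[of x] that by (simp add: M.smult_l_minus N.smult_l_minus)
  show "f (x \<ominus>\<^bsub>M\<^esub> y) = f x \<ominus>\<^bsub>N\<^esub> f y" if "x \<in> carrier M" "y \<in> carrier M" for x y
    using that f(2)[of x "\<ominus>\<^bsub>M\<^esub> y"] minus by (simp add: a_minus_def)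
qed

lemma ring_module_simps [simp]:
  "carrier (ring_module R) = carrier R" "smult (ring_module R) = monoid.mult R"
  "add (ring_module R) = add R" "ring.zero (ring_module R) = ring.zero R"
  by (simp_all add: ring_module_def)

lemma (in module) ideal_submodule:
  assumes "ideal J R"
  shows "module R ((ring_module R)\<lparr>carrier := J\<rparr>)"
proof -
  interpret J: ideal J R by fact
  show ?thesis
  proof (rule moduleI)
    show "abelian_group ((ring_module R)\<lparr>carrier := J\<rparr>)"
    proof (rule abelian_groupI)
      fix x assume "x \<in> carrier ((ring_module R)\<lparr>carrier := J\<rparr>)"
      then show "\<exists>y\<in>carrier ((ring_module R)\<lparr>carrier := J\<rparr>).
          y \<oplus>\<^bsub>(ring_module R)\<lparr>carrier := J\<rparr>\<^esub> x = \<zero>\<^bsub>(ring_module R)\<lparr>carrier := J\<rparr>\<^esub>"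
        using J.Icarr by (intro bexI[of _ "\<ominus>\<^bsub>R\<^esub> x"]) (simp_all add: R.l_neg)
    qed (auto simp: J.Icarr R.a_ac)
  qed (auto simp: J.Icarr J.I_l_closed R.l_distr R.r_distr R.m_assoc R.is_cring)
qed

text \<open>Injectivity in the form of linear equations: \<open>a w = u\<close>, \<open>b w = v\<close> has a solution as soon as every
  relation between \<open>a\<close> and \<open>b\<close> holds between \<open>u\<close> and \<open>v\<close>.  That condition makes \<open>p a + q b \<mapsto> p u + q v\<close>
  a well-defined map on the ideal generated by \<open>a\<close> and \<open>b\<close>; the image of \<open>1\<close> under an extension to \<open>R\<close>
  is \<open>w\<close>.\<close>
lemma injective_solve:
  assumes inj: "injective_module R E" and a: "a \<in> carrier R" "b \<in> carrier R"
    and u: "u \<in> carrier E" "v \<in> carrier E"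
    and rel: "\<And>p q. p \<in> carrier R \<Longrightarrow> q \<in> carrier R \<Longrightarrow> p \<otimes>\<^bsub>R\<^esub> a \<oplus>\<^bsub>R\<^esub> q \<otimes>\<^bsub>R\<^esub> b = \<zero>\<^bsub>R\<^esub> \<Longrightarrow>
      p \<odot>\<^bsub>E\<^esub> u \<oplus>\<^bsub>E\<^esub> q \<odot>\<^bsub>E\<^esub> v = \<zero>\<^bsub>E\<^esub>"
  obtains w where "w \<in> carrier E" "a \<odot>\<^bsub>E\<^esub> w = u" "b \<odot>\<^bsub>E\<^esub> w = v"
proof -
  interpret E: module R E using inj by (simp add: injective_module_def)
  let ?J = "E.gen2 a b"
  have J: "ideal ?J R" using E.gen2_ideal a by simp
  define f where "f z = (THE e. \<exists>p\<in>carrier R. \<exists>q\<in>carrier R.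
    z = p \<otimes>\<^bsub>R\<^esub> a \<oplus>\<^bsub>R\<^esub> q \<otimes>\<^bsub>R\<^esub> b \<and> e = p \<odot>\<^bsub>E\<^esub> u \<oplus>\<^bsub>E\<^esub> q \<odot>\<^bsub>E\<^esub> v)" for z
  have f: "f (p \<otimes>\<^bsub>R\<^esub> a \<oplus>\<^bsub>R\<^esub> q \<otimes>\<^bsub>R\<^esub> b) = p \<odot>\<^bsub>E\<^esub> u \<oplus>\<^bsub>E\<^esub> q \<odot>\<^bsub>E\<^esub> v"
    if pq: "p \<in> carrier R" "q \<in> carrier R" for p q
    unfolding f_def
  proof (rule the_equality)
    show "\<exists>p'\<in>carrier R. \<exists>q'\<in>carrier R. p \<otimes>\<^bsub>R\<^esub> a \<oplus>\<^bsub>R\<^esub> q \<otimes>\<^bsub>R\<^esub> b = p' \<otimes>\<^bsub>R\<^esub> a \<oplus>\<^bsub>R\<^esub> q' \<otimes>\<^bsub>R\<^esub> b \<and>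
        p \<odot>\<^bsub>E\<^esub> u \<oplus>\<^bsub>E\<^esub> q \<odot>\<^bsub>E\<^esub> v = p' \<odot>\<^bsub>E\<^esub> u \<oplus>\<^bsub>E\<^esub> q' \<odot>\<^bsub>E\<^esub> v"
      using pq by blast
    fix e assume "\<exists>p'\<in>carrier R. \<exists>q'\<in>carrier R. p \<otimes>\<^bsub>R\<^esub> a \<oplus>\<^bsub>R\<^esub> q \<otimes>\<^bsub>R\<^esub> b = p' \<otimes>\<^bsub>R\<^esub> a \<oplus>\<^bsub>R\<^esub> q' \<otimes>\<^bsub>R\<^esub> b \<and>
        e = p' \<odot>\<^bsub>E\<^esub> u \<oplus>\<^bsub>E\<^esub> q' \<odot>\<^bsub>E\<^esub> v"
    then obtain p' q' where *: "p' \<in> carrier R" "q' \<in> carrier R"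
      "p \<otimes>\<^bsub>R\<^esub> a \<oplus>\<^bsub>R\<^esub> q \<otimes>\<^bsub>R\<^esub> b = p' \<otimes>\<^bsub>R\<^esub> a \<oplus>\<^bsub>R\<^esub> q' \<otimes>\<^bsub>R\<^esub> b" "e = p' \<odot>\<^bsub>E\<^esub> u \<oplus>\<^bsub>E\<^esub> q' \<odot>\<^bsub>E\<^esub> v"
      by blast
    have "(p \<ominus>\<^bsub>R\<^esub> p') \<otimes>\<^bsub>R\<^esub> a \<oplus>\<^bsub>R\<^esub> (q \<ominus>\<^bsub>R\<^esub> q') \<otimes>\<^bsub>R\<^esub> b =
        (p \<otimes>\<^bsub>R\<^esub> a \<oplus>\<^bsub>R\<^esub> q \<otimes>\<^bsub>R\<^esub> b) \<ominus>\<^bsub>R\<^esub> (p' \<otimes>\<^bsub>R\<^esub> a \<oplus>\<^bsub>R\<^esub> q' \<otimes>\<^bsub>R\<^esub> b)"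
      using a pq *(1,2) by algebra
    also have "\<dots> = \<zero>\<^bsub>R\<^esub>" unfolding *(3) using a *(1,2) by algebra
    finally have 0: "(p \<ominus>\<^bsub>R\<^esub> p') \<odot>\<^bsub>E\<^esub> u \<oplus>\<^bsub>E\<^esub> (q \<ominus>\<^bsub>R\<^esub> q') \<odot>\<^bsub>E\<^esub> v = \<zero>\<^bsub>E\<^esub>"
      using rel pq *(1,2) by simp
    have "p \<odot>\<^bsub>E\<^esub> u \<oplus>\<^bsub>E\<^esub> q \<odot>\<^bsub>E\<^esub> v =
        ((p \<ominus>\<^bsub>R\<^esub> p') \<oplus>\<^bsub>R\<^esub> p') \<odot>\<^bsub>E\<^esub> u \<oplus>\<^bsub>E\<^esub> ((q \<ominus>\<^bsub>R\<^esub> q') \<oplus>\<^bsub>R\<^esub> q') \<odot>\<^bsub>E\<^esub> v"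
      using pq *(1,2) by (simp add: a_minus_def E.R.a_assoc E.R.l_neg)
    also have "\<dots> = ((p \<ominus>\<^bsub>R\<^esub> p') \<odot>\<^bsub>E\<^esub> u \<oplus>\<^bsub>E\<^esub> (q \<ominus>\<^bsub>R\<^esub> q') \<odot>\<^bsub>E\<^esub> v) \<oplus>\<^bsub>E\<^esub> e"
      using pq *(1,2) u by (simp add: *(4) E.smult_l_distr E.M.a_ac)
    also have "\<dots> = e" using 0 * u by simp
    finally show "e = p \<odot>\<^bsub>E\<^esub> u \<oplus>\<^bsub>E\<^esub> q \<odot>\<^bsub>E\<^esub> v" by simp
  qed
  have "f \<in> mod_hom R ((ring_module R)\<lparr>carrier := ?J\<rparr>) E"
  proof -
    have "f (y \<oplus>\<^bsub>R\<^esub> z) = f y \<oplus>\<^bsub>E\<^esub> f z" if yz: "y \<in> ?J" "z \<in> ?J" for y z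
    proof -
      obtain p q where y: "p \<in> carrier R" "q \<in> carrier R" "y = p \<otimes>\<^bsub>R\<^esub> a \<oplus>\<^bsub>R\<^esub> q \<otimes>\<^bsub>R\<^esub> b"
        using yz(1) by (rule E.gen2E)
      obtain p' q' where z: "p' \<in> carrier R" "q' \<in> carrier R" "z = p' \<otimes>\<^bsub>R\<^esub> a \<oplus>\<^bsub>R\<^esub> q' \<otimes>\<^bsub>R\<^esub> b"
        using yz(2) by (rule E.gen2E)
      have "y \<oplus>\<^bsub>R\<^esub> z = (p \<oplus>\<^bsub>R\<^esub> p') \<otimes>\<^bsub>R\<^esub> a \<oplus>\<^bsub>R\<^esub> (q \<oplus>\<^bsub>R\<^esub> q') \<otimes>\<^bsub>R\<^esub> b"
        unfolding y(3) z(3) using a y(1,2) z(1,2) by algebra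
      then show ?thesis using y z u by (simp add: f E.smult_l_distr E.M.a_ac)
    qed
    moreover have "f (c \<otimes>\<^bsub>R\<^esub> y) = c \<odot>\<^bsub>E\<^esub> f y" if c: "c \<in> carrier R" and y: "y \<in> ?J" for c y
    proof -
      obtain p q where y: "p \<in> carrier R" "q \<in> carrier R" "y = p \<otimes>\<^bsub>R\<^esub> a \<oplus>\<^bsub>R\<^esub> q \<otimes>\<^bsub>R\<^esub> b"
        using y by (rule E.gen2E)
      have "c \<otimes>\<^bsub>R\<^esub> y = (c \<otimes>\<^bsub>R\<^esub> p) \<otimes>\<^bsub>R\<^esub> a \<oplus>\<^bsub>R\<^esub> (c \<otimes>\<^bsub>R\<^esub> q) \<otimes>\<^bsub>R\<^esub> b"
        unfolding y(3) using a y(1,2) c by algebra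
      then show ?thesis using y c u by (simp add: f E.smult_r_distr E.smult_assoc1)
    qed
    moreover have "f y \<in> carrier E" if "y \<in> ?J" for y
      using that u by (elim E.gen2E) (simp add: f)
    ultimately show ?thesis by (simp add: mod_hom_def)
  qed
  moreover have "id \<in> mod_hom R ((ring_module R)\<lparr>carrier := ?J\<rparr>) (ring_module R)"
    using ideal.Icarr[OF J] by (simp add: mod_hom_def)
  ultimately obtain h where h: "h \<in> mod_hom R (ring_module R) E" "\<And>z. z \<in> ?J \<Longrightarrow> h z = f z"
    using injective_module_extends[OF inj E.ideal_submodule[OF J] ring_module_is_module[OF E.is_cring], of id f]
    by auto
  show thesis
  proof
    show "h \<one>\<^bsub>R\<^esub> \<in> carrier E" using mod_homD(1)[OF h(1), of "\<one>\<^bsub>R\<^esub>"] by simp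
    have "a \<in> ?J" "f a = u"
      using f[of "\<one>\<^bsub>R\<^esub>" "\<zero>\<^bsub>R\<^esub>"] E.gen2I[of "\<one>\<^bsub>R\<^esub>" "\<zero>\<^bsub>R\<^esub>" a b] a u by simp_all
    then show "a \<odot>\<^bsub>E\<^esub> h \<one>\<^bsub>R\<^esub> = u" using h(2)[of a] mod_homD(3)[OF h(1), of a "\<one>\<^bsub>R\<^esub>"] a by simp
    have "b \<in> ?J" "f b = v"
      using f[of "\<zero>\<^bsub>R\<^esub>" "\<one>\<^bsub>R\<^esub>"] E.gen2I[of "\<zero>\<^bsub>R\<^esub>" "\<one>\<^bsub>R\<^esub>" a b] a u by simp_all
    then show "b \<odot>\<^bsub>E\<^esub> h \<one>\<^bsub>R\<^esub> = v" using h(2)[of b] mod_homD(3)[OF h(1), of b "\<one>\<^bsub>R\<^esub>"] a by simp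
  qed
qed

lemma mod_hom_image_submodule:
  assumes M: "module R M" and N: "module R N" and f: "f \<in> mod_hom R M N" and S: "submodule S R M"
  shows "submodule (f ` S) R N"
proof -
  interpret M: module R M by fact
  interpret N: module R N by fact
  note S = M.submoduleE[OF S]
  note f' = mod_homD[OF f] mod_hom_zero_minus[OF f M N]
  have c: "x \<in> carrier M" if "x \<in> S" for x using S(1) that by auto
  show ?thesis
  proof (rule N.submoduleI)
    show "f ` S \<subseteq> carrier N" using f'(1) c by auto
    obtain x where "x \<in> S" using S(2) by auto
    then have "\<zero>\<^bsub>M\<^esub> \<in> S" using S(4)[of "\<zero>\<^bsub>R\<^esub>" x] c by simp
    then show "\<zero>\<^bsub>N\<^esub> \<in> f ` S" using f'(4) by (metis imageI)
    show "\<ominus>\<^bsub>N\<^esub> y \<in> f ` S" if "y \<in> f ` S" for y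
      using that S(3) f'(5) c by (auto simp: image_iff) (metis)
    show "y \<oplus>\<^bsub>N\<^esub> z \<in> f ` S" if "y \<in> f ` S" "z \<in> f ` S" for y z
      using that S(5) f'(2) c by (auto simp: image_iff) (metis)
    show "a \<odot>\<^bsub>N\<^esub> y \<in> f ` S" if "a \<in> carrier R" "y \<in> f ` S" for a y
      using that S(4) f'(3) c by (auto simp: image_iff) (metis)
  qed
qed

lemma quot_module_smult_zero_iff:
  assumes M: "module R M" and N: "submodule N R M" and a: "a \<in> carrier R" and x: "x \<in> carrier M"
  shows "a \<odot>\<^bsub>quot_module (M\<lparr>carrier := C\<rparr>) N\<^esub> (N +>\<^bsub>M\<lparr>carrier := C\<rparr>\<^esub> x) = \<zero>\<^bsub>quot_module (M\<lparr>carrier := C\<rparr>) N\<^esub>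
    \<longleftrightarrow> a \<odot>\<^bsub>M\<^esub> x \<in> N"
proof -
  interpret M: module R M by fact
  note N = M.submoduleE[OF N]
  have c: "h \<in> carrier M" if "h \<in> N" for h using N(1) that by auto
  obtain h0 where "h0 \<in> N" using N(2) by auto
  then have 0: "\<zero>\<^bsub>M\<^esub> \<in> N" using N(4)[of "\<zero>\<^bsub>R\<^esub>" h0] c by simp
  let ?S = "\<Union>h\<in>N. \<Union>k\<in>N. {k \<oplus>\<^bsub>M\<^esub> a \<odot>\<^bsub>M\<^esub> (h \<oplus>\<^bsub>M\<^esub> x)}"
  have "?S = N \<longleftrightarrow> a \<odot>\<^bsub>M\<^esub> x \<in> N"
  proof
    assume S: "?S = N"
    have "\<zero>\<^bsub>M\<^esub> \<oplus>\<^bsub>M\<^esub> a \<odot>\<^bsub>M\<^esub> (\<zero>\<^bsub>M\<^esub> \<oplus>\<^bsub>M\<^esub> x) \<in> ?S" using 0 by blast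
    then show "a \<odot>\<^bsub>M\<^esub> x \<in> N" unfolding S using a x by simp
  next
    assume ax: "a \<odot>\<^bsub>M\<^esub> x \<in> N"
    have "k \<oplus>\<^bsub>M\<^esub> a \<odot>\<^bsub>M\<^esub> (h \<oplus>\<^bsub>M\<^esub> x) \<in> N" if "h \<in> N" "k \<in> N" for h k
      using that N(4,5) ax a x c by (simp add: M.smult_r_distr)
    moreover have "k \<in> ?S" if k: "k \<in> N" for k
    proof -
      have "k = (k \<oplus>\<^bsub>M\<^esub> \<ominus>\<^bsub>M\<^esub> (a \<odot>\<^bsub>M\<^esub> x)) \<oplus>\<^bsub>M\<^esub> a \<odot>\<^bsub>M\<^esub> (\<zero>\<^bsub>M\<^esub> \<oplus>\<^bsub>M\<^esub> x)"
        using c[OF k] a x by (simp add: M.M.a_assoc M.M.l_neg)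
      moreover have "k \<oplus>\<^bsub>M\<^esub> \<ominus>\<^bsub>M\<^esub> (a \<odot>\<^bsub>M\<^esub> x) \<in> N" using N(3,5) k ax by simp
      ultimately show ?thesis using 0 by blast
    qed
    ultimately show "?S = N" by blast
  qed
  moreover have "a \<odot>\<^bsub>quot_module (M\<lparr>carrier := C\<rparr>) N\<^esub> (N +>\<^bsub>M\<lparr>carrier := C\<rparr>\<^esub> x) = ?S"
    by (auto simp: quot_module_def a_r_coset_def r_coset_def)
  ultimately show ?thesis by (simp add: quot_module_def)
qed

section \<open>Torsion submodules\<close>

text \<open>The torsion submodule for the ideal generated by \<open>x\<close> and \<open>y\<close>, tested on powers of the generators.\<close>
definition pair_torsion :: "('a, 'r) ring_scheme \<Rightarrow> 'a \<Rightarrow> 'a \<Rightarrow> ('a, 'm, 's) module_scheme \<Rightarrow> 'm set"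
  where "pair_torsion R x y M =
    {m \<in> carrier M. \<exists>n::nat. x [^]\<^bsub>R\<^esub> n \<odot>\<^bsub>M\<^esub> m = \<zero>\<^bsub>M\<^esub> \<and> y [^]\<^bsub>R\<^esub> n \<odot>\<^bsub>M\<^esub> m = \<zero>\<^bsub>M\<^esub>}"

context module
begin

lemma pow_annihilates_mono:
  assumes "x [^]\<^bsub>R\<^esub> (n::nat) \<odot>\<^bsub>M\<^esub> m = \<zero>\<^bsub>M\<^esub>" "n \<le> k" "x \<in> carrier R" "m \<in> carrier M"
  shows "x [^]\<^bsub>R\<^esub> k \<odot>\<^bsub>M\<^esub> m = \<zero>\<^bsub>M\<^esub>"
proof -
  have "x [^]\<^bsub>R\<^esub> k = x [^]\<^bsub>R\<^esub> (k - n) \<otimes>\<^bsub>R\<^esub> x [^]\<^bsub>R\<^esub> n"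
    using assms R.nat_pow_mult[of x "k - n" n] by simp
  then show ?thesis using assms by (simp add: smult_assoc1)
qed

lemma pair_torsionE:
  assumes "m \<in> pair_torsion R x y M" "x \<in> carrier R" "y \<in> carrier R"
  obtains n where "n \<ge> n0" "x [^]\<^bsub>R\<^esub> (n::nat) \<odot>\<^bsub>M\<^esub> m = \<zero>\<^bsub>M\<^esub>" "y [^]\<^bsub>R\<^esub> n \<odot>\<^bsub>M\<^esub> m = \<zero>\<^bsub>M\<^esub>"
proof -
  obtain n :: nat where "m \<in> carrier M" "x [^]\<^bsub>R\<^esub> n \<odot>\<^bsub>M\<^esub> m = \<zero>\<^bsub>M\<^esub>" "y [^]\<^bsub>R\<^esub> n \<odot>\<^bsub>M\<^esub> m = \<zero>\<^bsub>M\<^esub>"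
    using assms(1) by (auto simp: pair_torsion_def)
  then show thesis
    using that[of "max n n0"] pow_annihilates_mono[of _ n _ "max n n0"] assms(2,3) by auto
qed

lemma pair_torsion_pow:
  assumes "x \<in> carrier R" "y \<in> carrier R" "N > 0"
  shows "pair_torsion R (x [^]\<^bsub>R\<^esub> (N::nat)) (y [^]\<^bsub>R\<^esub> N) M = pair_torsion R x y M"
proof (intro equalityI subsetI)
  fix m assume "m \<in> pair_torsion R (x [^]\<^bsub>R\<^esub> N) (y [^]\<^bsub>R\<^esub> N) M"
  then show "m \<in> pair_torsion R x y M" using assms by (auto simp: pair_torsion_def R.nat_pow_pow)
next
  fix m assume m: "m \<in> pair_torsion R x y M"
  then have mc: "m \<in> carrier M" by (simp add: pair_torsion_def)
  obtain n :: nat where n: "x [^]\<^bsub>R\<^esub> n \<odot>\<^bsub>M\<^esub> m = \<zero>\<^bsub>M\<^esub>" "y [^]\<^bsub>R\<^esub> n \<odot>\<^bsub>M\<^esub> m = \<zero>\<^bsub>M\<^esub>"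
    using pair_torsionE[OF m assms(1,2), of 0] by metis
  have "n \<le> N * n" using assms(3) by simp
  then have "x [^]\<^bsub>R\<^esub> (N * n) \<odot>\<^bsub>M\<^esub> m = \<zero>\<^bsub>M\<^esub>" "y [^]\<^bsub>R\<^esub> (N * n) \<odot>\<^bsub>M\<^esub> m = \<zero>\<^bsub>M\<^esub>"
    using pow_annihilates_mono n assms(1,2) mc by blast+
  then show "m \<in> pair_torsion R (x [^]\<^bsub>R\<^esub> N) (y [^]\<^bsub>R\<^esub> N) M"
    using mc assms by (auto simp: pair_torsion_def R.nat_pow_pow)
qed

lemma pair_torsion_submodule:
  assumes x: "x \<in> carrier R" and y: "y \<in> carrier R"
  shows "submodule (pair_torsion R x y M) R M"
proof (rule submoduleI)
  show "pair_torsion R x y M \<subseteq> carrier M" by (auto simp: pair_torsion_def)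
  show "\<zero>\<^bsub>M\<^esub> \<in> pair_torsion R x y M" using x y by (simp add: pair_torsion_def)
next
  fix m assume "m \<in> pair_torsion R x y M"
  then show "\<ominus>\<^bsub>M\<^esub> m \<in> pair_torsion R x y M"
    using x y by (auto simp: pair_torsion_def smult_r_minus)
next
  fix m k assume m: "m \<in> pair_torsion R x y M" and k: "k \<in> pair_torsion R x y M"
  then have c: "m \<in> carrier M" "k \<in> carrier M" by (auto simp: pair_torsion_def)
  obtain n :: nat where n: "x [^]\<^bsub>R\<^esub> n \<odot>\<^bsub>M\<^esub> m = \<zero>\<^bsub>M\<^esub>" "y [^]\<^bsub>R\<^esub> n \<odot>\<^bsub>M\<^esub> m = \<zero>\<^bsub>M\<^esub>"
    using pair_torsionE[OF m x y, of 0] by metis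
  obtain l where l: "l \<ge> n" "x [^]\<^bsub>R\<^esub> l \<odot>\<^bsub>M\<^esub> k = \<zero>\<^bsub>M\<^esub>" "y [^]\<^bsub>R\<^esub> l \<odot>\<^bsub>M\<^esub> k = \<zero>\<^bsub>M\<^esub>"
    using pair_torsionE[OF k x y, of n] by metis
  have "x [^]\<^bsub>R\<^esub> l \<odot>\<^bsub>M\<^esub> m = \<zero>\<^bsub>M\<^esub>" "y [^]\<^bsub>R\<^esub> l \<odot>\<^bsub>M\<^esub> m = \<zero>\<^bsub>M\<^esub>"
    using pow_annihilates_mono n l(1) x y c by blast+
  then have "x [^]\<^bsub>R\<^esub> l \<odot>\<^bsub>M\<^esub> (m \<oplus>\<^bsub>M\<^esub> k) = \<zero>\<^bsub>M\<^esub>" "y [^]\<^bsub>R\<^esub> l \<odot>\<^bsub>M\<^esub> (m \<oplus>\<^bsub>M\<^esub> k) = \<zero>\<^bsub>M\<^esub>"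
    using l c x y by (simp_all add: smult_r_distr)
  then show "m \<oplus>\<^bsub>M\<^esub> k \<in> pair_torsion R x y M" using c by (auto simp: pair_torsion_def)
next
  fix a m assume a: "a \<in> carrier R" and m: "m \<in> pair_torsion R x y M"
  have "z \<odot>\<^bsub>M\<^esub> (a \<odot>\<^bsub>M\<^esub> k) = a \<odot>\<^bsub>M\<^esub> (z \<odot>\<^bsub>M\<^esub> k)" if "z \<in> carrier R" "k \<in> carrier M" for z k
    using that a by (simp flip: smult_assoc1 add: R.m_comm)
  moreover obtain n :: nat where "m \<in> carrier M" "x [^]\<^bsub>R\<^esub> n \<odot>\<^bsub>M\<^esub> m = \<zero>\<^bsub>M\<^esub>" "y [^]\<^bsub>R\<^esub> n \<odot>\<^bsub>M\<^esub> m = \<zero>\<^bsub>M\<^esub>"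
    using m by (auto simp: pair_torsion_def)
  ultimately show "a \<odot>\<^bsub>M\<^esub> m \<in> pair_torsion R x y M"
    using a x y by (auto simp: pair_torsion_def intro!: exI[of _ n])
qed

text \<open>The \<open>n\<close>-th power of the ideal is generated by the monomials of degree \<open>n\<close> in \<open>x\<close> and \<open>y\<close>.\<close>
lemma ideal_power_annihilates:
  assumes x: "x \<in> carrier R" and y: "y \<in> carrier R"
  shows "m \<in> carrier M \<Longrightarrow> (\<And>i j. i + j = n \<Longrightarrow> (x [^]\<^bsub>R\<^esub> i \<otimes>\<^bsub>R\<^esub> y [^]\<^bsub>R\<^esub> j) \<odot>\<^bsub>M\<^esub> m = \<zero>\<^bsub>M\<^esub>) \<Longrightarrow>
    a \<in> (gen2 x y) [^]\<^bsub>ideals_set R\<^esub> (n::nat) \<Longrightarrow> a \<in> carrier R \<and> a \<odot>\<^bsub>M\<^esub> m = \<zero>\<^bsub>M\<^esub>"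
proof (induction n arbitrary: m a)
  case 0
  then have "(x [^]\<^bsub>R\<^esub> (0::nat) \<otimes>\<^bsub>R\<^esub> y [^]\<^bsub>R\<^esub> (0::nat)) \<odot>\<^bsub>M\<^esub> m = \<zero>\<^bsub>M\<^esub>" by blast
  then show ?case using 0 by (simp add: ideals_set_def nat_pow_def)
next
  case (Suc n)
  note m = Suc.prems(1) and kills = Suc.prems(2)
  have x': "(x [^]\<^bsub>R\<^esub> i \<otimes>\<^bsub>R\<^esub> y [^]\<^bsub>R\<^esub> j) \<odot>\<^bsub>M\<^esub> (x \<odot>\<^bsub>M\<^esub> m) = \<zero>\<^bsub>M\<^esub>" if "i + j = n" for i j
    using kills[of "Suc i" j] that x y m by (simp flip: smult_assoc1 add: R.m_ac)
  have y': "(x [^]\<^bsub>R\<^esub> i \<otimes>\<^bsub>R\<^esub> y [^]\<^bsub>R\<^esub> j) \<odot>\<^bsub>M\<^esub> (y \<odot>\<^bsub>M\<^esub> m) = \<zero>\<^bsub>M\<^esub>" if "i + j = n" for i j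
    using kills[of i "Suc j"] that x y m by (simp flip: smult_assoc1 add: R.m_ac)
  have "(gen2 x y) [^]\<^bsub>ideals_set R\<^esub> Suc n = ideal_prod R ((gen2 x y) [^]\<^bsub>ideals_set R\<^esub> n) (gen2 x y)"
    by (simp add: ideals_set_def nat_pow_def)
  then have "a \<in> ideal_prod R ((gen2 x y) [^]\<^bsub>ideals_set R\<^esub> n) (gen2 x y)" using Suc.prems(3) by simp
  then show ?case
  proof (induction rule: ideal_prod.induct)
    case (prod b c)
    then have bx: "b \<in> carrier R" "b \<odot>\<^bsub>M\<^esub> (x \<odot>\<^bsub>M\<^esub> m) = \<zero>\<^bsub>M\<^esub>" and "b \<odot>\<^bsub>M\<^esub> (y \<odot>\<^bsub>M\<^esub> m) = \<zero>\<^bsub>M\<^esub>"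
      using Suc.IH[OF _ x'] Suc.IH[OF _ y'] m x y by auto
    moreover obtain p q where pq: "p \<in> carrier R" "q \<in> carrier R" "c = p \<otimes>\<^bsub>R\<^esub> x \<oplus>\<^bsub>R\<^esub> q \<otimes>\<^bsub>R\<^esub> y"
      using prod(2) by (rule gen2E)
    moreover have "(b \<otimes>\<^bsub>R\<^esub> (p \<otimes>\<^bsub>R\<^esub> x \<oplus>\<^bsub>R\<^esub> q \<otimes>\<^bsub>R\<^esub> y)) = p \<otimes>\<^bsub>R\<^esub> (b \<otimes>\<^bsub>R\<^esub> x) \<oplus>\<^bsub>R\<^esub> q \<otimes>\<^bsub>R\<^esub> (b \<otimes>\<^bsub>R\<^esub> y)"
      using pq(1,2) bx(1) x y by (simp add: R.r_distr R.m_ac)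
    ultimately show ?case using x y m by (simp add: smult_l_distr smult_assoc1)
  next
    case (sum s1 s2)
    then show ?case using m by (simp add: smult_l_distr)
  qed
qed

lemma gen2_eq_Idl:
  assumes "x \<in> carrier R" "y \<in> carrier R"
  shows "Idl\<^bsub>R\<^esub> {x, y} = gen2 x y"
proof
  have "x \<in> gen2 x y" "y \<in> gen2 x y"
    using gen2I[of "\<one>\<^bsub>R\<^esub>" "\<zero>\<^bsub>R\<^esub>" x y] gen2I[of "\<zero>\<^bsub>R\<^esub>" "\<one>\<^bsub>R\<^esub>" x y] assms by simp_all
  then show "Idl\<^bsub>R\<^esub> {x, y} \<subseteq> gen2 x y" using assms by (intro R.genideal_minimal gen2_ideal) auto
  interpret I: ideal "Idl\<^bsub>R\<^esub> {x, y}" R using R.genideal_ideal assms by simp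
  have "x \<in> Idl\<^bsub>R\<^esub> {x, y}" "y \<in> Idl\<^bsub>R\<^esub> {x, y}" using R.genideal_self[of "{x, y}"] assms by auto
  then show "gen2 x y \<subseteq> Idl\<^bsub>R\<^esub> {x, y}" by (auto elim!: gen2E intro!: I.a_closed I.I_l_closed)
qed

end

lemma torsion_functor_eq_pair_torsion:
  fixes M :: "('a, 'm) module"
  assumes "module R M" and x: "x \<in> carrier R" and y: "y \<in> carrier R"
  shows "torsion_functor R (Idl\<^bsub>R\<^esub> {x, y}) M = M\<lparr>carrier := pair_torsion R x y M\<rparr>"
proof -
  interpret module R M by fact
  have "(\<exists>n::nat. \<forall>a\<in>(gen2 x y) [^]\<^bsub>ideals_set R\<^esub> n. a \<odot>\<^bsub>M\<^esub> m = \<zero>\<^bsub>M\<^esub>) \<longleftrightarrow> m \<in> pair_torsion R x y M"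
    if m: "m \<in> carrier M" for m
  proof
    have pow: "z [^]\<^bsub>R\<^esub> n \<in> (gen2 x y) [^]\<^bsub>ideals_set R\<^esub> n" if z: "z \<in> gen2 x y" "z \<in> carrier R" for z and n :: nat
    proof (induction n)
      case (Suc n)
      then show ?case using z by (auto simp: ideals_set_def nat_pow_def intro!: ideal_prod.prod)
    qed (simp add: ideals_set_def nat_pow_def)
    have "x \<in> gen2 x y" "y \<in> gen2 x y"
      using gen2I[of "\<one>\<^bsub>R\<^esub>" "\<zero>\<^bsub>R\<^esub>" x y] gen2I[of "\<zero>\<^bsub>R\<^esub>" "\<one>\<^bsub>R\<^esub>" x y] assms by simp_all
    moreover assume "\<exists>n::nat. \<forall>a\<in>(gen2 x y) [^]\<^bsub>ideals_set R\<^esub> n. a \<odot>\<^bsub>M\<^esub> m = \<zero>\<^bsub>M\<^esub>"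
    ultimately show "m \<in> pair_torsion R x y M"
      using m pow x y by (auto simp: pair_torsion_def)
  next
    assume "m \<in> pair_torsion R x y M"
    then obtain n :: nat where n: "x [^]\<^bsub>R\<^esub> n \<odot>\<^bsub>M\<^esub> m = \<zero>\<^bsub>M\<^esub>" "y [^]\<^bsub>R\<^esub> n \<odot>\<^bsub>M\<^esub> m = \<zero>\<^bsub>M\<^esub>"
      by (auto simp: pair_torsion_def)
    \<comment> \<open>A monomial of degree \<open>2 n\<close> contains \<open>x^n\<close> or \<open>y^n\<close>.\<close>
    have "(x [^]\<^bsub>R\<^esub> i \<otimes>\<^bsub>R\<^esub> y [^]\<^bsub>R\<^esub> j) \<odot>\<^bsub>M\<^esub> m = \<zero>\<^bsub>M\<^esub>" if ij: "i + j = n + n" for i j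
    proof (cases "n \<le> i")
      case True
      then have "x [^]\<^bsub>R\<^esub> i \<odot>\<^bsub>M\<^esub> m = \<zero>\<^bsub>M\<^esub>" using pow_annihilates_mono n(1) x m by blast
      then show ?thesis using x y m by (simp add: R.m_comm[of "x [^]\<^bsub>R\<^esub> i"] smult_assoc1)
    next
      case False
      then have "n \<le> j" using ij by simp
      then have "y [^]\<^bsub>R\<^esub> j \<odot>\<^bsub>M\<^esub> m = \<zero>\<^bsub>M\<^esub>" using pow_annihilates_mono n(2) y m by blast
      then show ?thesis using x y m by (simp add: smult_assoc1)
    qed
    then show "\<exists>n::nat. \<forall>a\<in>(gen2 x y) [^]\<^bsub>ideals_set R\<^esub> n. a \<odot>\<^bsub>M\<^esub> m = \<zero>\<^bsub>M\<^esub>"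
      using ideal_power_annihilates[OF x y m, of "n + n"] by blast
  qed
  moreover have "pair_torsion R x y M \<subseteq> carrier M" by (auto simp: pair_torsion_def)
  ultimately show ?thesis
    unfolding torsion_functor_def gen2_eq_Idl[OF x y] by (intro arg_cong2[where f = "\<lambda>M C. M\<lparr>carrier := C\<rparr>"]) auto
qed

section \<open>Second local cohomology of a coprime pair with a common factor\<close>

locale coprime_resolution = domain R for R :: "('a, 'r) ring_scheme" (structure) +
  fixes E :: "nat \<Rightarrow> ('a, 'e) module" and d :: "nat \<Rightarrow> 'e \<Rightarrow> 'e" and \<epsilon> :: "'a \<Rightarrow> 'e"
    and g s t :: 'a
  assumes resolution: "injective_resolution R (ring_module R) \<epsilon> E d"
    and coprime: "coprime_pair s t"
    and g [simp]: "g \<in> carrier R" and s [simp]: "s \<in> carrier R" and t [simp]: "t \<in> carrier R"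
begin

text \<open>The two elements whose local cohomology is computed; the common factor \<open>g\<close> may vanish.\<close>
abbreviation gs where "gs \<equiv> g \<otimes> s"
abbreviation gt where "gt \<equiv> g \<otimes> t"

lemma module_E [simp]: "module R (E n)"
  using resolution by (simp add: injective_resolution_def injective_module_def)

lemma d_hom: "d n \<in> mod_hom R (E n) (E (Suc n))"
  using resolution by (simp add: injective_resolution_def)

lemmas d_simps = mod_homD[OF d_hom] mod_hom_zero_minus[OF d_hom module_E module_E]

lemma d_d: "z \<in> carrier (E n) \<Longrightarrow> d (Suc n) (d n z) = \<zero>\<^bsub>E (Suc (Suc n))\<^esub>"
  using resolution unfolding injective_resolution_def by blast

lemma d_exact:
  assumes "z \<in> carrier (E (Suc n))" "d (Suc n) z = \<zero>\<^bsub>E (Suc (Suc n))\<^esub>"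
  obtains w where "w \<in> carrier (E n)" "z = d n w"
  using resolution assms unfolding injective_resolution_def by blast

lemma eps_hom: "\<epsilon> \<in> mod_hom R (ring_module R) (E 0)"
  using resolution by (simp add: injective_resolution_def)

lemmas eps_simps = mod_homD[OF eps_hom, simplified]

lemma eps_inj: "a \<in> carrier R \<Longrightarrow> b \<in> carrier R \<Longrightarrow> \<epsilon> a = \<epsilon> b \<Longrightarrow> a = b"
  using resolution by (auto simp: injective_resolution_def inj_on_def)

lemma d_eps: "a \<in> carrier R \<Longrightarrow> d 0 (\<epsilon> a) = \<zero>\<^bsub>E (Suc 0)\<^esub>"
  using resolution unfolding injective_resolution_def by auto

lemma eps_exact:
  assumes "z \<in> carrier (E 0)" "d 0 z = \<zero>\<^bsub>E (Suc 0)\<^esub>"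
  obtains a where "a \<in> carrier R" "z = \<epsilon> a"
proof -
  have "z \<in> \<epsilon> ` carrier R" using resolution assms by (simp add: injective_resolution_def)
  then show thesis using that by auto
qed

text \<open>With \<open>x = g s\<close> and \<open>y = g t\<close>, the hypothesis says that \<open>u / x^n\<close> and \<open>v / y^n\<close> agree where both \<open>x\<close>
  and \<open>y\<close> are inverted, and \<open>w\<close> is a common global lift.  The equations for \<open>w\<close> are solvable because, for
  \<open>g \<noteq> 0\<close>, coprimality makes every relation between \<open>x^{2n}\<close> and \<open>y^{2n}\<close> a multiple of the one with
  coefficients \<open>t^{2n}\<close> and \<open>- s^{2n}\<close>, and \<open>t^{2n} x^n u - s^{2n} y^n v = s^n t^n (y^n u - x^n v) = 0\<close>.
  For \<open>g = 0\<close> the equations are trivial, since \<open>n > 0\<close>.\<close>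
lemma coprime_lift:
  assumes n: "n > 0" and u: "u \<in> carrier (E 0)" and v: "v \<in> carrier (E 0)"
    and uv: "gt [^] (n::nat) \<odot>\<^bsub>E 0\<^esub> u = gs [^] n \<odot>\<^bsub>E 0\<^esub> v"
  obtains w where "w \<in> carrier (E 0)"
    "gs [^] (n + n) \<odot>\<^bsub>E 0\<^esub> w = gs [^] n \<odot>\<^bsub>E 0\<^esub> u" "gt [^] (n + n) \<odot>\<^bsub>E 0\<^esub> w = gt [^] n \<odot>\<^bsub>E 0\<^esub> v"
proof -
  interpret E: module R "E 0" by simp
  have "p \<odot>\<^bsub>E 0\<^esub> (gs [^] n \<odot>\<^bsub>E 0\<^esub> u) \<oplus>\<^bsub>E 0\<^esub> q \<odot>\<^bsub>E 0\<^esub> (gt [^] n \<odot>\<^bsub>E 0\<^esub> v) = \<zero>\<^bsub>E 0\<^esub>"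
    if p: "p \<in> carrier R" and q: "q \<in> carrier R" and 0: "p \<otimes> gs [^] (n + n) \<oplus> q \<otimes> gt [^] (n + n) = \<zero>" for p q
  proof (cases "g = \<zero>")
    case True
    then show ?thesis using n u v p q by (simp add: nat_pow_zero)
  next
    case False
    have "g [^] k \<noteq> \<zero>" for k :: nat by (induction k) (use False in auto)
    then have G: "g [^] (n + n) \<noteq> \<zero>" .
    have "g [^] (n + n) \<otimes> (p \<otimes> s [^] (n + n) \<oplus> q \<otimes> t [^] (n + n)) = \<zero>"
      using 0 p q by (simp add: nat_pow_distrib r_distr m_ac)
    then have "p \<otimes> s [^] (n + n) \<oplus> q \<otimes> t [^] (n + n) = \<zero>" using integral G p q by (metis add.m_closed g m_closed nat_pow_closed s t)
    then have "p \<otimes> s [^] (n + n) = (\<ominus> q) \<otimes> t [^] (n + n)"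
      using p q by (simp add: l_minus sum_zero_eq_neg)
    then obtain c where c: "c \<in> carrier R" "p = c \<otimes> t [^] (n + n)" "\<ominus> q = c \<otimes> s [^] (n + n)"
      using coprime_pairD[OF coprime_pair_pow[OF coprime s t], of p "\<ominus> q" "n + n" "n + n"] p q by auto
    then have q': "q = (\<ominus> c) \<otimes> s [^] (n + n)" using minus_minus[OF q] by (simp add: l_minus)
    have "p \<odot>\<^bsub>E 0\<^esub> (gs [^] n \<odot>\<^bsub>E 0\<^esub> u) = (c \<otimes> (s [^] n \<otimes> t [^] n)) \<odot>\<^bsub>E 0\<^esub> (gt [^] n \<odot>\<^bsub>E 0\<^esub> u)"
      unfolding c(2) using c(1) u by (simp add: nat_pow_distrib nat_pow_mult[symmetric] m_ac flip: E.smult_assoc1)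
    moreover have "q \<odot>\<^bsub>E 0\<^esub> (gt [^] n \<odot>\<^bsub>E 0\<^esub> v) = ((\<ominus> c) \<otimes> (s [^] n \<otimes> t [^] n)) \<odot>\<^bsub>E 0\<^esub> (gs [^] n \<odot>\<^bsub>E 0\<^esub> v)"
      unfolding q' using c(1) v by (simp add: nat_pow_distrib nat_pow_mult[symmetric] m_ac flip: E.smult_assoc1)
    ultimately show ?thesis
      using uv c(1) v by (simp add: l_minus E.smult_l_minus E.M.r_neg)
  qed
  moreover have "injective_module R (E 0)" using resolution by (simp add: injective_resolution_def)
  ultimately show thesis
    using injective_solve[of R "E 0" "gs [^] (n + n)" "gt [^] (n + n)" "gs [^] n \<odot>\<^bsub>E 0\<^esub> u" "gt [^] n \<odot>\<^bsub>E 0\<^esub> v"] u v that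
    by auto
qed

text \<open>With \<open>w\<close> from the previous lemma, \<open>e - d w\<close> is a torsion cochain with the same boundary as \<open>e\<close>.\<close>
lemma boundary_if_compatible:
  assumes n: "n > 0" and e: "e \<in> carrier (E (Suc 0))" and u: "u \<in> carrier (E 0)" and v: "v \<in> carrier (E 0)"
    and xe: "gs [^] (n::nat) \<odot>\<^bsub>E (Suc 0)\<^esub> e = d 0 u" and ye: "gt [^] n \<odot>\<^bsub>E (Suc 0)\<^esub> e = d 0 v"
    and uv: "gt [^] (n::nat) \<odot>\<^bsub>E 0\<^esub> u = gs [^] n \<odot>\<^bsub>E 0\<^esub> v"
  shows "d (Suc 0) e \<in> d (Suc 0) ` pair_torsion R gs gt (E (Suc 0))"
proof -
  interpret E0: module R "E 0" by simp
  interpret E1: module R "E (Suc 0)" by simp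
  interpret E2: module R "E (Suc (Suc 0))" by simp
  obtain w where w: "w \<in> carrier (E 0)"
    "gs [^] (n + n) \<odot>\<^bsub>E 0\<^esub> w = gs [^] n \<odot>\<^bsub>E 0\<^esub> u" "gt [^] (n + n) \<odot>\<^bsub>E 0\<^esub> w = gt [^] n \<odot>\<^bsub>E 0\<^esub> v"
    using coprime_lift[OF n u v uv] by metis
  have dw: "d 0 w \<in> carrier (E (Suc 0))" using w d_simps by simp
  have *: "z [^] (n + n) \<odot>\<^bsub>E (Suc 0)\<^esub> (e \<ominus>\<^bsub>E (Suc 0)\<^esub> d 0 w) = \<zero>\<^bsub>E (Suc 0)\<^esub>"
    if z: "z \<in> carrier R" "y \<in> carrier (E 0)" "z [^] n \<odot>\<^bsub>E (Suc 0)\<^esub> e = d 0 y"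
      "z [^] (n + n) \<odot>\<^bsub>E 0\<^esub> w = z [^] n \<odot>\<^bsub>E 0\<^esub> y" for z y
  proof -
    have "z [^] (n + n) \<odot>\<^bsub>E (Suc 0)\<^esub> d 0 w = d 0 (z [^] n \<odot>\<^bsub>E 0\<^esub> y)"
      using d_simps(3)[of "z [^] (n + n)" w 0] z(1) w(1) by (simp add: z(4)[symmetric])
    also have "\<dots> = z [^] n \<odot>\<^bsub>E (Suc 0)\<^esub> (z [^] n \<odot>\<^bsub>E (Suc 0)\<^esub> e)" using d_simps(3) z by simp
    also have "\<dots> = z [^] (n + n) \<odot>\<^bsub>E (Suc 0)\<^esub> e"
      using z e by (simp add: nat_pow_mult[symmetric] E1.smult_assoc1)
    finally show ?thesis
      using z e dw by (simp add: a_minus_def E1.smult_r_distr E1.smult_r_minus E1.M.r_neg)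
  qed
  have "e \<ominus>\<^bsub>E (Suc 0)\<^esub> d 0 w \<in> pair_torsion R gs gt (E (Suc 0))"
    using *[OF _ u xe w(2)] *[OF _ v ye w(3)] e dw unfolding pair_torsion_def by auto
  moreover have "d (Suc 0) (e \<ominus>\<^bsub>E (Suc 0)\<^esub> d 0 w) = d (Suc 0) e"
    using d_simps(6)[OF e dw] d_d[OF w(1)] d_simps(1)[OF e] by (simp add: a_minus_def)
  ultimately show ?thesis by (metis imageI)
qed

text \<open>The comparison of local and Cech cohomology for \<open>x = g s\<close> and \<open>y = g t\<close>: the boundary \<open>d e\<close> vanishes in the second local
  cohomology module iff \<open>r / (x y)^n\<close> vanishes in \<open>R_{xy} / (R_x + R_y)\<close>.  A torsion cochain \<open>f\<close> with
  \<open>d f = d e\<close> makes \<open>e - f\<close> a boundary \<open>d w\<close>, and comparing \<open>w\<close> with \<open>u / x^n\<close> and \<open>v / y^n\<close> produces the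
  two coefficients from \<open>R\<close>; conversely the coefficients correct \<open>u\<close> and \<open>v\<close> so that they become
  compatible.\<close>
lemma boundary_iff:
  assumes n: "n > 0" and e: "e \<in> carrier (E (Suc 0))" and u: "u \<in> carrier (E 0)" and v: "v \<in> carrier (E 0)"
    and xe: "gs [^] (n::nat) \<odot>\<^bsub>E (Suc 0)\<^esub> e = d 0 u" and ye: "gt [^] n \<odot>\<^bsub>E (Suc 0)\<^esub> e = d 0 v"
    and r: "r \<in> carrier R" and uv: "gt [^] (n::nat) \<odot>\<^bsub>E 0\<^esub> u = gs [^] n \<odot>\<^bsub>E 0\<^esub> v \<oplus>\<^bsub>E 0\<^esub> \<epsilon> r"
  shows "d (Suc 0) e \<in> d (Suc 0) ` pair_torsion R gs gt (E (Suc 0)) \<longleftrightarrow>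
    (\<exists>k. r \<otimes> (gs \<otimes> gt) [^] k \<in> gen2 (gs [^] (n + k)) (gt [^] (n + k)))" (is "?lhs \<longleftrightarrow> ?rhs")
proof
  interpret E0: module R "E 0" by simp
  interpret E1: module R "E (Suc 0)" by simp
  interpret E2: module R "E (Suc (Suc 0))" by simp
  have assoc: "a \<odot>\<^bsub>E 0\<^esub> (b \<odot>\<^bsub>E 0\<^esub> z) = (a \<otimes> b) \<odot>\<^bsub>E 0\<^esub> z" if "a \<in> carrier R" "b \<in> carrier R" "z \<in> carrier (E 0)" for a b z
    using that E0.smult_assoc1 by simp
  have cross: "(gt [^] (n + k) \<otimes> gs [^] k) \<odot>\<^bsub>E 0\<^esub> u =
      (gs [^] (n + k) \<otimes> gt [^] k) \<odot>\<^bsub>E 0\<^esub> v \<oplus>\<^bsub>E 0\<^esub> \<epsilon> (r \<otimes> (gs \<otimes> gt) [^] k)" for k :: nat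
  proof -
    have "(gt [^] (n + k) \<otimes> gs [^] k) = (gs \<otimes> gt) [^] k \<otimes> gt [^] n"
      by (simp only: nat_pow_distrib nat_pow_mult[symmetric] m_closed g s t nat_pow_closed m_ac)
    then have "(gt [^] (n + k) \<otimes> gs [^] k) \<odot>\<^bsub>E 0\<^esub> u = (gs \<otimes> gt) [^] k \<odot>\<^bsub>E 0\<^esub> (gt [^] n \<odot>\<^bsub>E 0\<^esub> u)"
      using u assoc[of "(gs \<otimes> gt) [^] k" "gt [^] n" u] by simp
    also have "\<dots> = ((gs \<otimes> gt) [^] k \<otimes> gs [^] n) \<odot>\<^bsub>E 0\<^esub> v \<oplus>\<^bsub>E 0\<^esub> \<epsilon> ((gs \<otimes> gt) [^] k \<otimes> r)"
      unfolding uv using v r eps_simps(1)[OF r] by (simp add: E0.smult_r_distr eps_simps(3) E0.smult_assoc1)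
    also have "(gs \<otimes> gt) [^] k \<otimes> gs [^] n = gs [^] (n + k) \<otimes> gt [^] k"
      by (simp only: nat_pow_distrib nat_pow_mult[symmetric] m_closed g s t nat_pow_closed m_ac)
    also have "(gs \<otimes> gt) [^] k \<otimes> r = r \<otimes> (gs \<otimes> gt) [^] k" using r by (simp add: m_comm)
    finally show ?thesis .
  qed
  show ?rhs if lhs: ?lhs
  proof -
    obtain f where f: "f \<in> pair_torsion R gs gt (E (Suc 0))" "d (Suc 0) e = d (Suc 0) f" using lhs by blast
    then have fc: "f \<in> carrier (E (Suc 0))" by (simp add: pair_torsion_def)
    obtain m where m: "m \<ge> n" "gs [^] m \<odot>\<^bsub>E (Suc 0)\<^esub> f = \<zero>\<^bsub>E (Suc 0)\<^esub>" "gt [^] m \<odot>\<^bsub>E (Suc 0)\<^esub> f = \<zero>\<^bsub>E (Suc 0)\<^esub>"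
      using E1.pair_torsionE[OF f(1), of n] by (metis m_closed g s t)
    define k where "k = m - n"
    then have mk: "m = n + k" using m by simp
    have "d (Suc 0) (e \<ominus>\<^bsub>E (Suc 0)\<^esub> f) = \<zero>\<^bsub>E (Suc (Suc 0))\<^esub>"
      using d_simps(6)[OF e fc] d_simps(1)[OF fc] f(2) by (simp add: a_minus_def E2.M.r_neg)
    then obtain w where w: "w \<in> carrier (E 0)" "e \<ominus>\<^bsub>E (Suc 0)\<^esub> f = d 0 w"
      using d_exact[of "e \<ominus>\<^bsub>E (Suc 0)\<^esub> f" 0] e fc by auto
    have dw: "d 0 w \<in> carrier (E (Suc 0))" using w d_simps by simp
    have ew: "e = d 0 w \<oplus>\<^bsub>E (Suc 0)\<^esub> f" using e fc by (simp add: w(2)[symmetric] a_minus_def E1.M.a_assoc E1.M.l_neg)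
    have diff: "\<exists>a\<in>carrier R. z [^] k \<odot>\<^bsub>E 0\<^esub> y = z [^] m \<odot>\<^bsub>E 0\<^esub> w \<oplus>\<^bsub>E 0\<^esub> \<epsilon> a"
      if z: "z \<in> carrier R" "y \<in> carrier (E 0)" "z [^] n \<odot>\<^bsub>E (Suc 0)\<^esub> e = d 0 y"
        "z [^] m \<odot>\<^bsub>E (Suc 0)\<^esub> f = \<zero>\<^bsub>E (Suc 0)\<^esub>" for z y
    proof -
      have "d 0 (z [^] k \<odot>\<^bsub>E 0\<^esub> y) = (z [^] k \<otimes> z [^] n) \<odot>\<^bsub>E (Suc 0)\<^esub> e"
        using z e d_simps(3)[of "z [^] k" y] by (simp add: E1.smult_assoc1)
      also have "z [^] k \<otimes> z [^] n = z [^] m" using z by (simp add: nat_pow_mult mk add.commute)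
      also have "z [^] m \<odot>\<^bsub>E (Suc 0)\<^esub> e = d 0 (z [^] m \<odot>\<^bsub>E 0\<^esub> w)"
        unfolding ew using z w dw fc d_simps(3)[of "z [^] m" w] by (simp add: E1.smult_r_distr)
      finally have "d 0 (z [^] k \<odot>\<^bsub>E 0\<^esub> y \<ominus>\<^bsub>E 0\<^esub> z [^] m \<odot>\<^bsub>E 0\<^esub> w) = \<zero>\<^bsub>E (Suc 0)\<^esub>"
        using d_simps(6)[of "z [^] k \<odot>\<^bsub>E 0\<^esub> y" 0 "z [^] m \<odot>\<^bsub>E 0\<^esub> w"] d_simps(1)[of "z [^] m \<odot>\<^bsub>E 0\<^esub> w" 0] z w
        by (simp add: a_minus_def E1.M.r_neg)
      then obtain a where a: "a \<in> carrier R" "z [^] k \<odot>\<^bsub>E 0\<^esub> y \<ominus>\<^bsub>E 0\<^esub> z [^] m \<odot>\<^bsub>E 0\<^esub> w = \<epsilon> a"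
        using eps_exact[of "z [^] k \<odot>\<^bsub>E 0\<^esub> y \<ominus>\<^bsub>E 0\<^esub> z [^] m \<odot>\<^bsub>E 0\<^esub> w"] z w by auto
      have "z [^] k \<odot>\<^bsub>E 0\<^esub> y = z [^] m \<odot>\<^bsub>E 0\<^esub> w \<oplus>\<^bsub>E 0\<^esub> \<epsilon> a"
        unfolding a(2)[symmetric] using z w by (simp add: a_minus_def E0.M.a_lcomm[of "z [^] m \<odot>\<^bsub>E 0\<^esub> w"] E0.M.r_neg)
      then show ?thesis using a by blast
    qed
    obtain a where a: "a \<in> carrier R" "gs [^] k \<odot>\<^bsub>E 0\<^esub> u = gs [^] m \<odot>\<^bsub>E 0\<^esub> w \<oplus>\<^bsub>E 0\<^esub> \<epsilon> a"
      using diff[OF _ u xe m(2)] by auto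
    obtain b where b: "b \<in> carrier R" "gt [^] k \<odot>\<^bsub>E 0\<^esub> v = gt [^] m \<odot>\<^bsub>E 0\<^esub> w \<oplus>\<^bsub>E 0\<^esub> \<epsilon> b"
      using diff[OF _ v ye m(3)] by auto
    let ?W = "(gs [^] m \<otimes> gt [^] m) \<odot>\<^bsub>E 0\<^esub> w" and ?r = "r \<otimes> (gs \<otimes> gt) [^] k"
    have W: "?W \<in> carrier (E 0)" using w by simp
    have "(gt [^] m \<otimes> gs [^] k) \<odot>\<^bsub>E 0\<^esub> u = ?W \<oplus>\<^bsub>E 0\<^esub> \<epsilon> (gt [^] m \<otimes> a)"
      using u w a(1) eps_simps(1)[OF a(1)]
      by (simp add: E0.smult_assoc1 a(2) E0.smult_r_distr eps_simps(3) m_comm[of "gs [^] m"])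
    moreover have "(gs [^] m \<otimes> gt [^] k) \<odot>\<^bsub>E 0\<^esub> v = ?W \<oplus>\<^bsub>E 0\<^esub> \<epsilon> (gs [^] m \<otimes> b)"
      using v w b(1) eps_simps(1)[OF b(1)]
      by (simp add: E0.smult_assoc1 b(2) E0.smult_r_distr eps_simps(3))
    ultimately have "?W \<oplus>\<^bsub>E 0\<^esub> \<epsilon> (gt [^] m \<otimes> a) = ?W \<oplus>\<^bsub>E 0\<^esub> (\<epsilon> (gs [^] m \<otimes> b) \<oplus>\<^bsub>E 0\<^esub> \<epsilon> ?r)"
      using cross[of k] W r b(1) eps_simps(1) by (simp add: mk E0.M.a_assoc)
    then have "\<epsilon> (gt [^] m \<otimes> a) = \<epsilon> (gs [^] m \<otimes> b) \<oplus>\<^bsub>E 0\<^esub> \<epsilon> ?r"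
      using W r b(1) a(1) eps_simps(1) by simp
    then have "\<epsilon> (gt [^] m \<otimes> a) = \<epsilon> (gs [^] m \<otimes> b \<oplus> ?r)"
      using r b(1) eps_simps(2) by simp
    then have eq: "gt [^] m \<otimes> a = gs [^] m \<otimes> b \<oplus> ?r" using eps_inj a b r by simp
    have "?r = (\<ominus> b) \<otimes> gs [^] m \<oplus> (gs [^] m \<otimes> b \<oplus> ?r)"
      using b r by (simp add: l_minus m_comm[of b] add.m_assoc[symmetric] l_neg)
    also have "\<dots> = (\<ominus> b) \<otimes> gs [^] m \<oplus> a \<otimes> gt [^] m" using a b by (simp only: eq[symmetric] m_comm[of a] m_closed g s t nat_pow_closed)
    finally have "?r \<in> gen2 (gs [^] m) (gt [^] m)" using gen2I[of "\<ominus> b" a "gs [^] m" "gt [^] m"] a b by simp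
    then show ?thesis unfolding mk by blast
  qed
  show ?lhs if rhs: ?rhs
  proof -
    obtain k where k: "r \<otimes> (gs \<otimes> gt) [^] k \<in> gen2 (gs [^] (n + k)) (gt [^] (n + k))" using rhs by blast
    define m where "m = n + k"
    obtain a b where ab: "a \<in> carrier R" "b \<in> carrier R"
      "r \<otimes> (gs \<otimes> gt) [^] k = a \<otimes> gs [^] m \<oplus> b \<otimes> gt [^] m"
      using k unfolding m_def by (rule gen2E)
    let ?u = "gs [^] k \<odot>\<^bsub>E 0\<^esub> u \<oplus>\<^bsub>E 0\<^esub> \<epsilon> (\<ominus> b)" and ?v = "gt [^] k \<odot>\<^bsub>E 0\<^esub> v \<oplus>\<^bsub>E 0\<^esub> \<epsilon> a"
    have shift: "z [^] m \<odot>\<^bsub>E (Suc 0)\<^esub> e = d 0 (z [^] k \<odot>\<^bsub>E 0\<^esub> y \<oplus>\<^bsub>E 0\<^esub> \<epsilon> c)"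
      if z: "z \<in> carrier R" "y \<in> carrier (E 0)" "z [^] n \<odot>\<^bsub>E (Suc 0)\<^esub> e = d 0 y" "c \<in> carrier R" for z y c
    proof -
      have "d 0 (z [^] k \<odot>\<^bsub>E 0\<^esub> y \<oplus>\<^bsub>E 0\<^esub> \<epsilon> c) = z [^] k \<odot>\<^bsub>E (Suc 0)\<^esub> d 0 y"
        using z d_eps d_simps(1)[of y 0] d_simps(2)[of "z [^] k \<odot>\<^bsub>E 0\<^esub> y" 0 "\<epsilon> c"] eps_simps(1) d_simps(3)[of "z [^] k" y 0]
        by simp
      also have "\<dots> = (z [^] k \<otimes> z [^] n) \<odot>\<^bsub>E (Suc 0)\<^esub> e" using z e by (simp add: E1.smult_assoc1)
      also have "z [^] k \<otimes> z [^] n = z [^] m" using z by (simp add: nat_pow_mult m_def add.commute)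
      finally show ?thesis by simp
    qed
    have "gt [^] m \<odot>\<^bsub>E 0\<^esub> ?u = (gt [^] m \<otimes> gs [^] k) \<odot>\<^bsub>E 0\<^esub> u \<oplus>\<^bsub>E 0\<^esub> \<epsilon> (gt [^] m \<otimes> \<ominus> b)"
      using u ab eps_simps(1)[of "\<ominus> b"] by (simp add: E0.smult_r_distr E0.smult_assoc1 eps_simps(3))
    also have "\<dots> = (gs [^] m \<otimes> gt [^] k) \<odot>\<^bsub>E 0\<^esub> v \<oplus>\<^bsub>E 0\<^esub>
        \<epsilon> ((a \<otimes> gs [^] m \<oplus> b \<otimes> gt [^] m) \<oplus> (gt [^] m \<otimes> \<ominus> b))"
      using cross[of k] v ab r eps_simps(1) by (simp add: m_def eps_simps(2) E0.M.a_assoc)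
    also have "(a \<otimes> gs [^] m \<oplus> b \<otimes> gt [^] m) \<oplus> (gt [^] m \<otimes> \<ominus> b) = gs [^] m \<otimes> a"
      using ab by (simp add: r_minus m_comm[of b] m_comm[of a] a_assoc r_neg)
    also have "(gs [^] m \<otimes> gt [^] k) \<odot>\<^bsub>E 0\<^esub> v \<oplus>\<^bsub>E 0\<^esub> \<epsilon> (gs [^] m \<otimes> a) = gs [^] m \<odot>\<^bsub>E 0\<^esub> ?v"
      using v ab eps_simps(1)[of a] by (simp add: E0.smult_r_distr E0.smult_assoc1 eps_simps(3))
    finally have "gt [^] m \<odot>\<^bsub>E 0\<^esub> ?u = gs [^] m \<odot>\<^bsub>E 0\<^esub> ?v" .
    then show ?thesis
      using n e u v ab eps_simps(1) shift[OF _ u xe, of "\<ominus> b"] shift[OF _ v ye, of a]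
      by (intro boundary_if_compatible[of m e ?u ?v]) (auto simp: m_def)
  qed
qed

text \<open>With \<open>x = g s\<close> and \<open>y = g t\<close>, every torsion cocycle \<open>z\<close> has a Cech representative
  \<open>r / (x y)^n\<close>, found by the usual zigzag: \<open>z = d e\<close>,
  then \<open>x^n e = d u\<close> and \<open>y^n e = d v\<close>, then \<open>y^n u - x^n v\<close> comes from \<open>r\<close>.  The zigzag is linear, so
  the representative of \<open>a z\<close> is \<open>a r / (x y)^n\<close>.\<close>
lemma annihilator_eq_cech_ann:
  assumes z: "z \<in> pair_torsion R gs gt (E (Suc (Suc 0)))" and dz: "d (Suc (Suc 0)) z = \<zero>\<^bsub>E (Suc (Suc (Suc 0)))\<^esub>"
  obtains n r where "r \<in> carrier R"
    "{a \<in> carrier R. a \<odot>\<^bsub>E (Suc (Suc 0))\<^esub> z \<in> d (Suc 0) ` pair_torsion R gs gt (E (Suc 0))} = cech_ann gs gt n r"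
proof -
  interpret E0: module R "E 0" by simp
  interpret E1: module R "E (Suc 0)" by simp
  interpret E2: module R "E (Suc (Suc 0))" by simp
  have zc: "z \<in> carrier (E (Suc (Suc 0)))" using z by (simp add: pair_torsion_def)
  obtain e where e: "e \<in> carrier (E (Suc 0))" "z = d (Suc 0) e" using d_exact[OF zc dz] by metis
  obtain n :: nat where n: "n \<ge> 1" "gs [^] n \<odot>\<^bsub>E (Suc (Suc 0))\<^esub> z = \<zero>\<^bsub>E (Suc (Suc 0))\<^esub>"
    "gt [^] n \<odot>\<^bsub>E (Suc (Suc 0))\<^esub> z = \<zero>\<^bsub>E (Suc (Suc 0))\<^esub>"
    using E2.pair_torsionE[OF z, of 1] by (metis m_closed g s t)
  have lift: "\<exists>u\<in>carrier (E 0). y [^] n \<odot>\<^bsub>E (Suc 0)\<^esub> e = d 0 u"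
    if "y \<in> carrier R" "y [^] n \<odot>\<^bsub>E (Suc (Suc 0))\<^esub> z = \<zero>\<^bsub>E (Suc (Suc 0))\<^esub>" for y
    using d_exact[of "y [^] n \<odot>\<^bsub>E (Suc 0)\<^esub> e" 0] that e d_simps(3)[of "y [^] n" e] by auto
  obtain u where u: "u \<in> carrier (E 0)" "gs [^] n \<odot>\<^bsub>E (Suc 0)\<^esub> e = d 0 u" using lift[OF _ n(2)] by auto
  obtain v where v: "v \<in> carrier (E 0)" "gt [^] n \<odot>\<^bsub>E (Suc 0)\<^esub> e = d 0 v" using lift[OF _ n(3)] by auto
  let ?y = "gt [^] n \<odot>\<^bsub>E 0\<^esub> u" and ?x = "gs [^] n \<odot>\<^bsub>E 0\<^esub> v"
  have "d 0 ?y = (gt [^] n \<otimes> gs [^] n) \<odot>\<^bsub>E (Suc 0)\<^esub> e"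
    using u e d_simps(3)[of "gt [^] n" u 0] by (simp add: E1.smult_assoc1)
  also have "\<dots> = d 0 ?x"
    using v e d_simps(3)[of "gs [^] n" v 0] by (simp add: E1.smult_assoc1 m_comm[of "gt [^] n"])
  finally have "d 0 (?y \<ominus>\<^bsub>E 0\<^esub> ?x) = \<zero>\<^bsub>E (Suc 0)\<^esub>"
    using d_simps(6)[of ?y 0 ?x] d_simps(1)[of ?x 0] u v by (simp add: a_minus_def E1.M.r_neg)
  then obtain r where r: "r \<in> carrier R" "?y \<ominus>\<^bsub>E 0\<^esub> ?x = \<epsilon> r"
    using eps_exact[of "?y \<ominus>\<^bsub>E 0\<^esub> ?x"] u v by auto
  have yx: "?y = ?x \<oplus>\<^bsub>E 0\<^esub> \<epsilon> r"
    unfolding r(2)[symmetric] using u v by (simp add: a_minus_def E0.M.a_lcomm[of ?x] E0.M.r_neg)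
  have "a \<odot>\<^bsub>E (Suc (Suc 0))\<^esub> z \<in> d (Suc 0) ` pair_torsion R gs gt (E (Suc 0)) \<longleftrightarrow> a \<in> cech_ann gs gt n r"
    if a: "a \<in> carrier R" for a
  proof -
    have comm: "b \<odot>\<^bsub>E k\<^esub> (a \<odot>\<^bsub>E k\<^esub> w) = a \<odot>\<^bsub>E k\<^esub> (b \<odot>\<^bsub>E k\<^esub> w)" if "b \<in> carrier R" "w \<in> carrier (E k)" for b w k
    proof -
      interpret module R "E k" by simp
      show ?thesis using a that m_comm[of a b] by (simp flip: smult_assoc1)
    qed
    have "gt [^] n \<odot>\<^bsub>E 0\<^esub> (a \<odot>\<^bsub>E 0\<^esub> u) = gs [^] n \<odot>\<^bsub>E 0\<^esub> (a \<odot>\<^bsub>E 0\<^esub> v) \<oplus>\<^bsub>E 0\<^esub> \<epsilon> (a \<otimes> r)"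
      using a u v r(1) yx eps_simps(1)[OF r(1)] by (simp add: comm E0.smult_r_distr eps_simps(3))
    then have "d (Suc 0) (a \<odot>\<^bsub>E (Suc 0)\<^esub> e) \<in> d (Suc 0) ` pair_torsion R gs gt (E (Suc 0)) \<longleftrightarrow>
      (\<exists>k. (a \<otimes> r) \<otimes> (gs \<otimes> gt) [^] k \<in> gen2 (gs [^] (n + k)) (gt [^] (n + k)))"
      using a u v r(1) e n(1)
      by (intro boundary_iff[of n _ "a \<odot>\<^bsub>E 0\<^esub> u" "a \<odot>\<^bsub>E 0\<^esub> v"]) (auto simp: comm d_simps(3))
    then show ?thesis using a e by (simp add: d_simps(3) cech_ann_def)
  qed
  moreover have "cech_ann gs gt n r \<subseteq> carrier R" by (auto simp: cech_ann_def)
  ultimately show thesis using r(1) by (intro that[of r n]) auto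
qed

text \<open>Torsion for \<open>x, y\<close> and for \<open>x^N, y^N\<close> is the same, so \<open>x, y\<close> may be replaced by \<open>g s, g t\<close>.\<close>
lemma ass_primes_local_cohomology_subset:
  assumes noeth: "noetherian_ring R" and x: "x \<in> carrier R" and y: "y \<in> carrier R"
    and N: "N > 0" and xN: "x [^] (N::nat) = gs" and yN: "y [^] N = gt"
  shows "ass_primes R (local_cohomology R (Idl\<^bsub>R\<^esub> {x, y}) E d 2) \<subseteq> cyclic_ass R (gen2 s t)"
proof
  let ?I = "Idl\<^bsub>R\<^esub> {x, y}" and ?T = "\<lambda>n. pair_torsion R gs gt (E n)"
  let ?B = "d (Suc 0) ` ?T (Suc 0)"
  have T: "torsion_functor R ?I (E n) = (E n)\<lparr>carrier := ?T n\<rparr>" for n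
  proof -
    interpret module R "E n" by simp
    show ?thesis
      using torsion_functor_eq_pair_torsion[OF module_E x y, of n] pair_torsion_pow[OF x y N] xN yN by simp
  qed
  define Z where "Z = {z \<in> ?T (Suc (Suc 0)). d (Suc (Suc 0)) z = \<zero>\<^bsub>E (Suc (Suc (Suc 0)))\<^esub>}"
  have H: "local_cohomology R ?I E d 2 = quot_module ((E (Suc (Suc 0)))\<lparr>carrier := Z\<rparr>) ?B"
    by (simp add: local_cohomology_def cohomology_def T numeral_2_eq_2 Z_def)
  interpret E1: module R "E (Suc 0)" by simp
  have B: "submodule ?B R (E (Suc (Suc 0)))"
    by (rule mod_hom_image_submodule[OF _ _ d_hom E1.pair_torsion_submodule]) auto
  fix P assume "P \<in> ass_primes R (local_cohomology R ?I E d 2)"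
  then obtain m where P: "primeideal P R"
    "m \<in> carrier (quot_module ((E (Suc (Suc 0)))\<lparr>carrier := Z\<rparr>) ?B)"
    "P = {a \<in> carrier R. a \<odot>\<^bsub>quot_module ((E (Suc (Suc 0)))\<lparr>carrier := Z\<rparr>) ?B\<^esub> m =
      \<zero>\<^bsub>quot_module ((E (Suc (Suc 0)))\<lparr>carrier := Z\<rparr>) ?B\<^esub>}"
    unfolding H ass_primes_def by blast
  obtain z where z: "z \<in> Z" "m = ?B +>\<^bsub>(E (Suc (Suc 0)))\<lparr>carrier := Z\<rparr>\<^esub> z"
    using P(2) by (auto simp: quot_module_def A_RCOSETS_def')
  have zc: "z \<in> carrier (E (Suc (Suc 0)))" using z by (simp add: Z_def pair_torsion_def)
  have "P = {a \<in> carrier R. a \<odot>\<^bsub>E (Suc (Suc 0))\<^esub> z \<in> ?B}"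
    unfolding P(3) z(2) by (intro Collect_cong conj_cong refl quot_module_smult_zero_iff[OF module_E B _ zc])
  moreover obtain n r where "r \<in> carrier R" "{a \<in> carrier R. a \<odot>\<^bsub>E (Suc (Suc 0))\<^esub> z \<in> ?B} = cech_ann gs gt n r"
  proof (rule annihilator_eq_cech_ann)
    show "z \<in> ?T (Suc (Suc 0))" "d (Suc (Suc 0)) z = \<zero>\<^bsub>E (Suc (Suc (Suc 0)))\<^esub>"
      using z(1) by (simp_all add: Z_def)
  qed
  ultimately show "P \<in> cyclic_ass R (gen2 s t)"
    using cech_ann_prime[OF noeth coprime g s t, of r n] P(1) by simp
qed

end

section \<open>Powers in almost factorial rings\<close>

locale frac_domain = domain R + K: field "frac_field R" for R :: "('a, 'r) ring_scheme" (structure)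
begin

abbreviation K where "K \<equiv> frac_field R"
abbreviation S where "S \<equiv> frac_image R"
abbreviation emb where "emb \<equiv> frac_embed R"

lemma emb_simps:
  "a \<in> carrier R \<Longrightarrow> emb a \<in> carrier K"
  "a \<in> carrier R \<Longrightarrow> b \<in> carrier R \<Longrightarrow> emb (a \<otimes> b) = emb a \<otimes>\<^bsub>K\<^esub> emb b"
  "a \<in> carrier R \<Longrightarrow> b \<in> carrier R \<Longrightarrow> emb (a \<oplus> b) = emb a \<oplus>\<^bsub>K\<^esub> emb b"
  "emb \<one> = \<one>\<^bsub>K\<^esub>" "emb \<zero> = \<zero>\<^bsub>K\<^esub>"
  using frac_embed_hom frac_field_zero_one by (auto simp: ring_hom_def frac_embed_def)

lemma emb_inject: "a \<in> carrier R \<Longrightarrow> b \<in> carrier R \<Longrightarrow> emb a = emb b \<longleftrightarrow> a = b"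
  using frac_embed_inj by (auto simp: inj_on_def)

lemma emb_pow: "a \<in> carrier R \<Longrightarrow> emb (a [^] (n::nat)) = emb a [^]\<^bsub>K\<^esub> n"
  by (induction n) (simp_all add: emb_simps)

lemma S_closed:
  shows S_carrier: "u \<in> S \<Longrightarrow> u \<in> carrier K"
    and S_mult: "u \<in> S \<Longrightarrow> w \<in> S \<Longrightarrow> u \<otimes>\<^bsub>K\<^esub> w \<in> S"
    and S_add: "u \<in> S \<Longrightarrow> w \<in> S \<Longrightarrow> u \<oplus>\<^bsub>K\<^esub> w \<in> S"
    and S_one: "\<one>\<^bsub>K\<^esub> \<in> S" and S_zero: "\<zero>\<^bsub>K\<^esub> \<in> S"
proof -
  show "u \<in> S \<Longrightarrow> u \<in> carrier K" using emb_simps(1) by auto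
  show "u \<in> S \<Longrightarrow> w \<in> S \<Longrightarrow> u \<otimes>\<^bsub>K\<^esub> w \<in> S" by (auto simp flip: emb_simps(2))
  show "u \<in> S \<Longrightarrow> w \<in> S \<Longrightarrow> u \<oplus>\<^bsub>K\<^esub> w \<in> S" by (auto simp flip: emb_simps(3))
  show "\<one>\<^bsub>K\<^esub> \<in> S" "\<zero>\<^bsub>K\<^esub> \<in> S" by (simp_all flip: emb_simps(4,5))
qed

lemma S_pow: "u \<in> S \<Longrightarrow> u [^]\<^bsub>K\<^esub> (n::nat) \<in> S"
  by (induction n) (simp_all add: S_one S_mult)

lemma ring_colonI: "u \<in> carrier K \<Longrightarrow> (\<And>w. w \<in> A \<Longrightarrow> u \<otimes>\<^bsub>K\<^esub> w \<in> S) \<Longrightarrow> u \<in> ring_colon R A"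
  by (auto simp: ring_colon_def)

lemma ring_colonD: "u \<in> ring_colon R A \<Longrightarrow> w \<in> A \<Longrightarrow> u \<otimes>\<^bsub>K\<^esub> w \<in> S"
  "u \<in> ring_colon R A \<Longrightarrow> u \<in> carrier K"
  unfolding ring_colon_def by blast+

lemma closure_extensive:
  assumes "A \<subseteq> carrier K"
  shows "A \<subseteq> ring_colon R (ring_colon R A)"
proof
  fix a assume a: "a \<in> A"
  show "a \<in> ring_colon R (ring_colon R A)"
  proof (rule ring_colonI)
    show "a \<in> carrier K" using a assms by auto
    fix w assume w: "w \<in> ring_colon R A"
    then have "w \<otimes>\<^bsub>K\<^esub> a \<in> S" using ring_colonD(1) a by metis
    then show "a \<otimes>\<^bsub>K\<^esub> w \<in> S" using K.m_comm[of a w] a assms ring_colonD(2)[OF w] by auto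
  qed
qed

text \<open>An element that multiplies \<open>A\<close> into \<open>R\<close> also multiplies the divisorial closure \<open>(R : (R : A))\<close> into
  \<open>R\<close>.  Products of divisorial ideals are controlled through this test alone.\<close>
lemma closure_test:
  assumes "f \<in> carrier K" "\<And>w. w \<in> A \<Longrightarrow> f \<otimes>\<^bsub>K\<^esub> w \<in> S" "q \<in> ring_colon R (ring_colon R A)"
  shows "f \<otimes>\<^bsub>K\<^esub> q \<in> S"
proof -
  have "f \<in> ring_colon R A" using assms(1,2) by (rule ring_colonI)
  then have "q \<otimes>\<^bsub>K\<^esub> f \<in> S" using ring_colonD(1)[OF assms(3)] by metis
  then show ?thesis using K.m_comm[of q f] assms(1) ring_colonD(2)[OF assms(3)] by simp
qed

lemma ring_colon_closure:
  assumes "A \<subseteq> carrier K"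
  shows "ring_colon R (ring_colon R (ring_colon R A)) = ring_colon R A"
proof
  show "ring_colon R (ring_colon R (ring_colon R A)) \<subseteq> ring_colon R A"
  proof (intro subsetI ring_colonI)
    fix u w assume u: "u \<in> ring_colon R (ring_colon R (ring_colon R A))" and w: "w \<in> A"
    show "u \<otimes>\<^bsub>K\<^esub> w \<in> S" using ring_colonD(1)[OF u] w closure_extensive[OF assms] by blast
  qed (rule ring_colonD(2))
  show "ring_colon R A \<subseteq> ring_colon R (ring_colon R (ring_colon R A))"
    using ring_colonD(2) by (intro closure_extensive) blast
qed

lemma ring_colon_smult: "u \<in> ring_colon R A \<Longrightarrow> A \<subseteq> carrier K \<Longrightarrow> a \<in> S \<Longrightarrow> a \<otimes>\<^bsub>K\<^esub> u \<in> ring_colon R A"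
proof (rule ring_colonI)
  assume u: "u \<in> ring_colon R A" and A: "A \<subseteq> carrier K" and a: "a \<in> S"
  show "a \<otimes>\<^bsub>K\<^esub> u \<in> carrier K" using ring_colonD(2)[OF u] S_carrier[OF a] by simp
  fix w assume w: "w \<in> A"
  then have "(a \<otimes>\<^bsub>K\<^esub> u) \<otimes>\<^bsub>K\<^esub> w = a \<otimes>\<^bsub>K\<^esub> (u \<otimes>\<^bsub>K\<^esub> w)"
    using ring_colonD(2)[OF u] S_carrier[OF a] A by (auto simp: K.m_assoc)
  then show "(a \<otimes>\<^bsub>K\<^esub> u) \<otimes>\<^bsub>K\<^esub> w \<in> S" using S_mult[OF a ring_colonD(1)[OF u w]] by metis
qed

lemma ring_colon_additive_subgroup:
  assumes A: "A \<subseteq> carrier K"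
  shows "additive_subgroup (ring_colon R A) K"
proof (rule additive_subgroup.intro, rule K.add.subgroupI)
  show "ring_colon R A \<subseteq> carrier K" using ring_colonD(2) by blast
  have "\<zero>\<^bsub>K\<^esub> \<in> ring_colon R A"
  proof (rule ring_colonI)
    fix w assume "w \<in> A"
    then have "\<zero>\<^bsub>K\<^esub> \<otimes>\<^bsub>K\<^esub> w = \<zero>\<^bsub>K\<^esub>" using A by auto
    then show "\<zero>\<^bsub>K\<^esub> \<otimes>\<^bsub>K\<^esub> w \<in> S" using S_zero by metis
  qed simp
  then show "ring_colon R A \<noteq> {}" by auto
next
  fix u assume u: "u \<in> ring_colon R A"
  have "emb (\<ominus> \<one>) \<oplus>\<^bsub>K\<^esub> \<one>\<^bsub>K\<^esub> = \<zero>\<^bsub>K\<^esub>" using emb_simps(3)[of "\<ominus> \<one>" \<one>] emb_simps(4,5) by (simp add: l_neg)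
  then have "emb (\<ominus> \<one>) = \<ominus>\<^bsub>K\<^esub> \<one>\<^bsub>K\<^esub>" using K.sum_zero_eq_neg emb_simps(1) by simp
  then have "\<ominus>\<^bsub>K\<^esub> u = emb (\<ominus> \<one>) \<otimes>\<^bsub>K\<^esub> u" using ring_colonD(2)[OF u] by (simp add: K.l_minus)
  then show "\<ominus>\<^bsub>K\<^esub> u \<in> ring_colon R A" using ring_colon_smult[OF u A, of "emb (\<ominus> \<one>)"] by simp
next
  fix u w assume u: "u \<in> ring_colon R A" and w: "w \<in> ring_colon R A"
  show "u \<oplus>\<^bsub>K\<^esub> w \<in> ring_colon R A"
  proof (rule ring_colonI)
    show "u \<oplus>\<^bsub>K\<^esub> w \<in> carrier K" using ring_colonD(2) u w by blast
    fix a assume a: "a \<in> A"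
    then have "(u \<oplus>\<^bsub>K\<^esub> w) \<otimes>\<^bsub>K\<^esub> a = u \<otimes>\<^bsub>K\<^esub> a \<oplus>\<^bsub>K\<^esub> w \<otimes>\<^bsub>K\<^esub> a"
      using ring_colonD(2) u w A by (intro K.l_distr) auto
    then show "(u \<oplus>\<^bsub>K\<^esub> w) \<otimes>\<^bsub>K\<^esub> a \<in> S" using S_add[OF ring_colonD(1)[OF u a] ring_colonD(1)[OF w a]] by metis
  qed
qed

lemma ideal_prod_test:
  assumes f: "f \<in> carrier K" and I: "I \<subseteq> carrier K" "J \<subseteq> carrier K"
    and test: "\<And>i j. i \<in> I \<Longrightarrow> j \<in> J \<Longrightarrow> f \<otimes>\<^bsub>K\<^esub> (i \<otimes>\<^bsub>K\<^esub> j) \<in> S"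
    and w: "w \<in> ideal_prod K I J"
  shows "w \<in> carrier K \<and> f \<otimes>\<^bsub>K\<^esub> w \<in> S"
  using w
proof (induction rule: ideal_prod.induct)
  case (prod i j)
  then show ?case using I test by auto
next
  case (sum w w')
  then show ?case using f S_add by (metis K.add.m_closed K.r_distr)
qed

lemma ideal_prod_carrier:
  assumes "I \<subseteq> carrier K" "J \<subseteq> carrier K"
  shows "ideal_prod K I J \<subseteq> carrier K"
proof
  fix w assume "w \<in> ideal_prod K I J"
  then show "w \<in> carrier K"
  proof (induction rule: ideal_prod.induct)
    case (prod i j)
    then show ?case using assms by auto
  qed simp
qed

lemma divisorial_pair:
  assumes x: "x \<in> carrier R" "x \<noteq> \<zero>" and y: "y \<in> carrier R"
  shows "divisorial_ideal R (ring_colon R (ring_colon R {emb x, emb y}))"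
proof -
  let ?A = "{emb x, emb y}"
  have A: "?A \<subseteq> carrier K" using emb_simps(1) x y by simp
  have A': "ring_colon R ?A \<subseteq> carrier K" using ring_colonD(2) by blast
  have one: "\<one>\<^bsub>K\<^esub> \<in> ring_colon R ?A"
    using x y emb_simps(1) by (intro ring_colonI) auto
  have "emb x \<in> ring_colon R (ring_colon R ?A)" using closure_extensive[OF A] by simp
  moreover have "emb x \<noteq> \<zero>\<^bsub>K\<^esub>" using emb_inject[of x \<zero>] x emb_simps(5) by simp
  ultimately have nz: "ring_colon R (ring_colon R ?A) \<noteq> {\<zero>\<^bsub>K\<^esub>}" by blast
  have "emb \<one> \<otimes>\<^bsub>K\<^esub> u \<in> S" if "u \<in> ring_colon R (ring_colon R ?A)" for u
    using ring_colonD[OF that] one by (metis K.m_comm K.one_closed emb_simps(4))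
  then have "fractional_ideal R (ring_colon R (ring_colon R ?A))"
    unfolding fractional_ideal_def
    using ring_colon_additive_subgroup[OF A'] ring_colon_smult[OF _ A'] nz by (intro conjI ballI bexI[of _ \<one>]) auto
  then show ?thesis unfolding divisorial_ideal_def using ring_colon_closure[OF A'] by simp
qed

text \<open>For each valuation the value of \<open>a^i b^j\<close> lies between those of \<open>a^n\<close> and \<open>b^n\<close> with \<open>n = i + j\<close>.
  Hence \<open>(a, b)^n\<close> and \<open>(a^n, b^n)\<close> have the same divisorial closure.\<close>
lemma krull_mixed_powers:
  assumes krull: "krull_domain R" and f: "f \<in> carrier K"
    and a: "a \<in> carrier K - {\<zero>\<^bsub>K\<^esub>}" and b: "b \<in> carrier K - {\<zero>\<^bsub>K\<^esub>}"
    and fa: "f \<otimes>\<^bsub>K\<^esub> a [^]\<^bsub>K\<^esub> (i + j) \<in> S" and fb: "f \<otimes>\<^bsub>K\<^esub> b [^]\<^bsub>K\<^esub> (i + j) \<in> S"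
  shows "f \<otimes>\<^bsub>K\<^esub> (a [^]\<^bsub>K\<^esub> (i::nat) \<otimes>\<^bsub>K\<^esub> b [^]\<^bsub>K\<^esub> (j::nat)) \<in> S"
proof (cases "f = \<zero>\<^bsub>K\<^esub>")
  case True
  then show ?thesis using a b S_zero by simp
next
  case False
  let ?U = "carrier K - {\<zero>\<^bsub>K\<^esub>}"
  have fU: "f \<in> ?U" using f False by simp
  have mult: "u \<otimes>\<^bsub>K\<^esub> w \<in> ?U" if "u \<in> ?U" "w \<in> ?U" for u w using that K.integral by auto
  have pow: "u [^]\<^bsub>K\<^esub> (n::nat) \<in> ?U" if "u \<in> ?U" for u n
  proof (induction n)
    case (Suc n)
    then show ?case using mult that by simp
  qed simp
  obtain V where V': "(\<forall>v\<in>V. discrete_valuation K v) \<and> (\<forall>u\<in>?U. finite {v \<in> V. v u \<noteq> 0}) \<and>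
      (\<forall>u\<in>?U. u \<in> S \<longleftrightarrow> (\<forall>v\<in>V. 0 \<le> v u))"
    using conjunct2[OF krull[unfolded krull_domain_def]] by (rule exE)
  note V = bspec[OF conjunct1[OF V']] and S_iff = bspec[OF conjunct2[OF conjunct2[OF V']]]
  have v_mult: "v (u \<otimes>\<^bsub>K\<^esub> w) = v u + v w" if "v \<in> V" "u \<in> ?U" "w \<in> ?U" for u v w
    by (rule bspec[OF bspec[OF conjunct1[OF V[OF that(1), unfolded discrete_valuation_def]] that(2)] that(3)])
  have one: "\<one>\<^bsub>K\<^esub> \<in> ?U" by simp
  have v_pow: "v (u [^]\<^bsub>K\<^esub> n) = int n * v u" if "v \<in> V" "u \<in> ?U" for u v n
  proof (induction n)
    case 0
    then show ?case using v_mult[OF that(1) one one] by simp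
  next
    case (Suc n)
    then show ?case using v_mult[OF that(1) pow[OF that(2)] that(2)] by (simp add: algebra_simps)
  qed
  have "0 \<le> v (f \<otimes>\<^bsub>K\<^esub> (a [^]\<^bsub>K\<^esub> i \<otimes>\<^bsub>K\<^esub> b [^]\<^bsub>K\<^esub> j))" if v: "v \<in> V" for v
  proof -
    have va: "0 \<le> v f + int (i + j) * v a"
      using S_iff[OF mult[OF fU pow[OF a]]] fa v v_mult[OF v fU pow[OF a]] v_pow[OF v a] by metis
    have vb: "0 \<le> v f + int (i + j) * v b"
      using S_iff[OF mult[OF fU pow[OF b]]] fb v v_mult[OF v fU pow[OF b]] v_pow[OF v b] by metis
    have "v (f \<otimes>\<^bsub>K\<^esub> (a [^]\<^bsub>K\<^esub> i \<otimes>\<^bsub>K\<^esub> b [^]\<^bsub>K\<^esub> j)) = v f + (int i * v a + int j * v b)"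
      using v_mult[OF v fU mult[OF pow[OF a] pow[OF b]]] v_mult[OF v pow[OF a] pow[OF b]] v_pow[OF v a] v_pow[OF v b]
      by simp
    moreover have "int (i + j) * v a \<le> int i * v a + int j * v b \<or> int (i + j) * v b \<le> int i * v a + int j * v b"
      using mult_left_mono[of "v a" "v b" "int j"] mult_left_mono[of "v b" "v a" "int i"]
      by (cases "v a \<le> v b") (auto simp: algebra_simps)
    ultimately show ?thesis using va vb by linarith
  qed
  then show ?thesis using S_iff[OF mult[OF fU mult[OF pow[OF a] pow[OF b]]]] by blast
qed

text \<open>The divisorial ideal \<open>I\<close> generated by \<open>x\<close> and \<open>y\<close> has finite order \<open>N\<close> in the class group, so its
  \<open>N\<close>-th power \<open>u R\<close> is principal.  It contains \<open>x^N\<close> and \<open>y^N\<close>, and it lies in the divisorial closure of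
  the monomials \<open>x^i y^j\<close> of degree \<open>N\<close>, which is the last conclusion.\<close>
lemma almost_factorial_principal_power:
  assumes af: "almost_factorial R" and x: "x \<in> carrier R" "x \<noteq> \<zero>" and y: "y \<in> carrier R"
  obtains N :: nat and u where "N > 0" "u \<in> carrier K - {\<zero>\<^bsub>K\<^esub>}"
    "emb x [^]\<^bsub>K\<^esub> N \<in> (\<lambda>w. u \<otimes>\<^bsub>K\<^esub> w) ` S" "emb y [^]\<^bsub>K\<^esub> N \<in> (\<lambda>w. u \<otimes>\<^bsub>K\<^esub> w) ` S"
    "\<forall>f\<in>carrier K. (\<forall>i j. i + j = N \<longrightarrow> f \<otimes>\<^bsub>K\<^esub> (emb x [^]\<^bsub>K\<^esub> i \<otimes>\<^bsub>K\<^esub> emb y [^]\<^bsub>K\<^esub> j) \<in> S)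
      \<longrightarrow> f \<otimes>\<^bsub>K\<^esub> u \<in> S"
proof -
  let ?x = "emb x" and ?y = "emb y"
  have xK: "?x \<in> carrier K" and yK: "?y \<in> carrier K" using emb_simps(1) x y by auto
  have SK: "S \<subseteq> carrier K" using S_carrier by blast
  have cK: "ring_colon R A \<subseteq> carrier K" for A using ring_colonD(2) by blast
  define I where "I = ring_colon R (ring_colon R {?x, ?y})"
  let ?D = "divisor_group R" and ?H = "principal_divisors R"
  let ?M = "divisor_class_group R"
  define Q where "Q = S \<otimes>\<^bsub>?D\<^esub> I"
  define C where "C = ?H #>\<^bsub>?D\<^esub> I"
  have IK: "I \<subseteq> carrier K" using cK by (simp add: I_def)
  have xyI: "?x \<in> I" "?y \<in> I" using closure_extensive[of "{?x, ?y}"] xK yK by (auto simp: I_def)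
  have Q: "Q = ring_colon R (ring_colon R (ideal_prod K S I))" by (simp add: Q_def divisor_group_def)
  have QK: "Q \<subseteq> carrier K" unfolding Q by (rule cK)
  have IQ: "I \<subseteq> Q"
  proof
    fix z assume z: "z \<in> I"
    then have "\<one>\<^bsub>K\<^esub> \<otimes>\<^bsub>K\<^esub> z \<in> ideal_prod K S I" using S_one by (intro ideal_prod.prod)
    moreover have "\<one>\<^bsub>K\<^esub> \<otimes>\<^bsub>K\<^esub> z = z" using z IK by auto
    ultimately have "z \<in> ideal_prod K S I" by metis
    then show "z \<in> Q" unfolding Q using closure_extensive[OF ideal_prod_carrier[OF SK IK]] by blast
  qed
  have Q_test: "f \<otimes>\<^bsub>K\<^esub> q \<in> S"
    if f: "f \<in> carrier K" "f \<otimes>\<^bsub>K\<^esub> ?x \<in> S" "f \<otimes>\<^bsub>K\<^esub> ?y \<in> S" and q: "q \<in> Q" for f q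
  proof (rule closure_test[OF f(1)])
    show "q \<in> ring_colon R (ring_colon R (ideal_prod K S I))" using q by (simp only: Q)
    fix w assume w: "w \<in> ideal_prod K S I"
    have "f \<otimes>\<^bsub>K\<^esub> (a \<otimes>\<^bsub>K\<^esub> z) \<in> S" if a: "a \<in> S" and z: "z \<in> I" for a z
    proof -
      have "f \<otimes>\<^bsub>K\<^esub> z \<in> S" using closure_test[OF f(1), of "{?x, ?y}"] f(2,3) z by (auto simp: I_def)
      moreover have "f \<otimes>\<^bsub>K\<^esub> (a \<otimes>\<^bsub>K\<^esub> z) = a \<otimes>\<^bsub>K\<^esub> (f \<otimes>\<^bsub>K\<^esub> z)"
        using f(1) S_carrier[OF a] z IK by (intro K.m_lcomm) auto
      ultimately show ?thesis using S_mult[OF a] by metis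
    qed
    then show "f \<otimes>\<^bsub>K\<^esub> w \<in> S" using ideal_prod_test[OF f(1) SK IK _ w] by blast
  qed
  \<comment> \<open>The powers of \<open>I\<close>, up to a unit factor \<open>S\<close> which places \<open>Q\<close> in the coset \<open>C\<close> of \<open>I\<close>.\<close>
  define P where "P = rec_nat S (\<lambda>_ P. P \<otimes>\<^bsub>?D\<^esub> Q)"
  have P0: "P 0 = S" and PSuc': "P (Suc k) = P k \<otimes>\<^bsub>?D\<^esub> Q" for k by (simp_all add: P_def)
  have PSuc: "P (Suc k) = ring_colon R (ring_colon R (ideal_prod K (P k) Q))" for k
    by (simp add: PSuc' divisor_group_def)
  have PK: "P k \<subseteq> carrier K" for k
  proof (cases k)
    case 0
    then show ?thesis using SK P0 by simp
  next
    case (Suc l)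
    then show ?thesis unfolding Suc PSuc by (intro cK)
  qed
  have P_pow: "z [^]\<^bsub>K\<^esub> k \<in> P k" if z: "z \<in> I" for z k
  proof (induction k)
    case 0
    then show ?case using S_one P0 by simp
  next
    case (Suc k)
    have "z [^]\<^bsub>K\<^esub> k \<otimes>\<^bsub>K\<^esub> z \<in> ideal_prod K (P k) Q" using Suc z IQ by (intro ideal_prod.prod) auto
    then show ?case unfolding PSuc using closure_extensive[OF ideal_prod_carrier[OF PK QK]] by auto
  qed
  have P_test: "f \<in> carrier K \<Longrightarrow> (\<And>i j. i + j = k \<Longrightarrow> f \<otimes>\<^bsub>K\<^esub> (?x [^]\<^bsub>K\<^esub> i \<otimes>\<^bsub>K\<^esub> ?y [^]\<^bsub>K\<^esub> j) \<in> S)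
      \<Longrightarrow> p \<in> P k \<Longrightarrow> f \<otimes>\<^bsub>K\<^esub> p \<in> S" for f k p
  proof (induction k arbitrary: f p)
    case 0
    have "f \<in> S" using 0(1) 0(2)[of 0 0] by simp
    then show ?case using 0(3) S_mult P0 by simp
  next
    case (Suc k)
    note f = Suc.prems(1) and test = Suc.prems(2)
    have 1: "(f \<otimes>\<^bsub>K\<^esub> ?x) \<otimes>\<^bsub>K\<^esub> (?x [^]\<^bsub>K\<^esub> i \<otimes>\<^bsub>K\<^esub> ?y [^]\<^bsub>K\<^esub> j) \<in> S" if "i + j = k" for i j
      using test[of "Suc i" j] that f xK yK by (simp add: K.m_ac)
    have 2: "(f \<otimes>\<^bsub>K\<^esub> ?y) \<otimes>\<^bsub>K\<^esub> (?x [^]\<^bsub>K\<^esub> i \<otimes>\<^bsub>K\<^esub> ?y [^]\<^bsub>K\<^esub> j) \<in> S" if "i + j = k" for i j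
      using test[of i "Suc j"] that f xK yK by (simp add: K.m_ac)
    have "f \<otimes>\<^bsub>K\<^esub> (p \<otimes>\<^bsub>K\<^esub> q) \<in> S" if p: "p \<in> P k" and q: "q \<in> Q" for p q
    proof -
      have pq: "p \<in> carrier K" "q \<in> carrier K" using p q PK QK by auto
      have "(f \<otimes>\<^bsub>K\<^esub> ?x) \<otimes>\<^bsub>K\<^esub> p \<in> S" "(f \<otimes>\<^bsub>K\<^esub> ?y) \<otimes>\<^bsub>K\<^esub> p \<in> S"
        using Suc.IH[OF _ 1 p] Suc.IH[OF _ 2 p] f xK yK by auto
      then have "(f \<otimes>\<^bsub>K\<^esub> p) \<otimes>\<^bsub>K\<^esub> ?x \<in> S" "(f \<otimes>\<^bsub>K\<^esub> p) \<otimes>\<^bsub>K\<^esub> ?y \<in> S"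
        using f xK yK pq by (simp_all add: K.m_ac)
      then have "(f \<otimes>\<^bsub>K\<^esub> p) \<otimes>\<^bsub>K\<^esub> q \<in> S" using Q_test q f pq by simp
      then show ?thesis using f pq by (simp add: K.m_assoc)
    qed
    then show ?case
      using closure_test[OF f _ Suc.prems(3)[unfolded PSuc]] ideal_prod_test[OF f PK QK] by blast
  qed
  have SH: "S \<in> ?H"
  proof -
    have "(\<lambda>w. \<one>\<^bsub>K\<^esub> \<otimes>\<^bsub>K\<^esub> w) ` S = (\<lambda>w. w) ` S"
      by (rule image_cong[OF refl], rule K.l_one, rule S_carrier)
    then have "S = (\<lambda>w. \<one>\<^bsub>K\<^esub> \<otimes>\<^bsub>K\<^esub> w) ` S" by simp
    moreover have "\<one>\<^bsub>K\<^esub> \<in> carrier K - {\<zero>\<^bsub>K\<^esub>}" by simp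
    ultimately show ?thesis unfolding principal_divisors_def by (intro CollectI exI conjI)
  qed
  have QC: "Q \<in> C" unfolding C_def Q_def r_coset_def using SH by blast
  have "divisorial_ideal R I" unfolding I_def by (rule divisorial_pair[OF x y])
  then have "C \<in> carrier ?M"
    unfolding divisor_class_group_def FactGroup_def C_def RCOSETS_def
    by (auto simp: divisor_group_def)
  then obtain N :: nat where N: "N > 0" "C [^]\<^bsub>?M\<^esub> N = \<one>\<^bsub>?M\<^esub>"
    using af unfolding almost_factorial_def torsion_group_def by blast
  \<comment> \<open>The \<open>k\<close>-th power of \<open>C\<close> as a set of products, so that a trivial power contains a principal divisor.\<close>
  have "P k \<in> C [^]\<^bsub>?M\<^esub> k" for k
  proof (induction k)
    case 0
    then show ?case using SH P0 by (simp add: divisor_class_group_def FactGroup_def nat_pow_def)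
  next
    case (Suc k)
    have "C [^]\<^bsub>?M\<^esub> Suc k = (C [^]\<^bsub>?M\<^esub> k) <#>\<^bsub>?D\<^esub> C"
      by (simp add: divisor_class_group_def FactGroup_def nat_pow_def)
    then show ?case unfolding PSuc' set_mult_def using Suc QC by auto
  qed
  then have "P N \<in> ?H" using N(2) by (metis divisor_class_group_def FactGroup_def monoid.select_convs(2))
  then obtain u where u: "u \<in> carrier K - {\<zero>\<^bsub>K\<^esub>}" "P N = (\<lambda>w. u \<otimes>\<^bsub>K\<^esub> w) ` S"
    unfolding principal_divisors_def by blast
  have "u \<otimes>\<^bsub>K\<^esub> \<one>\<^bsub>K\<^esub> \<in> P N" unfolding u(2) using S_one by blast
  then have uP: "u \<in> P N" using u(1) by simp
  show thesis
  proof (rule that[OF N(1) u(1)])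
    show "?x [^]\<^bsub>K\<^esub> N \<in> (\<lambda>w. u \<otimes>\<^bsub>K\<^esub> w) ` S" "?y [^]\<^bsub>K\<^esub> N \<in> (\<lambda>w. u \<otimes>\<^bsub>K\<^esub> w) ` S"
      using P_pow xyI by (simp_all only: u(2)[symmetric])
    show "\<forall>f\<in>carrier K. (\<forall>i j. i + j = N \<longrightarrow> f \<otimes>\<^bsub>K\<^esub> (?x [^]\<^bsub>K\<^esub> i \<otimes>\<^bsub>K\<^esub> ?y [^]\<^bsub>K\<^esub> j) \<in> S) \<longrightarrow> f \<otimes>\<^bsub>K\<^esub> u \<in> S"
      using P_test[OF _ _ uP] by simp
  qed
qed

text \<open>Dividing \<open>x^N\<close> and \<open>y^N\<close> by the generator \<open>g\<close> of \<open>I^N\<close> leaves a pair \<open>s, t\<close> whose divisorial closure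
  is \<open>R\<close>.  If \<open>a s = b t\<close>, the fraction \<open>f = a / t = b / s\<close> multiplies \<open>s\<close> and \<open>t\<close> into \<open>R\<close>, so it lies in
  \<open>R\<close> and is the common factor \<open>c\<close>.\<close>
lemma almost_factorial_coprime_power:
  assumes af: "almost_factorial R" and x: "x \<in> carrier R" "x \<noteq> \<zero>" and y: "y \<in> carrier R" "y \<noteq> \<zero>"
  obtains N :: nat and g s t where "N > 0" "g \<in> carrier R" "s \<in> carrier R" "t \<in> carrier R"
    "x [^] N = g \<otimes> s" "y [^] N = g \<otimes> t" "coprime_pair s t"
proof -
  have krull: "krull_domain R" using af by (simp add: almost_factorial_def)
  let ?x = "emb x" and ?y = "emb y"
  have xK: "?x \<in> carrier K - {\<zero>\<^bsub>K\<^esub>}" and yK: "?y \<in> carrier K - {\<zero>\<^bsub>K\<^esub>}"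
    using emb_simps(1,5) emb_inject[of _ \<zero>] x y by auto
  obtain N :: nat and u where N: "N > 0" and u: "u \<in> carrier K - {\<zero>\<^bsub>K\<^esub>}"
    and xN: "?x [^]\<^bsub>K\<^esub> N \<in> (\<lambda>w. u \<otimes>\<^bsub>K\<^esub> w) ` S" and yN: "?y [^]\<^bsub>K\<^esub> N \<in> (\<lambda>w. u \<otimes>\<^bsub>K\<^esub> w) ` S"
    and test: "\<forall>f\<in>carrier K. (\<forall>i j. i + j = N \<longrightarrow> f \<otimes>\<^bsub>K\<^esub> (?x [^]\<^bsub>K\<^esub> i \<otimes>\<^bsub>K\<^esub> ?y [^]\<^bsub>K\<^esub> j) \<in> S)
      \<longrightarrow> f \<otimes>\<^bsub>K\<^esub> u \<in> S"
    by (rule almost_factorial_principal_power[OF af x y(1)])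
  have "\<one>\<^bsub>K\<^esub> \<otimes>\<^bsub>K\<^esub> (?x [^]\<^bsub>K\<^esub> i \<otimes>\<^bsub>K\<^esub> ?y [^]\<^bsub>K\<^esub> j) \<in> S" for i j :: nat
    using S_mult[OF S_one S_mult[OF S_pow S_pow]] x y by simp
  then have "\<one>\<^bsub>K\<^esub> \<otimes>\<^bsub>K\<^esub> u \<in> S" using bspec[OF test K.one_closed] by simp
  then obtain g where g: "g \<in> carrier R" "u = emb g" using u by auto
  obtain s where s: "s \<in> carrier R" "?x [^]\<^bsub>K\<^esub> N = u \<otimes>\<^bsub>K\<^esub> emb s" using xN by auto
  obtain t where t: "t \<in> carrier R" "?y [^]\<^bsub>K\<^esub> N = u \<otimes>\<^bsub>K\<^esub> emb t" using yN by auto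
  have xgs: "x [^] N = g \<otimes> s" using s g x emb_inject[of "x [^] N" "g \<otimes> s"] by (simp add: emb_pow emb_simps)
  have ygt: "y [^] N = g \<otimes> t" using t g y emb_inject[of "y [^] N" "g \<otimes> t"] by (simp add: emb_pow emb_simps)
  have "y [^] k \<noteq> \<zero>" for k :: nat by (induction k) (use y in auto)
  then have t0: "t \<noteq> \<zero>" using ygt g t by auto
  have "coprime_pair s t"
    unfolding coprime_pair_def
  proof (intro ballI impI)
    fix a b assume a: "a \<in> carrier R" and b: "b \<in> carrier R" and ab: "a \<otimes> s = b \<otimes> t"
    have tK: "emb t \<in> carrier K" and sK: "emb s \<in> carrier K" and aK: "emb a \<in> carrier K" and bK: "emb b \<in> carrier K"
      using emb_simps(1) s t a b by auto
    have t0K: "emb t \<noteq> \<zero>\<^bsub>K\<^esub>" using emb_inject[of t \<zero>] t t0 emb_simps(5) by simp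
    define f where "f = inv\<^bsub>K\<^esub> (emb t) \<otimes>\<^bsub>K\<^esub> emb a"
    have it: "inv\<^bsub>K\<^esub> (emb t) \<in> carrier K" "inv\<^bsub>K\<^esub> (emb t) \<otimes>\<^bsub>K\<^esub> emb t = \<one>\<^bsub>K\<^esub>"
      using K.field_Units tK t0K by auto
    have iu: "inv\<^bsub>K\<^esub> u \<in> carrier K" "inv\<^bsub>K\<^esub> u \<otimes>\<^bsub>K\<^esub> u = \<one>\<^bsub>K\<^esub>"
      using K.field_Units u by auto
    have fK: "f \<in> carrier K" using it aK by (simp add: f_def)
    have ft: "f \<otimes>\<^bsub>K\<^esub> emb t = emb a"
    proof -
      have "f \<otimes>\<^bsub>K\<^esub> emb t = (inv\<^bsub>K\<^esub> (emb t) \<otimes>\<^bsub>K\<^esub> emb t) \<otimes>\<^bsub>K\<^esub> emb a"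
        unfolding f_def using it(1) tK aK by (simp add: K.m_ac)
      then show ?thesis using it aK by simp
    qed
    have fs: "f \<otimes>\<^bsub>K\<^esub> emb s = emb b"
    proof -
      have "f \<otimes>\<^bsub>K\<^esub> emb s = inv\<^bsub>K\<^esub> (emb t) \<otimes>\<^bsub>K\<^esub> emb (a \<otimes> s)"
        unfolding f_def using it(1) aK sK a s by (simp add: emb_simps K.m_assoc)
      also have "\<dots> = (inv\<^bsub>K\<^esub> (emb t) \<otimes>\<^bsub>K\<^esub> emb t) \<otimes>\<^bsub>K\<^esub> emb b"
        unfolding ab using it(1) tK bK b t by (simp add: emb_simps K.m_ac)
      finally show ?thesis using it bK by simp
    qed
    \<comment> \<open>Multiplies \<open>x^N = u s\<close> to \<open>b\<close> and \<open>y^N = u t\<close> to \<open>a\<close>, both in \<open>R\<close>.\<close>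
    define h where "h = f \<otimes>\<^bsub>K\<^esub> inv\<^bsub>K\<^esub> u"
    have hK: "h \<in> carrier K" using fK iu by (simp add: h_def)
    have hu: "h \<otimes>\<^bsub>K\<^esub> u = f" using fK iu u by (simp add: h_def K.m_assoc)
    have "h \<otimes>\<^bsub>K\<^esub> (u \<otimes>\<^bsub>K\<^esub> w) = f \<otimes>\<^bsub>K\<^esub> w" if "w \<in> carrier K" for w
      using hK that u hu by (metis DiffD1 K.m_assoc)
    then have "h \<otimes>\<^bsub>K\<^esub> ?x [^]\<^bsub>K\<^esub> N \<in> S" "h \<otimes>\<^bsub>K\<^esub> ?y [^]\<^bsub>K\<^esub> N \<in> S"
      using s(2) t(2) sK tK fs ft a b by auto
    then have "h \<otimes>\<^bsub>K\<^esub> (?x [^]\<^bsub>K\<^esub> i \<otimes>\<^bsub>K\<^esub> ?y [^]\<^bsub>K\<^esub> j) \<in> S" if "i + j = N" for i j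
      using krull_mixed_powers[OF krull hK xK yK, of i j] that by simp
    then have "f \<in> S" using bspec[OF test hK] hu by simp
    then obtain c where c: "c \<in> carrier R" "f = emb c" by auto
    have act: "a = c \<otimes> t" using ft c a t emb_inject[of a "c \<otimes> t"] by (simp add: emb_simps)
    have "b = c \<otimes> s" using fs c b s emb_inject[of b "c \<otimes> s"] by (simp add: emb_simps)
    then show "\<exists>c\<in>carrier R. a = c \<otimes> t \<and> b = c \<otimes> s" using act c by blast
  qed
  then show thesis using that[of N g s t] N g s t xgs ygt by blast
qed

end

section \<open>Finiteness of associated primes\<close>

theorem mainTheorem4:
  fixes R :: "('a, 'r) ring_scheme"
    and E :: "nat \<Rightarrow> ('a, 'e) module" and d :: "nat \<Rightarrow> 'e \<Rightarrow> 'e" and \<epsilon> :: "'a \<Rightarrow> 'e"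
    and x y :: 'a
  assumes "almost_factorial R" and "local_ring R" and "noetherian_ring R"
    and "x \<in> carrier R" and "y \<in> carrier R"
    and "injective_resolution R (ring_module R) \<epsilon> E d"
  shows "finite (ass_primes R (local_cohomology R (Idl\<^bsub>R\<^esub> {x, y}) E d 2))"
proof -
  interpret domain R using assms(1) by (simp add: almost_factorial_def krull_domain_def)
  interpret F: frac_domain R
    by (intro frac_domain.intro domain_axioms frac_field_is_field)
  have "\<exists>N g s t. (N::nat) > 0 \<and> g \<in> carrier R \<and> s \<in> carrier R \<and> t \<in> carrier R \<and>
      x [^]\<^bsub>R\<^esub> N = g \<otimes>\<^bsub>R\<^esub> s \<and> y [^]\<^bsub>R\<^esub> N = g \<otimes>\<^bsub>R\<^esub> t \<and> coprime_pair s t"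
  proof (cases "x = \<zero>\<^bsub>R\<^esub> \<or> y = \<zero>\<^bsub>R\<^esub>")
    case True
    then show ?thesis
    proof
      assume "x = \<zero>\<^bsub>R\<^esub>"
      then show ?thesis using assms(5) coprime_pair_sym[OF coprime_pair_one_zero]
        by (intro exI[of _ 1] exI[of _ y] exI[of _ "\<zero>\<^bsub>R\<^esub>"] exI[of _ "\<one>\<^bsub>R\<^esub>"]) simp
    next
      assume "y = \<zero>\<^bsub>R\<^esub>"
      then show ?thesis using assms(4) coprime_pair_one_zero
        by (intro exI[of _ 1] exI[of _ x] exI[of _ "\<one>\<^bsub>R\<^esub>"] exI[of _ "\<zero>\<^bsub>R\<^esub>"]) simp
    qed
  next
    case False
    then show ?thesis using F.almost_factorial_coprime_power[OF assms(1,4) _ assms(5)] by metis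
  qed
  then obtain N :: nat and g s t where N: "N > 0" and R: "g \<in> carrier R" "s \<in> carrier R" "t \<in> carrier R"
    and eq: "x [^]\<^bsub>R\<^esub> N = g \<otimes>\<^bsub>R\<^esub> s" "y [^]\<^bsub>R\<^esub> N = g \<otimes>\<^bsub>R\<^esub> t" and st: "coprime_pair s t"
    by metis
  interpret coprime_resolution R E d \<epsilon> g s t
    using assms(6) st R by unfold_locales
  show ?thesis
    using finite_subset[OF ass_primes_local_cohomology_subset[OF assms(3,4,5) N eq]] finite_cyclic_ass[OF assms(3)] gen2_ideal R(2,3) by blast
qed

end
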